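(* Let $T>0$, let $1<m,n<\infty$ and $3\le p,q<\infty$ satisfy $\frac2p+\frac1m=1$ and $\frac2q+\frac1n=1$. Let $(v,\omega)$, with vorticity $\omega=\mathrm{curl}\,v$, be a weak solution on $(0,T)\times\mathbb{T}^3$ of the Euler equations $$v_t+v\cdot\nabla v+\nabla\pi=0,\qquad \omega_t+v\cdot\nabla\omega-\omega\cdot\nabla v=0,\qquad \mathrm{div}\,v=\mathrm{div}\,\omega=0,$$ with $\omega\in L^\infty(0,T;L^{3/2}(\mathbb{T}^3))\cap L^m(0,T;L^n(\mathbb{T}^3))$ and $v\in L^p(0,T;L^q(\mathbb{T}^3))$. Assume that, for a.e. $t\in[0,T]$ and all $\ell$ in some neighborhood of the origin, $$\Big(\int_{\mathbb{T}^3}|v(x+\ell,t)-v(x,t)|^{\frac92}dx\Big)^{\frac29}\le C_1(t)^{\frac1{r_1}}|\ell|^\alpha\sigma_1^{\frac13}(\ell),\qquad \Big(\int_{\mathbb{T}^3}|\omega(x+\ell,t)-\omega(x,t)|^{\frac95}dx\Big)^{\frac59}\le C_2(t)^{\frac1{r_2}}|\ell|^\beta\sigma_2^{\frac13}(\ell),$$ with $$\frac2{r_1}+\frac1{r_2}=1,\qquad 1<r_1,r_2<\infty,\qquad 2\alpha+\beta\ge1,$$ where $C_1,C_2$ are (nonnegative) integrable functions on $[0,T]$ and $\sigma_1,\sigma_2$ are (nonnegative) bounded functions on some neighborhood of the origin, and at least one of them satisfies $\sigma_i(\ell)\to0$ as $\ell\to0$. Then the helicity is conserved, i.e. $\int_{\mathbb{T}^3}v(x,t)\cdot\omega(x,t)\,dx$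 is constant in $t$ (for a.e. $t\in(0,T)$).
   Context: $\mathbb{T}^3$ is the three-dimensional torus (functions are extended periodically). Weak solution means that the equations hold in the sense of distributions on $(0,T)\times\mathbb{T}^3$, with nonlinear terms in divergence form, i.e. $(v\cdot\nabla v)_j=\partial_i(v_iv_j)$, $(v\cdot\nabla\omega)_j=\partial_i(v_i\omega_j)$, $(\omega\cdot\nabla v)_j=\partial_i(\omega_iv_j)$, for a scalar pressure $\pi$ (normalized to have zero spatial mean). *)

theory Defs
  imports "HOL-Analysis.Analysis"
begin

text \<open>
  The torus is \<open>\<real>\<^sup>3/\<int>\<^sup>3\<close>. Functions on it are functions on \<open>\<real>\<^sup>3\<close> that have period 1 in every
  coordinate, and integrals over it are integrals over the unit cube.
\<close>

definition torus_cell :: "(real^3) set" where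
  "torus_cell = cbox 0 One"

definition torus_periodic :: "(real^3 \<Rightarrow> 'a) \<Rightarrow> bool" where
  "torus_periodic f \<longleftrightarrow> (\<forall>x i. f (x + axis i 1) = f x)"


subsection \<open>Lebesgue and Bochner--Lebesgue spaces\<close>

definition in_Lq :: "real \<Rightarrow> (real^3 \<Rightarrow> real^3) \<Rightarrow> bool" where
  "in_Lq q f \<longleftrightarrow> f \<in> borel_measurable (lebesgue_on torus_cell) \<and>
     integrable (lebesgue_on torus_cell) (\<lambda>x. norm (f x) powr q)"

definition Lq_norm :: "real \<Rightarrow> (real^3 \<Rightarrow> real^3) \<Rightarrow> real" where
  "Lq_norm q f = (LINT x|lebesgue_on torus_cell. norm (f x) powr q) powr (1 / q)"

text \<open>
  For finite \<open>q\<close>, strongly measurable maps from \<open>(0,T)\<close> to \<open>L\<^sup>q\<close> are, up to null sets, the jointly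
  measurable functions of \<open>(t,x)\<close> whose time slices lie in \<open>L\<^sup>q\<close>.
\<close>

definition jointly_measurable :: "real \<Rightarrow> (real \<Rightarrow> real^3 \<Rightarrow> real^3) \<Rightarrow> bool" where
  "jointly_measurable T f \<longleftrightarrow>
     (\<lambda>(t, x). f t x) \<in> borel_measurable (lebesgue_on ({0<..<T} \<times> torus_cell))"

definition in_LpLq :: "real \<Rightarrow> real \<Rightarrow> real \<Rightarrow> (real \<Rightarrow> real^3 \<Rightarrow> real^3) \<Rightarrow> bool" where
  "in_LpLq T p q f \<longleftrightarrow> jointly_measurable T f \<and>
     (AE t in lebesgue_on {0<..<T}. in_Lq q (f t)) \<and>
     integrable (lebesgue_on {0<..<T}) (\<lambda>t. Lq_norm q (f t) powr p)"

definition in_LinfLq :: "real \<Rightarrow> real \<Rightarrow> (real \<Rightarrow> real^3 \<Rightarrow> real^3) \<Rightarrow> bool" where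
  "in_LinfLq T q f \<longleftrightarrow> jointly_measurable T f \<and>
     (AE t in lebesgue_on {0<..<T}. in_Lq q (f t)) \<and>
     (\<exists>K. AE t in lebesgue_on {0<..<T}. Lq_norm q (f t) \<le> K)"


subsection \<open>Test functions on \<open>(0,T)\<close> times the torus\<close>

primrec iter_deriv :: "'a::real_normed_vector list \<Rightarrow> ('a \<Rightarrow> real) \<Rightarrow> 'a \<Rightarrow> real" where
  "iter_deriv [] f = f"
| "iter_deriv (u # us) f = (\<lambda>z. frechet_derivative (iter_deriv us f) (at z) u)"

definition smooth :: "('a::euclidean_space \<Rightarrow> real) \<Rightarrow> bool" where
  "smooth f \<longleftrightarrow> (\<forall>us. set us \<subseteq> Basis \<longrightarrow> iter_deriv us f differentiable_on UNIV)"

definition test_function :: "real \<Rightarrow> (real \<times> (real^3) \<Rightarrow> real) \<Rightarrow> bool" where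
  "test_function T \<phi> \<longleftrightarrow> smooth \<phi> \<and> (\<forall>t. torus_periodic (\<lambda>x. \<phi> (t, x))) \<and>
     (\<exists>a b. 0 < a \<and> b < T \<and> (\<forall>t x. t \<notin> {a..b} \<longrightarrow> \<phi> (t, x) = 0))"

definition dt :: "(real \<times> (real^3) \<Rightarrow> real) \<Rightarrow> real \<times> (real^3) \<Rightarrow> real" where
  "dt \<phi> z = frechet_derivative \<phi> (at z) (1, 0)"

definition grad :: "(real \<times> (real^3) \<Rightarrow> real) \<Rightarrow> real \<times> (real^3) \<Rightarrow> real^3" where
  "grad \<phi> z = (\<chi> i. frechet_derivative \<phi> (at z) (0, axis i 1))"


subsection \<open>Weak solutions of the Euler equations\<close>

definition locally_integrable ::
    "real \<Rightarrow> (real \<Rightarrow> real^3 \<Rightarrow> 'b::{banach, second_countable_topology}) \<Rightarrow> bool" where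
  "locally_integrable T f \<longleftrightarrow>
     (\<forall>a b. 0 < a \<and> b < T \<longrightarrow>
        integrable (lebesgue_on ({a..b} \<times> torus_cell)) (\<lambda>(t, x). f t x))"

definition spacetime_integral ::
    "real \<Rightarrow> (real \<times> (real^3) \<Rightarrow> 'b::{banach, second_countable_topology}) \<Rightarrow> 'b" where
  "spacetime_integral T F = (LINT z|lebesgue_on ({0<..<T} \<times> torus_cell). F z)"

text \<open>
  A scalar test function is used in vector-valued identities, which hold componentwise. For
  instance, the \<open>j\<close>-th component of \<open>(v \<bullet> grad \<phi>) v\<close> is the sum over \<open>i\<close> of \<open>v\<^sub>i v\<^sub>j \<partial>\<^sub>i \<phi>\<close>.
\<close>

definition weak_momentum ::
    "real \<Rightarrow> (real \<Rightarrow> real^3 \<Rightarrow> real^3) \<Rightarrow> (real \<Rightarrow> real^3 \<Rightarrow> real) \<Rightarrow> bool" where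
  "weak_momentum T v \<pi> \<longleftrightarrow> (\<forall>\<phi>. test_function T \<phi> \<longrightarrow>
     spacetime_integral T (\<lambda>(t, x).
       dt \<phi> (t, x) *\<^sub>R v t x + (v t x \<bullet> grad \<phi> (t, x)) *\<^sub>R v t x
       + \<pi> t x *\<^sub>R grad \<phi> (t, x)) = 0)"

definition weak_vorticity ::
    "real \<Rightarrow> (real \<Rightarrow> real^3 \<Rightarrow> real^3) \<Rightarrow> (real \<Rightarrow> real^3 \<Rightarrow> real^3) \<Rightarrow> bool" where
  "weak_vorticity T v \<omega> \<longleftrightarrow> (\<forall>\<phi>. test_function T \<phi> \<longrightarrow>
     spacetime_integral T (\<lambda>(t, x).
       dt \<phi> (t, x) *\<^sub>R \<omega> t x + (v t x \<bullet> grad \<phi> (t, x)) *\<^sub>R \<omega> t x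
       - (\<omega> t x \<bullet> grad \<phi> (t, x)) *\<^sub>R v t x) = 0)"

definition weak_div_free :: "real \<Rightarrow> (real \<Rightarrow> real^3 \<Rightarrow> real^3) \<Rightarrow> bool" where
  "weak_div_free T f \<longleftrightarrow> (\<forall>\<phi>. test_function T \<phi> \<longrightarrow>
     spacetime_integral T (\<lambda>(t, x). f t x \<bullet> grad \<phi> (t, x)) = 0)"

text \<open>
  The sign comes from integration by parts: the integral of \<open>\<phi> curl v\<close> is minus that of
  \<open>grad \<phi> \<times> v\<close>.
\<close>

definition weak_curl ::
    "real \<Rightarrow> (real \<Rightarrow> real^3 \<Rightarrow> real^3) \<Rightarrow> (real \<Rightarrow> real^3 \<Rightarrow> real^3) \<Rightarrow> bool" where
  "weak_curl T v \<omega> \<longleftrightarrow> (\<forall>\<phi>. test_function T \<phi> \<longrightarrow>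
     spacetime_integral T (\<lambda>(t, x). \<phi> (t, x) *\<^sub>R \<omega> t x)
     = spacetime_integral T (\<lambda>(t, x). cross3 (v t x) (grad \<phi> (t, x))))"

definition euler_weak_solution ::
    "real \<Rightarrow> (real \<Rightarrow> real^3 \<Rightarrow> real^3) \<Rightarrow> (real \<Rightarrow> real^3 \<Rightarrow> real^3) \<Rightarrow> bool" where
  "euler_weak_solution T v \<omega> \<longleftrightarrow>
     (\<forall>t\<in>{0<..<T}. torus_periodic (v t) \<and> torus_periodic (\<omega> t)) \<and>
     locally_integrable T v \<and> locally_integrable T \<omega> \<and>
     (\<forall>i j. locally_integrable T (\<lambda>t x. v t x $ i * v t x $ j) \<and>
            locally_integrable T (\<lambda>t x. v t x $ i * \<omega> t x $ j)) \<and>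
     (\<exists>\<pi>. (\<forall>t\<in>{0<..<T}. torus_periodic (\<pi> t)) \<and> locally_integrable T \<pi> \<and>
          (AE t in lebesgue_on {0<..<T}. has_bochner_integral (lebesgue_on torus_cell) (\<pi> t) 0) \<and>
          weak_momentum T v \<pi>) \<and>
     weak_vorticity T v \<omega> \<and> weak_div_free T v \<and> weak_div_free T \<omega> \<and> weak_curl T v \<omega>"


subsection \<open>Increment bounds\<close>

text \<open>
  Membership in \<open>L\<^sup>s\<close> is required explicitly, because the Bochner integral of a non-integrable
  function is 0. At \<open>l = 0\<close>, where \<open>powr\<close> gives 0 for every exponent, the left-hand side vanishes.
\<close>

definition increment_bound ::
    "real \<Rightarrow> real \<Rightarrow> (real \<Rightarrow> real^3 \<Rightarrow> real^3) \<Rightarrow> real \<Rightarrow> (real \<Rightarrow> real) \<Rightarrow> real \<Rightarrow> real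
      \<Rightarrow> (real^3 \<Rightarrow> real) \<Rightarrow> bool" where
  "increment_bound T s f \<delta> C r \<alpha> \<sigma> \<longleftrightarrow>
     (AE t in lebesgue_on {0..T}. \<forall>l\<in>ball 0 \<delta>.
        in_Lq s (\<lambda>x. f t (x + l) - f t x) \<and>
        Lq_norm s (\<lambda>x. f t (x + l) - f t x)
          \<le> C t powr (1 / r) * norm l powr \<alpha> * \<sigma> l powr (1 / 3))"

end

theory Submission imports Defs begin

text \<open>
  The fields are mollified in space only, with the kernel proportional to
  \<open>\<Prod>\<^sub>i cos (\<pi> x\<^sub>i) ^ (2 N)\<close>. It is a trigonometric polynomial, so \<open>K (x - y)\<close> is a finite sum
  of products \<open>a\<^sub>k x * b\<^sub>k y\<close>, and the mollified helicity, the integral of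
  \<open>K (x - y) * (v x \<bullet> \<omega> y)\<close>, is a finite sum of products of Fourier-type moments of \<open>v\<close> and
  \<open>\<omega>\<close>. These moments have integrable weak time derivatives, hence coincide almost everywhere
  with primitives, and the product rule applies without any regularisation in time. The pressure
  drops out because \<open>\<omega>\<close> is divergence free. As \<open>grad K\<close> is odd and both fields are divergence
  free, the time derivative of the mollified helicity is a combination of integrals of
  \<open>grad K (x - y)\<close> against two increments of \<open>v\<close> and one of \<open>\<omega>\<close>. Hoelder's inequality with exponents
  9/2, 9/2, 9/5 and the uniform bound on the first moment of \<open>grad K\<close> make it vanish in the
  limit. The same trilinear increments control the convergence of the mollified helicity itself,
  since \<open>\<bar>\<delta>v\<bar> \<bar>\<delta>\<omega>\<bar> \<le> \<eta> \<bar>\<delta>\<omega>\<bar> + \<bar>\<delta>v\<bar>\<^sup>2 \<bar>\<delta>\<omega>\<bar> / \<eta>\<close>.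
\<close>


subsection \<open>Smooth functions\<close>

text \<open>The pressure is only locally integrable and admits no estimate, so it must cancel
  exactly before any inequality enters. The price of a trigonometric kernel is that it is not
  supported near the origin. The far part is paid by an exponentially small tail times the
  integrability of |v|^2 |\<omega>| over space and time, which 2/q + 1/n = 1 and 2/p + 1/m = 1
  provide. The near part uses the increment hypotheses: |l| to the power 2 \<alpha> + \<beta> is at
  most |l|, and the first moment of grad K is bounded because the kernel has width of order N^(-1/2)
  while its gradient has L1 norm of order N^(1/2). In time, C1^(2/r1) C2^(1/r2) is at most C1 + C2.
  Every error thus is \<epsilon> times an integrable function of t plus a tail, depending on
  \<epsilon> and N only, times another one: \<sigma>1 and \<sigma>2 do not depend on t, so neither
  does the radius chosen for \<epsilon>. Helicity is not known to be continuous in time; its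
  constancy follows because one numerical sequence converges to it at almost every t.\<close>

lemma iter_deriv_snoc:
  "iter_deriv (us @ [u]) f = iter_deriv us (\<lambda>z. frechet_derivative f (at z) u)"
  by (induction us) auto

text \<open>Replaces inductions over lists of derivatives: a closure property of
  \<open>smooth\<close> reduces to naming a class of differentiable functions that is stable under
  one partial derivative.\<close>

lemma smooth_coinduct:
  fixes f :: "'a::euclidean_space \<Rightarrow> real"
  assumes "P f"
    and "\<And>g. P g \<Longrightarrow> g differentiable_on UNIV"
    and "\<And>g u. P g \<Longrightarrow> u \<in> Basis \<Longrightarrow> P (\<lambda>z. frechet_derivative g (at z) u)"
  shows "smooth f"
proof -
  have "P (iter_deriv us f)" if "set us \<subseteq> Basis" for us
    using that by (induction us) (auto intro: assms)
  then show ?thesis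
    using assms(2) unfolding smooth_def by blast
qed

lemma smooth_differentiable: "smooth f \<Longrightarrow> f differentiable (at z)"
  unfolding smooth_def differentiable_on_def by (elim allE[of _ "[]"]) simp

lemma smooth_has_derivative: "smooth f \<Longrightarrow> (f has_derivative frechet_derivative f (at z)) (at z)"
  using smooth_differentiable frechet_derivative_works by blast

text \<open>\<open>iter_deriv\<close> applies further derivatives on the outside, whereas this one
  is the innermost; appending it to the end of the list puts it there.\<close>

lemma smooth_frechet_derivative_Basis:
  assumes "smooth f" "u \<in> Basis"
  shows "smooth (\<lambda>z. frechet_derivative f (at z) u)"
  unfolding smooth_def
proof (intro allI impI)
  fix us :: "'a list" assume "set us \<subseteq> Basis"
  then have "set (us @ [u]) \<subseteq> Basis" using assms(2) by simp
  then show "iter_deriv us (\<lambda>z. frechet_derivative f (at z) u) differentiable_on UNIV"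
    using assms(1) unfolding smooth_def iter_deriv_snoc[symmetric] by blast
qed

lemma smooth_continuous: "smooth f \<Longrightarrow> continuous_on A f"
  by (meson continuous_at_imp_continuous_on differentiable_imp_continuous_within smooth_differentiable)

lemma smooth_const: "smooth (\<lambda>z. c)"
  by (rule smooth_coinduct[where P = "\<lambda>g. \<exists>c. g = (\<lambda>z. c)"]) auto

lemma frechet_derivative_eq: "(f has_derivative f') (at z) \<Longrightarrow> frechet_derivative f (at z) = f'"
  by (metis frechet_derivative_at)

lemma smooth_add:
  fixes f g :: "'a::euclidean_space \<Rightarrow> real"
  assumes "smooth f" "smooth g"
  shows "smooth (\<lambda>z. f z + g z)"
proof (rule smooth_coinduct[where P = "\<lambda>h. \<exists>f g. smooth f \<and> smooth g \<and> h = (\<lambda>z. f z + g z)"])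
  show "\<exists>f' g'. smooth f' \<and> smooth g' \<and> (\<lambda>z. f z + g z) = (\<lambda>z. f' z + g' z)"
    using assms by blast
next
  fix h assume "\<exists>f g. smooth f \<and> smooth g \<and> h = (\<lambda>z::'a. f z + g z)"
  then obtain f g where fg: "smooth f" "smooth g" "h = (\<lambda>z::'a. f z + g z)" by blast
  have d: "(h has_derivative (\<lambda>u. frechet_derivative f (at z) u + frechet_derivative g (at z) u)) (at z)" for z
    unfolding fg(3) by (intro has_derivative_add smooth_has_derivative fg)
  then show "h differentiable_on UNIV"
    unfolding differentiable_on_def using differentiableI by fastforce
  fix u :: 'a assume "u \<in> Basis"
  then show "\<exists>f g. smooth f \<and> smooth g \<and> (\<lambda>z. frechet_derivative h (at z) u) = (\<lambda>z. f z + g z)"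
    unfolding frechet_derivative_eq[OF d] using fg smooth_frechet_derivative_Basis by blast
qed

text \<open>The Leibniz rule leads to sums of products, so the coinduction runs over all finite such sums.\<close>

lemma smooth_mult:
  fixes f g :: "'a::euclidean_space \<Rightarrow> real"
  assumes "smooth f" "smooth g"
  shows "smooth (\<lambda>z. f z * g z)"
proof (rule smooth_coinduct[where P = "\<lambda>h. \<exists>xs. (\<forall>(f, g)\<in>set xs. smooth f \<and> smooth g) \<and>
      h = (\<lambda>z. \<Sum>(f, g)\<leftarrow>xs. f z * g z)"])
  show "\<exists>xs. (\<forall>(f, g)\<in>set xs. smooth f \<and> smooth g) \<and>
      (\<lambda>z. f z * g z) = (\<lambda>z. \<Sum>(f, g)\<leftarrow>xs. f z * g z)"
    using assms by (intro exI[of _ "[(f, g)]"]) auto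
next
  fix h :: "'a \<Rightarrow> real"
  assume "\<exists>xs. (\<forall>(f, g)\<in>set xs. smooth f \<and> smooth g) \<and> h = (\<lambda>z. \<Sum>(f, g)\<leftarrow>xs. f z * g z)"
  then obtain xs where xs: "\<forall>(f, g)\<in>set xs. smooth f \<and> smooth g"
    and h: "h = (\<lambda>z. \<Sum>(f, g)\<leftarrow>xs. f z * g z)" by blast
  have d: "(h has_derivative (\<lambda>u. \<Sum>(f, g)\<leftarrow>xs. f z * frechet_derivative g (at z) u
      + frechet_derivative f (at z) u * g z)) (at z)" for z
    using xs unfolding h
  proof (induction xs)
    case (Cons a xs)
    then show ?case
      by (auto simp: case_prod_beta intro!: has_derivative_add has_derivative_mult smooth_has_derivative)
  qed simp
  then show "h differentiable_on UNIV"
    unfolding differentiable_on_def using differentiableI by fastforce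
  fix u :: 'a assume u: "u \<in> Basis"
  define ys where "ys = concat (map (\<lambda>(f, g). [(f, \<lambda>z. frechet_derivative g (at z) u),
     ((\<lambda>z. frechet_derivative f (at z) u), g)]) xs)"
  have "\<forall>(f, g)\<in>set ys. smooth f \<and> smooth g"
    using xs u by (auto simp: ys_def intro: smooth_frechet_derivative_Basis)
  moreover have "(\<lambda>z. frechet_derivative h (at z) u) = (\<lambda>z. \<Sum>(f, g)\<leftarrow>ys. f z * g z)"
    unfolding frechet_derivative_eq[OF d] ys_def by (induction xs) (auto simp: fun_eq_iff)
  ultimately show "\<exists>xs. (\<forall>(f, g)\<in>set xs. smooth f \<and> smooth g) \<and>
      (\<lambda>z. frechet_derivative h (at z) u) = (\<lambda>z. \<Sum>(f, g)\<leftarrow>xs. f z * g z)" by blast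
qed

text \<open>The chain rule turns the derivative in direction u into the one in direction L u, and
  \<open>smooth\<close> speaks of basis directions only; so L may merely send basis vectors to basis
  vectors or to 0. Projections do.\<close>

lemma smooth_compose_projection:
  fixes f :: "'b::euclidean_space \<Rightarrow> real" and L :: "'a::euclidean_space \<Rightarrow> 'b"
  assumes "smooth f" and L: "bounded_linear L" and B: "\<And>u. u \<in> Basis \<Longrightarrow> L u \<in> Basis \<or> L u = 0"
  shows "smooth (\<lambda>z. f (L z))"
proof (rule smooth_coinduct[where P = "\<lambda>h. \<exists>f. smooth f \<and> h = (\<lambda>z. f (L z))"])
  show "\<exists>f'. smooth f' \<and> (\<lambda>z. f (L z)) = (\<lambda>z. f' (L z))"
    using assms by blast
next
  fix h assume "\<exists>f. smooth f \<and> h = (\<lambda>z. f (L z))"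
  then obtain f where f: "smooth f" "h = (\<lambda>z. f (L z))" by blast
  have d: "(h has_derivative (\<lambda>u. frechet_derivative f (at (L z)) (L u))) (at z)" for z
    unfolding f(2)
    by (rule has_derivative_compose[OF bounded_linear_imp_has_derivative[OF L] smooth_has_derivative[OF f(1)]])
  then show "h differentiable_on UNIV"
    unfolding differentiable_on_def using differentiableI by fastforce
  fix u :: 'a assume "u \<in> Basis"
  from B[OF this] show "\<exists>f. smooth f \<and> (\<lambda>z. frechet_derivative h (at z) u) = (\<lambda>z. f (L z))"
  proof
    assume "L u = 0"
    then show ?thesis unfolding frechet_derivative_eq[OF d]
      using smooth_const[of 0] linear_0[OF linear_frechet_derivative[OF smooth_differentiable[OF f(1)]]]
      by (intro exI[of _ "\<lambda>_. 0"]) auto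
  next
    assume "L u \<in> Basis"
    then show ?thesis
      unfolding frechet_derivative_eq[OF d] using smooth_frechet_derivative_Basis[OF f(1)] by blast
  qed
qed

lemma smooth_fst: "smooth f \<Longrightarrow> smooth (\<lambda>z::'a::euclidean_space \<times> 'b::euclidean_space. f (fst z))"
  by (rule smooth_compose_projection[OF _ bounded_linear_fst]) (auto simp: Basis_prod_def)

lemma smooth_snd: "smooth f \<Longrightarrow> smooth (\<lambda>z::'a::euclidean_space \<times> 'b::euclidean_space. f (snd z))"
  by (rule smooth_compose_projection[OF _ bounded_linear_snd]) (auto simp: Basis_prod_def)

text \<open>The span of cos and sin at one frequency is stable under differentiation, while neither
  function is stable alone; hence both are carried together.\<close>

lemma smooth_trig_component:
  fixes i :: "'n::finite"
  shows "smooth (\<lambda>x::real^'n. A * cos (c * x $ i) + B * sin (c * x $ i))"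
proof (rule smooth_coinduct[where P = "\<lambda>h. \<exists>A B. h = (\<lambda>x::real^'n. A * cos (c * x $ i) + B * sin (c * x $ i))"])
  fix h assume "\<exists>A B. h = (\<lambda>x::real^'n. A * cos (c * x $ i) + B * sin (c * x $ i))"
  then obtain A B where h: "h = (\<lambda>x::real^'n. A * cos (c * x $ i) + B * sin (c * x $ i))" by blast
  have d: "(h has_derivative (\<lambda>u. (c * B * u $ i) * cos (c * x $ i) + (- c * A * u $ i) * sin (c * x $ i))) (at x)" for x
    unfolding h by (auto intro!: derivative_eq_intros bounded_linear_imp_has_derivative bounded_linear_vec_nth simp: algebra_simps)
  then show "h differentiable_on UNIV"
    unfolding differentiable_on_def using differentiableI by fastforce
  fix u :: "real^'n"
  show "\<exists>A B. (\<lambda>z. frechet_derivative h (at z) u) = (\<lambda>x::real^'n. A * cos (c * x $ i) + B * sin (c * x $ i))"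
    unfolding frechet_derivative_eq[OF d] by blast
qed blast

lemma smooth_realI:
  fixes f :: "real \<Rightarrow> real"
  assumes "P f" and "\<And>g. P g \<Longrightarrow> \<exists>g'. P g' \<and> (\<forall>t. (g has_real_derivative g' t) (at t))"
  shows "smooth f"
proof (rule smooth_coinduct[where P = P])
  fix g assume "P g"
  then obtain g' where g': "P g'" and d: "\<And>t. (g has_real_derivative g' t) (at t)" using assms(2) by blast
  then show "g differentiable_on UNIV"
    unfolding differentiable_on_def by (meson UNIV_I field_differentiable_def field_differentiable_imp_differentiable differentiable_at_withinI)
  fix u :: real assume "u \<in> Basis"
  then have "u = 1" by simp
  have "frechet_derivative g (at t) = (*) (g' t)" for t
    by (rule frechet_derivative_eq) (use d[of t] in \<open>simp add: has_field_derivative_def\<close>)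
  then show "P (\<lambda>z. frechet_derivative g (at z) u)" using g' \<open>u = 1\<close> by simp
qed fact

lemma smooth_real_has_derivative:
  fixes f :: "real \<Rightarrow> real"
  assumes "smooth f"
  shows "\<exists>f'. smooth f' \<and> (\<forall>t. (f has_real_derivative f' t) (at t))"
proof (intro exI conjI allI)
  show "smooth (\<lambda>t. frechet_derivative f (at t) 1)"
    using assms smooth_frechet_derivative_Basis by force
  fix t
  have "frechet_derivative f (at t) = (\<lambda>s. frechet_derivative f (at t) (s *\<^sub>R 1))" by simp
  also have "\<dots> = (\<lambda>s. s *\<^sub>R frechet_derivative f (at t) 1)"
    by (simp only: linear_cmul[OF linear_frechet_derivative[OF smooth_differentiable[OF assms]]])
  finally have "frechet_derivative f (at t) = (\<lambda>s. s * frechet_derivative f (at t) 1)" by simp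
  then show "(f has_real_derivative frechet_derivative f (at t) 1) (at t)"
    using smooth_has_derivative[OF assms, of t] by (metis has_derivative_imp_has_field_derivative)
qed

text \<open>The class consisting of f and of all smooth functions is stable, since f is sent to the
  smooth function g. This makes primitives of bumps available as test functions.\<close>

lemma smooth_antiderivative:
  fixes f g :: "real \<Rightarrow> real"
  assumes "smooth g" "\<And>t. (f has_real_derivative g t) (at t)"
  shows "smooth f"
proof (rule smooth_realI[where P = "\<lambda>h. h = f \<or> smooth h"])
  fix h assume "h = f \<or> smooth h"
  then show "\<exists>g'. (g' = f \<or> smooth g') \<and> (\<forall>t. (h has_real_derivative g' t) (at t))"
  proof
    assume "h = f"
    then show ?thesis using assms by blast
  next
    assume "smooth h"
    then show ?thesis using smooth_real_has_derivative by blast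
  qed
qed simp

subsection \<open>Bump functions\<close>

text \<open>The parameter k records the negative powers of s that differentiation of exp(-1/s)
  produces, so that the linear span of the family is stable under derivatives.\<close>

definition flat_exp :: "nat \<Rightarrow> real \<Rightarrow> real" where
  "flat_exp k s = (if s \<le> 0 then 0 else exp (- inverse s) * inverse s ^ k)"

lemma flat_exp_tendsto_0: "(flat_exp k \<longlongrightarrow> 0) (at 0)"
proof -
  have "((\<lambda>s. inverse s ^ k / exp (inverse s)) \<longlongrightarrow> (0::real)) (at_right 0)"
    using tendsto_power_div_exp_0 filterlim_inverse_at_top_right by (rule filterlim_compose)
  then have "(flat_exp k \<longlongrightarrow> 0) (at_right 0)"
    by (rule Lim_transform_eventually)
       (auto simp: flat_exp_def eventually_at_filter exp_minus field_simps)
  moreover have "(flat_exp k \<longlongrightarrow> 0) (at_left 0)"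
    by (rule tendsto_eventually) (auto simp: flat_exp_def eventually_at_filter)
  ultimately show ?thesis
    by (simp add: filterlim_split_at)
qed

lemma flat_exp_has_derivative:
  "(flat_exp k has_real_derivative (- real k * flat_exp (Suc k) s + flat_exp (k + 2) s)) (at s)"
proof -
  consider "s < 0" | "s = 0" | "s > 0" by linarith
  then show ?thesis
  proof cases
    case 1
    have "((\<lambda>s. 0) has_real_derivative (- real k * flat_exp (Suc k) s + flat_exp (k + 2) s)) (at s)"
      using 1 by (simp add: flat_exp_def)
    then show ?thesis
      by (rule has_field_derivative_transform_within_open[where S = "{..<0}"]) (use 1 in \<open>auto simp: flat_exp_def\<close>)
  next
    case 2
    \<comment> \<open>The difference quotient at 0 is \<open>flat_exp (Suc k)\<close> itself, whose
      limit at 0 is known.\<close>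
    have "((\<lambda>h. (flat_exp k (0 + h) - flat_exp k 0) / h) \<longlongrightarrow> 0) (at 0)"
      by (rule Lim_transform_eventually[OF flat_exp_tendsto_0[of "Suc k"]])
         (auto simp: flat_exp_def eventually_at_filter field_simps)
    then show ?thesis
      using 2 by (simp add: DERIV_def flat_exp_def)
  next
    case 3
    have "((\<lambda>s. exp (- inverse s) * inverse s ^ k) has_real_derivative
        (- real k * flat_exp (Suc k) s + flat_exp (k + 2) s)) (at s)"
    proof -
      \<comment> \<open>At k = 0 the truncated exponent \<open>k - Suc 0\<close> is wrong by one,
        but the factor \<open>real k\<close> vanishes there.\<close>
      have k: "real k * inverse s ^ (k - Suc 0) * inverse s = real k * inverse s ^ k" by (cases k) auto
      have "((\<lambda>s. exp (- inverse s) * inverse s ^ k) has_real_derivative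
        (exp (- inverse s) * (inverse s * inverse s) * inverse s ^ k
          + (real k * inverse s ^ (k - Suc 0) * - (inverse s * inverse s)) * exp (- inverse s))) (at s)"
        using 3 by (auto intro!: derivative_eq_intros)
      also have "exp (- inverse s) * (inverse s * inverse s) * inverse s ^ k
          + (real k * inverse s ^ (k - Suc 0) * - (inverse s * inverse s)) * exp (- inverse s)
        = exp (- inverse s) * (inverse s * inverse s) * inverse s ^ k
          - (real k * inverse s ^ (k - Suc 0) * inverse s) * inverse s * exp (- inverse s)"
        by (simp add: algebra_simps)
      also have "\<dots> = - real k * flat_exp (Suc k) s + flat_exp (k + 2) s"
        unfolding k using 3 by (simp add: flat_exp_def algebra_simps)
      finally show ?thesis .
    qed
    then show ?thesis
      by (rule has_field_derivative_transform_within_open[where S = "{0<..}"]) (use 3 in \<open>auto simp: flat_exp_def\<close>)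
  qed
qed

lemma smooth_flat_exp: "smooth (flat_exp k)"
proof (rule smooth_realI[where P = "\<lambda>g. \<exists>xs. g = (\<lambda>s. \<Sum>(c, k)\<leftarrow>xs. c * flat_exp k s)"])
  show "\<exists>xs. flat_exp k = (\<lambda>s. \<Sum>(c, k)\<leftarrow>xs. c * flat_exp k s)"
    by (intro exI[of _ "[(1, k)]"]) auto
next
  fix g :: "real \<Rightarrow> real" assume "\<exists>xs. g = (\<lambda>s. \<Sum>(c, k)\<leftarrow>xs. c * flat_exp k s)"
  then obtain xs where g: "g = (\<lambda>s. \<Sum>(c, k)\<leftarrow>xs. c * flat_exp k s)" by blast
  define ys where "ys = concat (map (\<lambda>(c, k). [(- real k * c, Suc k), (c, k + 2)]) xs)"
  have "(g has_real_derivative (\<Sum>(c, k)\<leftarrow>ys. c * flat_exp k s)) (at s)" for s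
    unfolding g ys_def
  proof (induction xs)
    case (Cons a xs)
    obtain c k where a: "a = (c, k)" by fastforce
    show ?case
      using DERIV_add[OF DERIV_cmult[OF flat_exp_has_derivative[of k s], of c] Cons]
      by (simp add: a algebra_simps)
  qed simp
  then show "\<exists>g'. (\<exists>xs. g' = (\<lambda>s. \<Sum>(c, k)\<leftarrow>xs. c * flat_exp k s)) \<and> (\<forall>t. (g has_real_derivative g' t) (at t))"
    by blast
qed

lemma smooth_real_affine:
  fixes f :: "real \<Rightarrow> real"
  assumes "smooth f"
  shows "smooth (\<lambda>t. f (a * t + b))"
\<comment> \<open>The factor A absorbs the powers of a that the chain rule produces.\<close>
proof (rule smooth_realI[where P = "\<lambda>h. \<exists>A f. smooth f \<and> h = (\<lambda>t. A * f (a * t + b))"])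
  show "\<exists>A f'. smooth f' \<and> (\<lambda>t. f (a * t + b)) = (\<lambda>t. A * f' (a * t + b))"
    using assms by (intro exI[of _ 1] exI[of _ f]) auto
next
  fix h assume "\<exists>A f. smooth f \<and> h = (\<lambda>t. A * f (a * t + b))"
  then obtain A f where f: "smooth f" and h: "h = (\<lambda>t. A * f (a * t + b))" by blast
  obtain f' where f': "smooth f'" "\<And>t. (f has_real_derivative f' t) (at t)"
    using smooth_real_has_derivative[OF f] by blast
  have "(h has_real_derivative (A * a) * f' (a * t + b)) (at t)" for t
    unfolding h by (auto intro!: derivative_eq_intros DERIV_chain'[OF _ f'(2)])
  then show "\<exists>g'. (\<exists>A f. smooth f \<and> g' = (\<lambda>t. A * f (a * t + b))) \<and> (\<forall>t. (h has_real_derivative g' t) (at t))"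
    using f' by (intro exI[of _ "\<lambda>t. (A * a) * f' (a * t + b)"]) blast
qed

text \<open>A smooth function that is positive exactly inside the interval (for n > 0), stays below
  1 and steepens to the indicator of the interval as n grows. Dominated convergence thus passes from
  smooth test functions to integrals over intervals.\<close>

definition bump :: "real \<Rightarrow> real \<Rightarrow> nat \<Rightarrow> real \<Rightarrow> real" where
  "bump x y n t = flat_exp 0 (real n * t + real n * (- x)) * flat_exp 0 ((- real n) * t + real n * y)"

lemma smooth_bump: "smooth (bump x y n)"
  unfolding bump_def by (intro smooth_mult smooth_real_affine smooth_flat_exp)

lemma flat_exp_0_bounds: "0 \<le> flat_exp 0 s" "flat_exp 0 s \<le> 1"
  by (auto simp: flat_exp_def)

lemma bump_bounds: "0 \<le> bump x y n t" "bump x y n t \<le> 1"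
  unfolding bump_def using flat_exp_0_bounds by (auto intro: mult_le_one)

lemma bump_outside: "t \<notin> {x<..<y} \<Longrightarrow> bump x y n t = 0"
  using mult_left_mono[of t x "real n"] mult_left_mono[of y t "real n"]
  by (auto simp: bump_def flat_exp_def not_less)

lemma bump_pos: "t \<in> {x<..<y} \<Longrightarrow> n > 0 \<Longrightarrow> bump x y n t > 0"
  by (auto simp: bump_def flat_exp_def algebra_simps zero_less_mult_iff not_le)

lemma flat_exp_0_limit:
  assumes "c > 0"
  shows "(\<lambda>n. flat_exp 0 (real n * c)) \<longlonglongrightarrow> 1"
proof -
  have "filterlim (\<lambda>n. real n * c) at_top sequentially"
    using assms by (intro filterlim_at_top_mult_tendsto_pos[OF tendsto_const] filterlim_real_sequentially) auto
  then have "(\<lambda>n. exp (- inverse (real n * c))) \<longlonglongrightarrow> exp (- 0)"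
    by (intro tendsto_exp tendsto_minus tendsto_inverse_0_at_top)
  moreover have "\<forall>\<^sub>F n in sequentially. exp (- inverse (real n * c)) = flat_exp 0 (real n * c)"
    using assms by (auto simp: flat_exp_def eventually_sequentially mult_le_0_iff intro!: exI[of _ 1])
  ultimately show ?thesis
    by (simp add: Lim_transform_eventually)
qed

lemma bump_tendsto: "(\<lambda>n. bump x y n t) \<longlonglongrightarrow> indicator {x<..<y} t"
proof (cases "t \<in> {x<..<y}")
  case True
  have "(\<lambda>n. flat_exp 0 (real n * (t - x)) * flat_exp 0 (real n * (y - t))) \<longlonglongrightarrow> 1 * 1"
    using True by (intro tendsto_mult flat_exp_0_limit) auto
  then show ?thesis
    using True by (simp add: bump_def algebra_simps)
qed (simp add: bump_outside)

subsection \<open>Functions with an integrable weak derivative\<close>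

lemma integral_lebesgue_on_subset:
  fixes f :: "'a::euclidean_space \<Rightarrow> 'b::{banach, second_countable_topology}"
  assumes "A \<subseteq> B" "A \<in> sets lebesgue" "B \<in> sets lebesgue"
  shows "integral\<^sup>L (lebesgue_on A) f = (LINT x|lebesgue_on B. indicator A x *\<^sub>R f x)"
  using assms by (simp add: integral_restrict_space) (rule Bochner_Integration.integral_cong, auto simp: indicator_def)

lemma integrable_lebesgue_on_subset:
  fixes f :: "'a::euclidean_space \<Rightarrow> 'b::{banach, second_countable_topology}"
  assumes "integrable (lebesgue_on B) f" "A \<subseteq> B" "A \<in> sets lebesgue" "B \<in> sets lebesgue"
  shows "integrable (lebesgue_on A) f"
proof -
  have "integrable lebesgue (\<lambda>x. indicat_real A x *\<^sub>R (indicat_real B x *\<^sub>R f x))"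
    by (rule integrable_mult_indicator) (use assms in \<open>auto simp: integrable_restrict_space\<close>)
  also have "(\<lambda>x. indicator A x *\<^sub>R (indicator B x *\<^sub>R f x)) = (\<lambda>x. indicat_real A x *\<^sub>R f x)"
    using assms by (auto simp: fun_eq_iff indicator_def)
  finally show ?thesis using assms by (auto simp: integrable_restrict_space)
qed

lemma integral_lebesgue_on_Icc_eq_lborel:
  fixes f :: "real \<Rightarrow> real"
  assumes "continuous_on UNIV f"
  shows "integral\<^sup>L (lebesgue_on {a..b}) f = integral\<^sup>L lborel (\<lambda>x. indicator {a .. b} x *\<^sub>R f x)"
  using borel_measurable_continuous_onI[OF assms]
  by (subst integral_restrict_space) (auto intro!: integral_completion)

lemma integrable_lebesgue_on_continuous:
  fixes f :: "'a::euclidean_space \<Rightarrow> 'b::{banach, second_countable_topology}"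
  assumes "continuous_on UNIV f"
  shows "integrable (lebesgue_on (cbox a b)) f"
proof -
  have "integrable lborel (\<lambda>x. indicator (cbox a b) x *\<^sub>R f x)"
    by (rule borel_integrable_compact) (auto intro: continuous_on_subset[OF assms])
  then have "integrable lebesgue (\<lambda>x. indicator (cbox a b) x *\<^sub>R f x)"
    by (subst integrable_completion) auto
  then show ?thesis by (subst integrable_restrict_space) auto
qed

lemma integrable_indefinite_integral:
  fixes f :: "real \<Rightarrow> real"
  assumes f: "integrable (lebesgue_on {a..b}) f"
  shows "(\<lambda>t. integral\<^sup>L (lebesgue_on {a..t}) f) \<in> borel_measurable (lebesgue_on {a..b})"
    and "t \<in> {a..b} \<Longrightarrow> \<bar>integral\<^sup>L (lebesgue_on {a..t}) f\<bar> \<le> (LINT s|lebesgue_on {a..b}. \<bar>f s\<bar>)"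
proof -
  define M where "M = lebesgue_on {a..b}"
  interpret M: finite_measure M unfolding M_def by (rule finite_measure_lebesgue_on) simp
  have fm[measurable]: "f \<in> borel_measurable M" using f by (auto simp: M_def)
  have id[measurable]: "(\<lambda>x. x) \<in> borel_measurable M" unfolding M_def by (metis id_borel_measurable_lebesgue_on id_def eq_id_iff)
  \<comment> \<open>The variable upper limit is moved into the integrand; then measurability in t is
    that of a partial integral of a jointly measurable function.\<close>
  have eq: "integral\<^sup>L (lebesgue_on {a..t}) f = (LINT s|M. (if s \<le> t then f s else 0))" if "t \<in> {a..b}" for t
    unfolding M_def using that
    by (subst integral_lebesgue_on_subset[of "{a..t}" "{a..b}"]) (auto intro!: Bochner_Integration.integral_cong)
  have "(\<lambda>t. LINT s|M. (if s \<le> t then f s else 0)) \<in> borel_measurable M"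
    by (rule M.borel_measurable_lebesgue_integral) measurable
  then show "(\<lambda>t. integral\<^sup>L (lebesgue_on {a..t}) f) \<in> borel_measurable (lebesgue_on {a..b})"
    unfolding M_def by (rule measurable_lebesgue_cong[THEN iffD1, rotated]) (simp add: eq[unfolded M_def])
  assume t: "t \<in> {a..b}"
  show "\<bar>integral\<^sup>L (lebesgue_on {a..t}) f\<bar> \<le> (LINT s|lebesgue_on {a..b}. \<bar>f s\<bar>)"
    unfolding eq[OF t] M_def[symmetric] 
    using f by (intro order_trans[OF integral_abs_bound] integral_mono_AE') (auto simp: M_def)
qed

lemma integrable_mult_indefinite_integral:
  fixes f g :: "real \<Rightarrow> real"
  assumes f: "integrable (lebesgue_on {a..b}) f" and g: "integrable (lebesgue_on {a..b}) g"
  shows "integrable (lebesgue_on {a..b}) (\<lambda>t. g t * integral\<^sup>L (lebesgue_on {a..t}) f)"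
proof (rule Bochner_Integration.integrable_bound)
  show "integrable (lebesgue_on {a..b}) (\<lambda>t. (LINT s|lebesgue_on {a..b}. \<bar>f s\<bar>) * g t)"
    using g by simp
  show "(\<lambda>t. g t * integral\<^sup>L (lebesgue_on {a..t}) f) \<in> borel_measurable (lebesgue_on {a..b})"
    using integrable_indefinite_integral(1)[OF f] g by (intro borel_measurable_times) auto
  show "AE t in lebesgue_on {a..b}. norm (g t * integral\<^sup>L (lebesgue_on {a..t}) f)
     \<le> norm ((LINT s|lebesgue_on {a..b}. \<bar>f s\<bar>) * g t)"
    using integrable_indefinite_integral(2)[OF f]
    
    by (intro AE_I2) (simp add: abs_mult mult.commute[of "\<bar>g _\<bar>"] mult_right_mono order_trans[OF _ abs_ge_self])
qed

text \<open>Fubini on the square, cut along its diagonal.\<close>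

lemma integral_by_parts_indefinite:
  fixes f g :: "real \<Rightarrow> real"
  assumes f: "integrable (lebesgue_on {a..b}) f" and g: "integrable (lebesgue_on {a..b}) g"
  shows "(LINT t|lebesgue_on {a..b}. f t * integral\<^sup>L (lebesgue_on {a..t}) g + g t * integral\<^sup>L (lebesgue_on {a..t}) f)
     = integral\<^sup>L (lebesgue_on {a..b}) f * integral\<^sup>L (lebesgue_on {a..b}) g"
proof -
  define M where "M = lebesgue_on {a..b}"
  interpret M: finite_measure M unfolding M_def by (rule finite_measure_lebesgue_on) simp
  interpret P: pair_sigma_finite M M ..
  have [measurable]: "f \<in> borel_measurable M" "g \<in> borel_measurable M" using f g by (auto simp: M_def)
  have id[measurable]: "(\<lambda>x. x) \<in> borel_measurable M" unfolding M_def by (metis id_borel_measurable_lebesgue_on id_def eq_id_iff)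
  have null: "AE s in M. s \<noteq> t" for t
    unfolding M_def by (rule AE_restrict_space_iff[THEN iffD2]) (auto intro: AE_mp[OF AE_completion[OF AE_lborel_singleton[of t]]])
  have eq: "integral\<^sup>L (lebesgue_on {a..t}) h = (LINT s|M. (if s \<le> t then h s else 0))"
    if "t \<in> {a..b}" for t and h :: "real \<Rightarrow> real"
    unfolding M_def using that
    by (subst integral_lebesgue_on_subset[of "{a..t}" "{a..b}"]) (auto intro!: Bochner_Integration.integral_cong)
  \<comment> \<open>The square is cut into r \<le> s and s < r, so one of the two primitives appears
    with the strict inequality; a single point has measure zero.\<close>
  have eq': "integral\<^sup>L (lebesgue_on {a..t}) f = (LINT s|M. (if s < t then f s else 0))"
    if "t \<in> {a..b}" for t
    unfolding eq[OF that]
  proof (rule integral_cong_AE)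
    show "AE s in M. (if s \<le> t then f s else 0) = (if s < t then f s else 0)"
      using null[of t] by eventually_elim auto
  qed measurable
  have fg: "integrable (M \<Otimes>\<^sub>M M) (\<lambda>(s, r). f s * g r)"
  proof (rule P.Fubini_integrable)
    have "integrable M (\<lambda>s. \<bar>f s\<bar> * (LINT r|M. \<bar>g r\<bar>))" using f by (auto simp: M_def)
    then show "integrable M (\<lambda>s. LINT r|M. norm (case (s, r) of (s, r) \<Rightarrow> f s * g r))"
      by (simp add: abs_mult)
    show "AE s in M. integrable M (\<lambda>r. case (s, r) of (s, r) \<Rightarrow> f s * g r)"
      using g by (simp add: M_def)
  qed measurable
  have i1: "integrable (M \<Otimes>\<^sub>M M) (\<lambda>(s, r). if r \<le> s then f s * g r else 0)"
    by (rule Bochner_Integration.integrable_bound[OF fg]) auto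
  have i2: "integrable (M \<Otimes>\<^sub>M M) (\<lambda>(s, r). if s < r then f s * g r else 0)"
    by (rule Bochner_Integration.integrable_bound[OF fg]) auto
  have "integral\<^sup>L M f * integral\<^sup>L M g = (LINT s|M. LINT r|M. f s * g r)"
    by simp
  also have "\<dots> = integral\<^sup>L (M \<Otimes>\<^sub>M M) (\<lambda>(s, r). f s * g r)"
    using P.integral_fst'[OF fg] by simp
  also have "\<dots> = integral\<^sup>L (M \<Otimes>\<^sub>M M) (\<lambda>z. (case z of (s, r) \<Rightarrow> if r \<le> s then f s * g r else 0)
      + (case z of (s, r) \<Rightarrow> if s < r then f s * g r else 0))"
    by (rule Bochner_Integration.integral_cong) auto
  also have "\<dots> = integral\<^sup>L (M \<Otimes>\<^sub>M M) (\<lambda>(s, r). if r \<le> s then f s * g r else 0)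
      + integral\<^sup>L (M \<Otimes>\<^sub>M M) (\<lambda>(s, r). if s < r then f s * g r else 0)"
    by (rule Bochner_Integration.integral_add[OF i1 i2])
  also have "integral\<^sup>L (M \<Otimes>\<^sub>M M) (\<lambda>(s, r). if r \<le> s then f s * g r else 0)
      = (LINT s|M. LINT r|M. (if r \<le> s then f s * g r else 0))"
    using P.integral_fst'[OF i1] by simp
  also have "\<dots> = (LINT s|M. f s * integral\<^sup>L (lebesgue_on {a..s}) g)"
  proof (rule Bochner_Integration.integral_cong)
    fix s assume "s \<in> space M"
    then have s: "s \<in> {a..b}" by (simp add: M_def)
    have "(LINT r|M. (if r \<le> s then f s * g r else 0)) = (LINT r|M. f s * (if r \<le> s then g r else 0))"
      by (rule Bochner_Integration.integral_cong) auto
    then show "(LINT r|M. (if r \<le> s then f s * g r else 0)) = f s * integral\<^sup>L (lebesgue_on {a..s}) g"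
      by (simp add: eq[OF s])
  qed simp
  also have "integral\<^sup>L (M \<Otimes>\<^sub>M M) (\<lambda>(s, r). if s < r then f s * g r else 0)
      = (LINT r|M. LINT s|M. (if s < r then f s * g r else 0))"
    using P.integral_snd[OF i2] by simp
  also have "\<dots> = (LINT r|M. g r * integral\<^sup>L (lebesgue_on {a..r}) f)"
  proof (rule Bochner_Integration.integral_cong)
    fix r assume "r \<in> space M"
    then have r: "r \<in> {a..b}" by (simp add: M_def)
    have "(LINT s|M. (if s < r then f s * g r else 0)) = (LINT s|M. g r * (if s < r then f s else 0))"
      by (rule Bochner_Integration.integral_cong) auto
    then show "(LINT s|M. (if s < r then f s * g r else 0)) = g r * integral\<^sup>L (lebesgue_on {a..r}) f"
      by (simp add: eq'[OF r])
  qed simp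
  also have "(LINT s|M. f s * integral\<^sup>L (lebesgue_on {a..s}) g) + (LINT r|M. g r * integral\<^sup>L (lebesgue_on {a..r}) f)
     = (LINT t|M. f t * integral\<^sup>L (lebesgue_on {a..t}) g + g t * integral\<^sup>L (lebesgue_on {a..t}) f)"
    unfolding M_def using f g by (intro Bochner_Integration.integral_add[symmetric] integrable_mult_indefinite_integral)
  finally show ?thesis by (simp add: M_def)
qed

section \<open>The du Bois-Reymond lemma\<close>

lemma AE_lebesgue_on_neq: "S \<in> sets lebesgue \<Longrightarrow> AE s in lebesgue_on S. s \<noteq> (t::'a::euclidean_space)"
  by (rule AE_restrict_space_iff[THEN iffD2]) (auto intro: AE_mp[OF AE_completion[OF AE_lborel_singleton[of t]]])

text \<open>Open intervals form an intersection-stable generator of the Borel sets, so a Dynkin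
  argument extends the vanishing integral to all Borel sets. Lebesgue sets differ from these by null
  sets, and a density with zero integral over every measurable set vanishes almost
  everywhere.\<close>

lemma AE_zero_if_integrals_zero:
  fixes g :: "real \<Rightarrow> real"
  assumes g: "integrable (lebesgue_on {a..b}) g"
    and zero: "\<And>x y. a \<le> x \<Longrightarrow> x < y \<Longrightarrow> y \<le> b \<Longrightarrow> (LINT t|lebesgue_on {a..b}. indicator {x<..<y} t * g t) = 0"
  shows "AE t in lebesgue_on {a..b}. g t = 0"
proof (rule sigma_finite_measure.density_zero[OF _ g])
  show "sigma_finite_measure (lebesgue_on {a..b})"
    by (intro finite_measure.axioms(1) finite_measure_lebesgue_on) simp
next
  define M where "M = lebesgue_on {a..b}"
  have gM: "integrable M g" using g by (simp add: M_def)
  have borelM: "S \<inter> {a..b} \<in> sets M" if "S \<in> sets borel" for S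
    using that unfolding M_def by (auto simp: sets_restrict_space)
  have intS: "integrable M (\<lambda>t. indicator S t * g t)" if "S \<in> sets borel" for S
  proof -
    have "integrable M (\<lambda>t. indicator (S \<inter> {a..b}) t *\<^sub>R g t)"
      by (rule integrable_mult_indicator[OF borelM[OF that] gM])
    then show ?thesis
      by (rule Bochner_Integration.integrable_cong[THEN iffD1, rotated -1]) (auto simp: M_def indicator_def)
  qed
  \<comment> \<open>The generator contains all intervals of the line. One that leaves {a..b} is
    clipped to it, and only the end points, which are null, can be lost.\<close>
  have all: "(LINT t|M. indicator {x<..<y} t * g t) = 0" for x y
  proof (cases "max x a < min y b")
    case True
    have "(LINT t|M. indicator {x<..<y} t * g t) = (LINT t|M. indicator {max x a<..<min y b} t * g t)"
    proof (rule integral_cong_AE)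
      have "AE t in M. t \<noteq> a" "AE t in M. t \<noteq> b" unfolding M_def by (auto intro: AE_lebesgue_on_neq)
      moreover have "AE t in M. t \<in> {a..b}" unfolding M_def by (metis AE_space space_lebesgue_on)
      ultimately show "AE t in M. indicator {x<..<y} t * g t = indicator {max x a<..<min y b} t * g t"
        by eventually_elim (auto simp: indicator_def)
    qed (use intS in auto)
    then show ?thesis using zero[of "max x a" "min y b"] True by (simp add: M_def)
  next
    case False
    have "(LINT t|M. indicator {x<..<y} t * g t) = (LINT t|M. 0)"
    proof (rule integral_cong_AE)
      have "AE t in M. t \<noteq> a" "AE t in M. t \<noteq> b" unfolding M_def by (auto intro: AE_lebesgue_on_neq)
      moreover have "AE t in M. t \<in> {a..b}" unfolding M_def by (metis AE_space space_lebesgue_on)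
      ultimately show "AE t in M. indicator {x<..<y} t * g t = 0"
        by eventually_elim (use False in \<open>auto simp: indicator_def\<close>)
    qed (use intS in auto)
    then show ?thesis by simp
  qed
  \<comment> \<open>Complements in the Dynkin argument are subtracted from this integral over all of
    {a..b}.\<close>
  have total: "(LINT t|M. g t) = 0"
  proof -
    have "(LINT t|M. g t) = (LINT t|M. indicator {a-1<..<b+1} t * g t)"
      by (rule Bochner_Integration.integral_cong) (auto simp: M_def)
    then show ?thesis using all by simp
  qed
  have gen: "sets borel = sigma_sets UNIV (range (\<lambda>(x, y). {x<..<y::real}))"
    by (subst borel_eq_box) (auto intro!: arg_cong[where f = "sigma_sets UNIV"] image_cong)
  have borel: "(LINT t|M. indicator S t * g t) = 0" if "S \<in> sets borel" for S
  proof -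
    have "Int_stable (range (\<lambda>(x, y). {x<..<y::real}))"
      by (auto simp: Int_stable_def)
    moreover have "range (\<lambda>(x, y). {x<..<y::real}) \<subseteq> Pow UNIV" by simp
    moreover have "S \<in> sigma_sets UNIV (range (\<lambda>(x, y). {x<..<y::real}))"
      using that by (simp add: gen)
    ultimately show ?thesis
    proof (induction rule: sigma_sets_induct_disjoint)
      case (basic A) then show ?case using all by auto
    next
      case (compl A)
      then have A: "A \<in> sets borel" by (simp add: gen)
      have "(LINT t|M. indicator (UNIV - A) t * g t) = (LINT t|M. g t - indicator A t * g t)"
        by (rule Bochner_Integration.integral_cong) (auto simp: indicator_def)
      then show ?case using intS[OF A] gM compl total by simp
    next
      case (union A)
      then have A: "A i \<in> sets borel" for i by (auto simp: gen)
      have "disjoint_family A" by fact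
      then have "(LINT x:(\<Union>i. A i \<inter> {a..b})|M. g x) = (\<Sum>i. (LINT x:(A i \<inter> {a..b})|M. g x))"
        using borelM[OF A] integrable_mult_indicator[OF sets.countable_UN[OF image_subsetI[OF borelM[OF A]]] gM]
        by (intro lebesgue_integral_countable_add) (auto simp: disjoint_family_on_def set_integrable_def)
      moreover have set_eq: "(LINT x:(S \<inter> {a..b})|M. g x) = (LINT t|M. indicator S t * g t)" for S
        unfolding set_lebesgue_integral_def by (rule Bochner_Integration.integral_cong) (auto simp: M_def indicator_def)
      ultimately show ?case using union set_eq[of "\<Union>i. A i"] by simp
    qed auto
  qed
  fix A assume "A \<in> sets (lebesgue_on {a..b})"
  then have "A \<in> sets lebesgue" "A \<subseteq> {a..b}"
    by (auto simp: sets_restrict_space dest: sets.sets_into_space)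
  then obtain S N where S: "S \<in> sets borel" "negligible N" "S \<union> N = A"
    using sets_lebesgue_almost_borel by metis
  have "(LINT t|M. indicator A t * g t) = (LINT t|M. indicator S t * g t)"
  proof (rule integral_cong_AE)
    have "AE t in lebesgue. t \<notin> N"
      using S(2) by (simp add: negligible_iff_null_sets AE_not_in)
    then have "AE t in M. t \<notin> N"
      unfolding M_def by (auto simp: AE_restrict_space_iff)
    then show "AE t in M. indicator A t * g t = indicator S t * g t"
      by eventually_elim (use S(3) in \<open>auto simp: indicator_def\<close>)
    have "A \<in> sets M" using \<open>A \<in> sets (lebesgue_on {a..b})\<close> by (simp add: M_def)
    from integrable_mult_indicator[OF this gM] show "(\<lambda>t. indicator A t * g t) \<in> borel_measurable M" by simp
    show "(\<lambda>t. indicator S t * g t) \<in> borel_measurable M" using intS[OF S(1)] by simp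
  qed
  then show "set_lebesgue_integral (lebesgue_on {a..b}) A g = 0"
    using borel[OF S(1)] by (simp add: set_lebesgue_integral_def M_def)
qed

lemma smooth_imp_antiderivative:
  assumes "smooth (\<theta>::real \<Rightarrow> real)"
  obtains \<psi> where "smooth \<psi>" "\<And>t. (\<psi> has_real_derivative \<theta> t) (at t)" "\<psi> a = 0"
proof -
  have "\<exists>F. \<forall>x::real. -\<infinity> < ereal x \<longrightarrow> ereal x < \<infinity> \<longrightarrow> (F has_vector_derivative \<theta> x) (at x)"
    by (rule einterval_antiderivative) (use smooth_continuous[OF assms, of UNIV] continuous_on_eq_continuous_at in auto)
  then obtain F where F: "\<And>x. (F has_real_derivative \<theta> x) (at x)"
    by (auto simp: has_real_derivative_iff_has_vector_derivative)
  have d: "((\<lambda>x. F x - F a) has_real_derivative \<theta> x) (at x)" for x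
    using DERIV_diff[OF F DERIV_const] by simp
  then show thesis
    using that[of "\<lambda>x. F x - F a"] smooth_antiderivative[OF assms] by simp
qed

lemma integral_FTC_lebesgue_on:
  fixes \<psi> :: "real \<Rightarrow> real"
  assumes "\<And>t. (\<psi> has_real_derivative \<theta> t) (at t)" "continuous_on UNIV \<theta>" "x \<le> y"
  shows "integral\<^sup>L (lebesgue_on {x..y}) \<theta> = \<psi> y - \<psi> x"
  unfolding integral_lebesgue_on_Icc_eq_lborel[OF assms(2)]
  by (rule integral_FTC_atLeastAtMost)
     (use assms in \<open>auto intro: continuous_on_subset has_vector_derivative_at_within simp: has_real_derivative_iff_has_vector_derivative\<close>)

lemma zero_derivative_constant:
  fixes \<psi> :: "real \<Rightarrow> real"
  assumes "\<And>t. (\<psi> has_real_derivative \<theta> t) (at t)" "continuous_on UNIV \<theta>"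
    "x \<le> y" "\<And>t. t \<in> {x..y} \<Longrightarrow> \<theta> t = 0"
  shows "\<psi> x = \<psi> y"
proof -
  have "integral\<^sup>L (lebesgue_on {x..y}) \<theta> = integral\<^sup>L (lebesgue_on {x..y}) (\<lambda>t. 0)"
    by (rule Bochner_Integration.integral_cong) (use assms in auto)
  then show ?thesis using integral_FTC_lebesgue_on[OF assms(1,2,3)] by simp
qed

lemma bump_integral_nonzero:
  assumes ab: "a < b"
  shows "integral\<^sup>L (lebesgue_on {a..b}) (bump a b 1) \<noteq> 0"
proof
  define M where "M = lebesgue_on {a..b}"
  assume "integral\<^sup>L (lebesgue_on {a..b}) (bump a b 1) = 0"
  moreover have "integrable M (bump a b 1)"
    unfolding M_def cbox_interval[symmetric]
    by (rule integrable_lebesgue_on_continuous[OF smooth_continuous[OF smooth_bump]])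
  ultimately have "AE t in M. bump a b 1 t = 0"
    using integral_nonneg_eq_0_iff_AE[of M "bump a b 1"] bump_bounds by (auto simp: M_def)
  moreover have "AE t in M. t \<noteq> a" "AE t in M. t \<noteq> b" unfolding M_def by (auto intro: AE_lebesgue_on_neq)
  moreover have "AE t in M. t \<in> {a..b}" unfolding M_def by (metis AE_space space_lebesgue_on)
  ultimately have "AE t in M. False"
  proof eventually_elim
    case (elim t)
    then have "bump a b 1 t > 0" by (intro bump_pos) auto
    then show False using elim by simp
  qed
  then have "emeasure M (space M) = 0" by (simp add: AE_iff_measurable[OF _ refl])
  then show False using ab by (simp add: M_def emeasure_restrict_space)
qed

text \<open>With A the primitive of F, the difference g = V - A is orthogonal to every derivative of
  a test function. A smooth function supported in {a..b} is such a derivative once its mean is zero,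
  and subtracting a multiple of one fixed bump achieves this. Hence g minus a constant is orthogonal
  to all bumps, and in the limit to all intervals.\<close>

lemma du_bois_reymond:
  fixes V F :: "real \<Rightarrow> real"
  assumes ab: "a < b" and V: "integrable (lebesgue_on {a..b}) V" and F: "integrable (lebesgue_on {a..b}) F"
    and weak: "\<And>\<psi> \<psi>'. smooth \<psi> \<Longrightarrow> (\<And>t. (\<psi> has_real_derivative \<psi>' t) (at t)) \<Longrightarrow>
      (\<And>t. t \<notin> {a<..<b} \<Longrightarrow> \<psi> t = 0) \<Longrightarrow> (LINT t|lebesgue_on {a..b}. \<psi>' t * V t + \<psi> t * F t) = 0"
  shows "\<exists>c. AE t in lebesgue_on {a..b}. V t = c + integral\<^sup>L (lebesgue_on {a..t}) F"
proof -
  define M where "M = lebesgue_on {a..b}"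
  interpret M: finite_measure M unfolding M_def by (rule finite_measure_lebesgue_on) simp
  define A where "A t = integral\<^sup>L (lebesgue_on {a..t}) F" for t
  define g where "g t = V t - A t" for t
  have contM: "integrable M h" if "continuous_on UNIV h" for h :: "real \<Rightarrow> real"
    unfolding M_def cbox_interval[symmetric] by (rule integrable_lebesgue_on_continuous[OF that])
  have bddM: "integrable M (\<lambda>t. h t * k t)" if h: "continuous_on UNIV h" and k: "integrable M k" for h k :: "real \<Rightarrow> real"
  proof -
    have "compact (h ` {a..b})" by (intro compact_continuous_image continuous_on_subset[OF h]) auto
    then obtain B where B: "\<And>t. t \<in> {a..b} \<Longrightarrow> \<bar>h t\<bar> \<le> B"
      by (metis bounded_iff compact_imp_bounded image_eqI real_norm_def)
    show ?thesis
    proof (rule Bochner_Integration.integrable_bound)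
      show "integrable M (\<lambda>t. B * k t)" using k by simp
      show "(\<lambda>t. h t * k t) \<in> borel_measurable M"
        using contM[OF h] k by (intro borel_measurable_times) auto
      show "AE t in M. norm (h t * k t) \<le> norm (B * k t)"
        by (intro AE_I2) (simp add: M_def abs_mult mult_right_mono order_trans[OF B abs_ge_self])
    qed
  qed
  have Aint: "integrable M A"
    using integrable_mult_indefinite_integral[OF F, of "\<lambda>_. 1"] contM[of "\<lambda>_. 1"] by (simp add: A_def[abs_def] M_def)
  have gint: "integrable M g" using V Aint unfolding g_def M_def by simp
  \<comment> \<open>Integration by parts gives the weak equation for A with the same right-hand side
    F; subtracting the two equations removes F.\<close>
  have weak_g: "(LINT t|M. \<psi>' t * g t) = 0"
    if \<psi>: "smooth \<psi>" "smooth \<psi>'" "\<And>t. (\<psi> has_real_derivative \<psi>' t) (at t)" "\<And>t. t \<notin> {a<..<b} \<Longrightarrow> \<psi> t = 0" for \<psi> \<psi>'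
  proof -
    have c: "continuous_on UNIV \<psi>" "continuous_on UNIV \<psi>'" using \<psi> smooth_continuous by blast+
    have AI: "integral\<^sup>L (lebesgue_on {a..t}) \<psi>' = \<psi> t" if "t \<in> {a..b}" for t
      using integral_FTC_lebesgue_on[OF \<psi>(3) c(2), of a t] \<psi>(4)[of a] that by simp
    have "(LINT t|M. \<psi>' t * A t + F t * integral\<^sup>L (lebesgue_on {a..t}) \<psi>')
        = integral\<^sup>L M \<psi>' * integral\<^sup>L M F"
      unfolding M_def A_def using contM[OF c(2)] F by (intro integral_by_parts_indefinite) (auto simp: M_def)
    also have "integral\<^sup>L M \<psi>' = 0" using AI[of b] \<psi>(4)[of b] ab by (simp add: M_def)
    also have "(LINT t|M. \<psi>' t * A t + F t * integral\<^sup>L (lebesgue_on {a..t}) \<psi>')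
       = (LINT t|M. \<psi>' t * A t + \<psi> t * F t)"
      by (rule Bochner_Integration.integral_cong) (auto simp: M_def AI)
    finally have 1: "(LINT t|M. \<psi>' t * A t + \<psi> t * F t) = 0" by simp
    have 2: "(LINT t|M. \<psi>' t * V t + \<psi> t * F t) = 0"
      unfolding M_def by (rule weak[OF \<psi>(1,3,4)])
    have "(LINT t|M. \<psi>' t * g t) = (LINT t|M. (\<psi>' t * V t + \<psi> t * F t) - (\<psi>' t * A t + \<psi> t * F t))"
      by (rule Bochner_Integration.integral_cong) (auto simp: g_def algebra_simps)
    also have "\<dots> = 0"
      using 1 2 V F Aint c by (subst Bochner_Integration.integral_diff) (auto intro!: bddM Bochner_Integration.integrable_add simp: M_def[symmetric])
    finally show ?thesis .
  qed
  define m0 where "m0 = integral\<^sup>L M (bump a b 1)"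
  have cb: "continuous_on UNIV (bump x y n)" for x y n by (rule smooth_continuous[OF smooth_bump])
  have "m0 \<noteq> 0" using bump_integral_nonzero[OF ab] by (simp add: m0_def M_def)
  \<comment> \<open>The constant is forced: it is the average of g weighted by the fixed
    bump.\<close>
  define c where "c = (LINT t|M. bump a b 1 t * g t) / m0"
  have ortho: "(LINT t|M. bump x y n t * (g t - c)) = 0" if xy: "a \<le> x" "y \<le> b" for x y n
  proof -
    define m where "m = integral\<^sup>L M (bump x y n)"
    \<comment> \<open>The multiple of the fixed bump makes the mean of \<theta> zero, so the
      primitive of \<theta> that vanishes at a also vanishes from b on and is an admissible test
      function.\<close>
    define \<theta> where "\<theta> t = bump x y n t + (- m / m0) * bump a b 1 t" for t
    have \<theta>: "smooth \<theta>" unfolding \<theta>_def by (intro smooth_add smooth_mult smooth_const smooth_bump)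
    then have c\<theta>: "continuous_on UNIV \<theta>" by (rule smooth_continuous)
    obtain \<psi> where \<psi>: "smooth \<psi>" "\<And>t. (\<psi> has_real_derivative \<theta> t) (at t)" "\<psi> a = 0"
      using smooth_imp_antiderivative[OF \<theta>] by metis
    have out: "\<theta> t = 0" if "t \<notin> {a<..<b}" for t
      using that xy by (auto simp: \<theta>_def bump_outside)
    have "\<psi> b = integral\<^sup>L M \<theta>"
      using integral_FTC_lebesgue_on[OF \<psi>(2) c\<theta>, of a b] ab \<psi>(3) by (simp add: M_def)
    also have "\<dots> = m + (- m / m0) * m0"
      unfolding \<theta>_def m_def m0_def using contM[OF cb] by (subst Bochner_Integration.integral_add) auto
    finally have \<psi>b: "\<psi> b = 0" using \<open>m0 \<noteq> 0\<close> by simp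
    have "\<psi> t = 0" if t: "t \<notin> {a<..<b}" for t
    proof (cases "t \<le> a")
      case True
      then show ?thesis using zero_derivative_constant[OF \<psi>(2) c\<theta>, of t a] out \<psi>(3) by auto
    next
      case False
      then show ?thesis using zero_derivative_constant[OF \<psi>(2) c\<theta>, of b t] out \<psi>b t by auto
    qed
    then have "(LINT t|M. \<theta> t * g t) = 0" by (rule weak_g[OF \<psi>(1) \<theta> \<psi>(2)])
    also have "(LINT t|M. \<theta> t * g t) = (LINT t|M. bump x y n t * g t + (- m / m0) * (bump a b 1 t * g t))"
      by (rule Bochner_Integration.integral_cong) (auto simp: \<theta>_def algebra_simps)
    also have "\<dots> = (LINT t|M. bump x y n t * g t) - m * c"
      using bddM[OF cb gint] by (subst Bochner_Integration.integral_add) (auto simp: c_def)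
    also have "m * c = (LINT t|M. bump x y n t * c)" by (simp add: m_def)
    also have "(LINT t|M. bump x y n t * g t) - (LINT t|M. bump x y n t * c)
       = (LINT t|M. bump x y n t * g t - bump x y n t * c)"
      using bddM[OF cb gint] contM[OF cb] by (subst Bochner_Integration.integral_diff) auto
    finally show ?thesis by (simp add: right_diff_distrib)
  qed
  have "AE t in lebesgue_on {a..b}. g t - c = 0"
  proof (rule AE_zero_if_integrals_zero)
    show gc: "integrable (lebesgue_on {a..b}) (\<lambda>t. g t - c)"
      using gint by (simp add: M_def[symmetric])
    fix x y assume xy: "a \<le> x" "x < y" "y \<le> b"
    have "(\<lambda>n. LINT t|M. bump x y n t * (g t - c)) \<longlonglongrightarrow> (LINT t|M. indicator {x<..<y} t * (g t - c))"
    proof (rule integral_dominated_convergence)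
      show "integrable M (\<lambda>t. \<bar>g t - c\<bar>)" using gint by simp
      show "AE t in M. (\<lambda>n. bump x y n t * (g t - c)) \<longlonglongrightarrow> indicator {x<..<y} t * (g t - c)"
        by (intro AE_I2 tendsto_mult bump_tendsto tendsto_const)
      show "AE t in M. norm (bump x y n t * (g t - c)) \<le> \<bar>g t - c\<bar>" for n
        using bump_bounds by (intro AE_I2) (auto simp: abs_mult intro!: mult_left_le_one_le)
      have "(\<lambda>t. indicator {x<..<y} t) \<in> borel_measurable borel" by simp
      then have "(\<lambda>t. indicator {x<..<y} t :: real) \<in> borel_measurable M"
        unfolding M_def by (intro measurable_restrict_space1 measurable_completion) auto
      then show "(\<lambda>t. indicator {x<..<y} t * (g t - c)) \<in> borel_measurable M"
        using gint by (intro borel_measurable_times borel_measurable_diff) auto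
      show "(\<lambda>t. bump x y n t * (g t - c)) \<in> borel_measurable M" for n
        using gint contM[OF cb] by (intro borel_measurable_times borel_measurable_diff) auto
    qed
    then show "(LINT t|lebesgue_on {a..b}. indicator {x<..<y} t * (g t - c)) = 0"
      using ortho xy by (simp add: M_def[symmetric] LIMSEQ_const_iff)
  qed
  then have "AE t in lebesgue_on {a..b}. V t = c + A t"
    by (auto simp: g_def elim: AE_mp)
  then show ?thesis unfolding A_def by blast
qed

subsection \<open>Integrals of periodic functions\<close>

definition ivec :: "int^'n \<Rightarrow> real^'n" where
  "ivec k = (\<chi> i. of_int (k $ i))"

definition fracv :: "real^'n \<Rightarrow> real^'n" where
  "fracv x = (\<chi> i. frac (x $ i))"

lemma One_vec_nth [simp]:
  fixes i :: "'n::finite"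
  shows "(\<Sum>b\<in>(Basis :: (real^'n) set). b $ i) = 1"
proof -
  have "(One :: real^'n) \<bullet> axis i 1 = 1" by (rule inner_sum_Basis) (simp add: axis_in_Basis_iff)
  then show ?thesis by (simp add: inner_axis)
qed

lemma mem_torus_cell: "x \<in> torus_cell \<longleftrightarrow> (\<forall>i. 0 \<le> x $ i \<and> x $ i \<le> 1)"
  by (simp add: torus_cell_def mem_box_cart)

lemma torus_cell_lmeasurable [simp]: "torus_cell \<in> lmeasurable"
  by (simp add: torus_cell_def)

lemma torus_cell_sets [measurable, simp]: "torus_cell \<in> sets lebesgue" "torus_cell \<in> sets borel"
  by (auto simp: torus_cell_def)

lemma finite_measure_torus: "finite_measure (lebesgue_on torus_cell)"
  by (rule finite_measure_lebesgue_on) simp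

lemma measure_torus: "measure (lebesgue_on torus_cell) torus_cell = 1"
  unfolding torus_cell_def
  by (subst measure_restrict_space) (auto simp: measure_lborel_cbox_eq)

lemma torus_periodic_shift_nat:
  assumes "torus_periodic f" shows "f (x + real n *\<^sub>R axis i 1) = f x"
proof (induction n)
  case (Suc n)
  have "f (x + real (Suc n) *\<^sub>R axis i 1) = f ((x + real n *\<^sub>R axis i 1) + axis i 1)"
    by (simp add: algebra_simps)
  then show ?case using assms Suc by (simp add: torus_periodic_def)
qed simp

lemma torus_periodic_shift_int:
  assumes "torus_periodic f" shows "f (x + of_int n *\<^sub>R axis i 1) = f x"
proof (cases n)
  case (nonneg m)
  then show ?thesis using torus_periodic_shift_nat[OF assms] by simp
next
  case (neg m)
  have "f (x + of_int n *\<^sub>R axis i 1) = f (x + of_int n *\<^sub>R axis i 1 + real (Suc m) *\<^sub>R axis i 1)"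
    by (simp only: torus_periodic_shift_nat[OF assms])
  also have "x + of_int n *\<^sub>R axis i 1 + real (Suc m) *\<^sub>R axis i 1 = x + (of_int n + real (Suc m)) *\<^sub>R axis i 1"
    by (simp only: scaleR_add_left add.assoc)
  also have "of_int n + real (Suc m) = 0" using neg by simp
  finally show ?thesis by simp
qed

lemma torus_periodic_ivec:
  assumes "torus_periodic f" shows "f (x + ivec k) = f x"
proof -
  have "f (x + (\<Sum>i\<in>I. of_int (k $ i) *\<^sub>R axis i 1)) = f x" if "finite I" for I
    using that
  proof (induction I arbitrary: x)
    case (insert i I)
    have "f (x + (\<Sum>i\<in>insert i I. of_int (k $ i) *\<^sub>R axis i 1))
        = f ((x + of_int (k $ i) *\<^sub>R axis i 1) + (\<Sum>i\<in>I. of_int (k $ i) *\<^sub>R axis i 1))"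
      using insert by (simp add: add.assoc)
    then show ?case using insert torus_periodic_shift_int[OF assms] by simp
  qed simp
  from this[of UNIV] show ?thesis
    by (metis (no_types, lifting) basis_expansion finite_class.finite_UNIV ivec_def scalar_mult_eq_scaleR sum.cong vec_lambda_beta)
qed

text \<open>Half open, so that every point has exactly one integer translate in the cell; the
  ceiling below picks it out.\<close>

definition half_open_cell :: "real^'n \<Rightarrow> (real^'n) set" where
  "half_open_cell c = {x. \<forall>i. c $ i \<le> x $ i \<and> x $ i < c $ i + 1}"

lemma half_open_cell_unique: "x + ivec k \<in> half_open_cell c \<longleftrightarrow> k = (\<chi> i. \<lceil>c $ i - x $ i\<rceil>)"
proof -
  have "x + ivec k \<in> half_open_cell c \<longleftrightarrow> (\<forall>i. c $ i - x $ i \<le> of_int (k $ i) \<and> of_int (k $ i) < c $ i - x $ i + 1)"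
    unfolding half_open_cell_def ivec_def by (auto simp: algebra_simps)
  also have "\<dots> \<longleftrightarrow> (\<forall>i. k $ i = \<lceil>c $ i - x $ i\<rceil>)"
    by (intro all_cong1) linarith
  finally show ?thesis by (simp add: vec_eq_iff)
qed

lemma half_open_cell_borel [measurable]: "half_open_cell c \<in> sets borel"
proof -
  have "half_open_cell c = (\<Inter>i. {x. c $ i \<le> x $ i} \<inter> {x. x $ i < c $ i + 1})"
    by (auto simp: half_open_cell_def)
  also have "\<dots> \<in> sets borel"
    by (intro sets.countable_INT' sets.Int borel_closed borel_open) (auto intro: closed_halfspace_component_ge_cart closed_Collect_le open_Collect_less continuous_intros)
  finally show ?thesis .
qed

text \<open>The integer translates of either cell tile the space, so each cell can be cut along the tiles of the other.\<close>

lemma nn_integral_half_open_cell: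
  fixes g :: "real^'n \<Rightarrow> ennreal"
  assumes [measurable]: "g \<in> borel_measurable borel" and per: "\<And>x k. g (x + ivec k) = g x"
  shows "(\<integral>\<^sup>+x. g x * indicator (half_open_cell c) x \<partial>lborel) = (\<integral>\<^sup>+x. g x * indicator (half_open_cell d) x \<partial>lborel)"
proof -
  let ?I = "count_space (UNIV :: (int^'n) set)"
  have one: "(\<integral>\<^sup>+k. indicator (half_open_cell d) (x + ivec k) \<partial>?I) = (1::ennreal)" for x :: "real^'n" and d
  proof -
    have "(\<integral>\<^sup>+k. indicator (half_open_cell d) (x + ivec k) \<partial>?I)
        = (\<integral>\<^sup>+k. indicator {\<chi> i. \<lceil>d $ i - x $ i\<rceil>} k \<partial>?I)"
      by (rule nn_integral_cong) (simp add: indicator_def half_open_cell_unique)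
    then show ?thesis by simp
  qed
  have one': "(\<integral>\<^sup>+k. indicator (half_open_cell d) (x - ivec k) \<partial>?I) = (1::ennreal)" for x :: "real^'n" and d
  proof -
    have "x - ivec k \<in> half_open_cell d \<longleftrightarrow> k = - (\<chi> i. \<lceil>d $ i - x $ i\<rceil>)" for k
    proof -
      have "x - ivec k = x + ivec (- k)" by (simp add: ivec_def vec_eq_iff)
      then have "x - ivec k \<in> half_open_cell d \<longleftrightarrow> - k = (\<chi> i. \<lceil>d $ i - x $ i\<rceil>)"
        by (simp only: half_open_cell_unique)
      then show ?thesis by (metis minus_minus)
    qed
    then have "(\<integral>\<^sup>+k. indicator (half_open_cell d) (x - ivec k) \<partial>?I)
        = (\<integral>\<^sup>+k. indicator {- (\<chi> i. \<lceil>d $ i - x $ i\<rceil>)} k \<partial>?I)"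
      by (intro nn_integral_cong) (simp add: indicator_def)
    then show ?thesis by simp
  qed
  have shift: "(\<integral>\<^sup>+x. h (x + ivec k) \<partial>lborel) = (\<integral>\<^sup>+x. h x \<partial>lborel)"
    if [measurable]: "h \<in> borel_measurable borel" for h :: "real^'n \<Rightarrow> ennreal" and k
  proof -
    have "(\<integral>\<^sup>+x. h x \<partial>lborel) = (\<integral>\<^sup>+x. h x \<partial>(distr lborel borel ((+) (ivec k))))"
      by (simp only: lborel_distr_plus)
    also have "\<dots> = (\<integral>\<^sup>+x. h (ivec k + x) \<partial>lborel)" by (rule nn_integral_distr) auto
    finally show ?thesis by (simp add: add.commute)
  qed
  have "(\<integral>\<^sup>+x. g x * indicator (half_open_cell c) x \<partial>lborel)
      = (\<integral>\<^sup>+x. \<integral>\<^sup>+k. g x * indicator (half_open_cell c) x * indicator (half_open_cell d) (x + ivec k) \<partial>?I \<partial>lborel)"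
    by (simp add: nn_integral_cmult one)
  also have "\<dots> = (\<integral>\<^sup>+k. \<integral>\<^sup>+x. g x * indicator (half_open_cell c) x * indicator (half_open_cell d) (x + ivec k) \<partial>lborel \<partial>?I)"
    by (rule nn_integral_count_space_nn_integral) auto
  \<comment> \<open>Translation by \<open>ivec k\<close> leaves g unchanged and moves the dependence
    on k from the cell d to the cell c, whose translates again sum to 1.\<close>
  also have "\<dots> = (\<integral>\<^sup>+k. \<integral>\<^sup>+x. g x * indicator (half_open_cell c) (x - ivec k) * indicator (half_open_cell d) x \<partial>lborel \<partial>?I)"
  proof (rule nn_integral_cong)
    fix k
    show "(\<integral>\<^sup>+x. g x * indicator (half_open_cell c) x * indicator (half_open_cell d) (x + ivec k) \<partial>lborel)
       = (\<integral>\<^sup>+x. g x * indicator (half_open_cell c) (x - ivec k) * indicator (half_open_cell d) x \<partial>lborel)"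
      using shift[of "\<lambda>x. g x * indicator (half_open_cell c) (x - ivec k) * indicator (half_open_cell d) x" k]
      by (simp add: per)
  qed
  also have "\<dots> = (\<integral>\<^sup>+x. \<integral>\<^sup>+k. g x * indicator (half_open_cell c) (x - ivec k) * indicator (half_open_cell d) x \<partial>?I \<partial>lborel)"
    by (rule nn_integral_count_space_nn_integral[symmetric]) auto
  also have "\<dots> = (\<integral>\<^sup>+x. g x * indicator (half_open_cell d) x \<partial>lborel)"
  proof (rule nn_integral_cong)
    fix x
    have "(\<integral>\<^sup>+k. g x * indicator (half_open_cell c) (x - ivec k) * indicator (half_open_cell d) x \<partial>?I)
        = (\<integral>\<^sup>+k. (g x * indicator (half_open_cell d) x) * indicator (half_open_cell c) (x - ivec k) \<partial>?I)"
      by (intro nn_integral_cong) (simp only: ac_simps)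
    also have "\<dots> = g x * indicator (half_open_cell d) x"
      by (subst nn_integral_cmult) (simp_all add: one')
    finally show "(\<integral>\<^sup>+k. g x * indicator (half_open_cell c) (x - ivec k) * indicator (half_open_cell d) x \<partial>?I)
        = g x * indicator (half_open_cell d) x" .
  qed
  finally show ?thesis .
qed

lemma AE_half_open_cell: "AE x in lborel. x \<in> half_open_cell c \<longleftrightarrow> x \<in> cbox c (c + One)"
proof -
  have "negligible (cbox c (c + One) - box c (c + One))" by (rule negligible_frontier_interval)
  then have "AE x in lborel. x \<notin> cbox c (c + One) - box c (c + One)"
    using AE_completion_iff AE_not_in negligible_iff_null_sets by blast
  then show ?thesis
    by eventually_elim (auto simp: half_open_cell_def mem_box_cart less_eq_real_def)
qed

lemma nn_integral_torus_cell:
  assumes [measurable]: "g \<in> borel_measurable borel"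
  shows "(\<integral>\<^sup>+x. g x \<partial>lebesgue_on torus_cell) = (\<integral>\<^sup>+x. g x * indicator torus_cell x \<partial>lborel)"
  by (simp add: nn_integral_restrict_space nn_integral_completion)

text \<open>The fundamental domain for increments: its centre is the origin, where the kernel
  concentrates, and every coordinate is bounded by 1/2, up to which cos(pi s) is
  nonnegative.\<close>

definition centered_cell :: "(real^3) set" where
  "centered_cell = cbox (- (1/2) *\<^sub>R One) ((1/2) *\<^sub>R One)"

text \<open>The substitution x = y + l sends the torus to a unit cube around y. Cubes in different
  positions are compared as half-open cells, from which they differ by null sets.\<close>

lemma nn_integral_periodic_shift:
  fixes g :: "real^3 \<Rightarrow> ennreal"
  assumes [measurable]: "g \<in> borel_measurable borel" and per: "torus_periodic g"
  shows "(\<integral>\<^sup>+x. g x \<partial>lebesgue_on torus_cell) = (\<integral>\<^sup>+l. g (y + l) * indicator centered_cell l \<partial>lborel)"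
proof -
  define c where "c = y - (1/2) *\<^sub>R (One::real^3)"
  have iff: "y + l \<in> cbox c (c + One) \<longleftrightarrow> l \<in> centered_cell" for l
    unfolding centered_cell_def mem_box_cart c_def by (rule all_cong1) (auto simp: field_simps)
  have "(\<integral>\<^sup>+l. g (y + l) * indicator centered_cell l \<partial>lborel) 
      = (\<integral>\<^sup>+x. g x * indicator (cbox c (c + One)) x \<partial>(distr lborel borel ((+) y)))"
    by (subst nn_integral_distr) (auto intro!: nn_integral_cong simp: indicator_def iff)
  also have "\<dots> = (\<integral>\<^sup>+x. g x * indicator (cbox c (c + One)) x \<partial>lborel)"
    by (simp only: lborel_distr_plus)
  also have "\<dots> = (\<integral>\<^sup>+x. g x * indicator (half_open_cell c) x \<partial>lborel)"
    by (rule nn_integral_cong_AE) (use AE_half_open_cell[of c] in \<open>eventually_elim, auto simp: indicator_def\<close>)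
  also have "\<dots> = (\<integral>\<^sup>+x. g x * indicator (half_open_cell 0) x \<partial>lborel)"
    by (rule nn_integral_half_open_cell) (auto simp: torus_periodic_ivec[OF per])
  also have "\<dots> = (\<integral>\<^sup>+x. g x * indicator torus_cell x \<partial>lborel)"
    by (rule nn_integral_cong_AE) (use AE_half_open_cell[of 0] in \<open>eventually_elim, auto simp: torus_cell_def indicator_def\<close>)
  also have "\<dots> = (\<integral>\<^sup>+x. g x \<partial>lebesgue_on torus_cell)"
    by (rule nn_integral_torus_cell[symmetric]) simp
  finally show ?thesis by simp
qed

section \<open>Borel representatives and the passage from pairs of points to increments\<close>

lemma lebesgue_ex_borel:
  fixes f :: "'a::euclidean_space \<Rightarrow> 'b::euclidean_space"
  assumes "f \<in> borel_measurable lebesgue"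
  obtains g where "g \<in> borel_measurable borel" "AE x in lborel. f x = g x"
proof -
  have "\<exists>h. \<forall>b\<in>Basis. h b \<in> borel_measurable borel \<and> (AE x in lborel. f x \<bullet> b = h b x)"
  proof (rule bchoice, safe)
    fix b :: 'b assume "b \<in> Basis"
    have "(\<lambda>x. f x \<bullet> b) \<in> borel_measurable lebesgue" using assms by (intro borel_measurable_inner) auto
    from completion_ex_borel_measurable_real[OF this]
    show "\<exists>h. h \<in> borel_measurable borel \<and> (AE x in lborel. f x \<bullet> b = h x)" by auto
  qed
  then obtain h where h: "\<And>b. b \<in> Basis \<Longrightarrow> h b \<in> borel_measurable borel"
      "\<And>b. b \<in> Basis \<Longrightarrow> AE x in lborel. f x \<bullet> b = h b x" by blast
  show thesis
  proof
    show "(\<lambda>x. \<Sum>b\<in>Basis. h b x *\<^sub>R b) \<in> borel_measurable borel"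
      using h(1) by (intro borel_measurable_sum borel_measurable_scaleR) auto
    have "AE x in lborel. \<forall>b\<in>Basis. f x \<bullet> b = h b x"
      using h(2) by (intro AE_finite_allI) auto
    then show "AE x in lborel. f x = (\<Sum>b\<in>Basis. h b x *\<^sub>R b)"
      by eventually_elim (metis (no_types, lifting) euclidean_representation sum.cong)
  qed
qed

lemma fracv_in_torus_cell: "fracv x \<in> torus_cell"
  by (auto simp: mem_torus_cell fracv_def frac_ge_0 frac_lt_1 less_imp_le)

lemma fracv_eq: "fracv x = x + ivec (\<chi> i. - \<lfloor>x $ i\<rfloor>)"
  by (simp add: fracv_def ivec_def vec_eq_iff frac_def)

lemma fracv_borel [measurable]: "fracv \<in> borel_measurable (borel :: (real^'n) measure)"
proof -
  have "(\<lambda>x::real^'n. fracv x \<bullet> b) \<in> borel_measurable borel" if bB: "b \<in> Basis" for b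
  proof -
    obtain i where b: "b = axis i 1" using bB by (auto simp: Basis_vec_def)
    have "(\<lambda>x::real^'n. x $ i - of_int \<lfloor>x $ i\<rfloor>) \<in> borel_measurable borel" by measurable
    then show ?thesis by (simp add: b inner_axis fracv_def frac_def)
  qed
  then show ?thesis by (subst borel_measurable_euclidean_space) blast
qed

text \<open>Joint measurability of f (y + l) in y and l is immediate for Borel functions, hence the
  representative. Composition with \<open>fracv\<close> makes it periodic, and the exceptional set
  lies in the countably many integer translates of a null set.\<close>

lemma torus_periodic_ex_borel:
  fixes f :: "real^3 \<Rightarrow> 'b::euclidean_space"
  assumes per: "torus_periodic f" and f: "f \<in> borel_measurable (lebesgue_on torus_cell)"
  obtains g where "g \<in> borel_measurable borel" "torus_periodic g" "negligible {x. f x \<noteq> g x}"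
proof -
  have "(\<lambda>x. if x \<in> torus_cell then f x else 0) \<in> borel_measurable lebesgue"
    using f by (simp add: borel_measurable_if)
  then obtain g where g: "g \<in> borel_measurable borel" "AE x in lborel. (if x \<in> torus_cell then f x else 0) = g x"
    by (rule lebesgue_ex_borel)
  define N where "N = {x. (if x \<in> torus_cell then f x else 0) \<noteq> g x}"
  have "AE x in lebesgue. (if x \<in> torus_cell then f x else 0) = g x" using g(2) by (simp add: AE_completion_iff)
  then obtain N' where "N' \<in> null_sets lebesgue" "N \<subseteq> N'"
    unfolding eventually_ae_filter N_def by auto
  then have N: "negligible N"
    using negligible_subset negligible_iff_null_sets by blast
  show thesis
  proof
    show "(\<lambda>x. g (fracv x)) \<in> borel_measurable borel" using g(1) by measurable
    show "torus_periodic (\<lambda>x. g (fracv x))"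
      unfolding torus_periodic_def
    proof (intro allI)
      fix x :: "real^3" and i
      have "fracv (x + axis i 1) = fracv x"
        by (auto simp: fracv_def vec_eq_iff axis_def frac_1_eq)
      then show "g (fracv (x + axis i 1)) = g (fracv x)" by simp
    qed
    have "{x. f x \<noteq> g (fracv x)} \<subseteq> (\<Union>k. (+) (ivec k) ` N)"
    proof safe
      fix x assume "f x \<noteq> g (fracv x)"
      moreover have "f (fracv x) = f x" using torus_periodic_ivec[OF per] by (simp add: fracv_eq)
      ultimately have "fracv x \<in> N" using fracv_in_torus_cell by (auto simp: N_def)
      moreover have "x = ivec (\<chi> i. \<lfloor>x $ i\<rfloor>) + fracv x"
        by (simp add: fracv_def ivec_def vec_eq_iff frac_def)
      ultimately show "x \<in> (\<Union>k. (+) (ivec k) ` N)" by blast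
    qed
    moreover have "negligible (\<Union>k. (+) (ivec k) ` N)"
      by (intro negligible_countable_Union) (auto intro: negligible_translation N)
    ultimately show "negligible {x. f x \<noteq> g (fracv x)}" by (rule negligible_subset[rotated])
  qed
qed

lemma AE_torus_shift:
  fixes f :: "real^3 \<Rightarrow> 'b"
  assumes "negligible {x. f x \<noteq> g x}"
  shows "AE x in lebesgue_on torus_cell. f (x + l) = g (x + l)"
proof -
  have "negligible ((+) (-l) ` {x. f x \<noteq> g x})" by (rule negligible_translation[OF assms])
  moreover have "{x. f (x + l) \<noteq> g (x + l)} \<subseteq> (+) (-l) ` {x. f x \<noteq> g x}"
    by (auto simp: image_iff) (metis add.commute add_diff_cancel_left')
  ultimately have "negligible {x. f (x + l) \<noteq> g (x + l)}" by (rule negligible_subset)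
  then have "AE x in lebesgue. f (x + l) = g (x + l)"
    unfolding negligible_iff_null_sets using AE_not_in by force
  then show ?thesis by (auto simp: AE_restrict_space_iff)
qed

lemma borel_measurable_torusI: "f \<in> measurable borel N \<Longrightarrow> f \<in> measurable (lebesgue_on torus_cell) N"
  by (intro measurable_restrict_space1 measurable_completion) simp

lemma (in pair_sigma_finite) AE_pair_fst:
  assumes "AE x in M1. P x"
  shows "AE z in M1 \<Otimes>\<^sub>M M2. P (fst z)"
proof -
  obtain N where N: "N \<in> null_sets M1" "{x \<in> space M1. \<not> P x} \<subseteq> N"
    using assms unfolding eventually_ae_filter by auto
  then have "N \<times> space M2 \<in> null_sets (M1 \<Otimes>\<^sub>M M2)"
    by (auto simp: null_sets_def M2.emeasure_pair_measure_Times)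
  then show ?thesis
    unfolding eventually_ae_filter using N(2) by (intro bexI[of _ "N \<times> space M2"]) (auto simp: space_pair_measure)
qed

lemma (in pair_sigma_finite) AE_pair_snd:
  assumes "AE x in M2. P x"
  shows "AE z in M1 \<Otimes>\<^sub>M M2. P (snd z)"
proof -
  obtain N where N: "N \<in> null_sets M2" "{x \<in> space M2. \<not> P x} \<subseteq> N"
    using assms unfolding eventually_ae_filter by auto
  then have "space M1 \<times> N \<in> null_sets (M1 \<Otimes>\<^sub>M M2)"
    by (auto simp: null_sets_def M2.emeasure_pair_measure_Times)
  then show ?thesis
    unfolding eventually_ae_filter using N(2) by (intro bexI[of _ "space M1 \<times> N"]) (auto simp: space_pair_measure)
qed

text \<open>For fixed y substitute x = y + l, then exchange the integrals. The exchange is done for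
  the Borel representative, which is traded back for f at each l separately, since a translate of a
  null set is null.\<close>

lemma nn_integral_torus_increments:
  fixes f :: "real^3 \<Rightarrow> 'b::euclidean_space" and \<kappa> :: "real^3 \<Rightarrow> ennreal"
  assumes per: "torus_periodic f" and f: "f \<in> borel_measurable (lebesgue_on torus_cell)"
    and \<kappa>[measurable]: "\<kappa> \<in> borel_measurable borel" and \<kappa>per: "torus_periodic \<kappa>"
    and G[measurable]: "G \<in> borel_measurable (borel :: ('b \<times> 'b) measure)"
  shows "(\<integral>\<^sup>+(x, y). \<kappa> (x - y) * G (f x, f y) \<partial>(lebesgue_on torus_cell \<Otimes>\<^sub>M lebesgue_on torus_cell))
    = (\<integral>\<^sup>+l. \<kappa> l * (\<integral>\<^sup>+y. G (f (y + l), f y) \<partial>lebesgue_on torus_cell) * indicator centered_cell l \<partial>lborel)"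
proof -
  define M where "M = lebesgue_on torus_cell"
  interpret M: finite_measure M unfolding M_def by (rule finite_measure_torus)
  interpret P: pair_sigma_finite M M ..
  interpret L: pair_sigma_finite lborel M ..
  obtain g where g[measurable]: "g \<in> borel_measurable borel" and gper: "torus_periodic g" and N: "negligible {x. f x \<noteq> g x}"
    by (rule torus_periodic_ex_borel[OF per f])
  have idM[measurable]: "(\<lambda>x. x) \<in> borel_measurable M" unfolding M_def by (rule borel_measurable_torusI) simp
  have eqM: "AE x in M. f (x + l) = g (x + l)" for l unfolding M_def by (rule AE_torus_shift[OF N])
  have eq0: "AE x in M. f x = g x" using eqM[of 0] by simp
  have "(\<integral>\<^sup>+(x, y). \<kappa> (x - y) * G (f x, f y) \<partial>(M \<Otimes>\<^sub>M M)) = (\<integral>\<^sup>+(x, y). \<kappa> (x - y) * G (g x, g y) \<partial>(M \<Otimes>\<^sub>M M))"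
  proof (rule nn_integral_cong_AE)
    have "AE z in M \<Otimes>\<^sub>M M. f (fst z) = g (fst z)" "AE z in M \<Otimes>\<^sub>M M. f (snd z) = g (snd z)"
      using P.AE_pair_fst[OF eq0] P.AE_pair_snd[OF eq0] by auto
    then show "AE z in M \<Otimes>\<^sub>M M. (case z of (x, y) \<Rightarrow> \<kappa> (x - y) * G (f x, f y)) = (case z of (x, y) \<Rightarrow> \<kappa> (x - y) * G (g x, g y))"
      by eventually_elim (auto simp: case_prod_beta)
  qed
  also have "\<dots> = (\<integral>\<^sup>+y. \<integral>\<^sup>+x. \<kappa> (x - y) * G (g x, g y) \<partial>M \<partial>M)"
    by (subst P.nn_integral_snd[symmetric]) (auto simp: case_prod_beta)
  also have "\<dots> = (\<integral>\<^sup>+y. \<integral>\<^sup>+l. \<kappa> l * G (g (y + l), g y) * indicator centered_cell l \<partial>lborel \<partial>M)"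
  proof (rule nn_integral_cong)
    fix y
    have "torus_periodic (\<lambda>x. \<kappa> (x - y) * G (g x, g y))"
      using \<kappa>per gper unfolding torus_periodic_def by (metis add_diff_eq diff_add_eq)
    then show "(\<integral>\<^sup>+x. \<kappa> (x - y) * G (g x, g y) \<partial>M) = (\<integral>\<^sup>+l. \<kappa> l * G (g (y + l), g y) * indicator centered_cell l \<partial>lborel)"
      unfolding M_def by (subst nn_integral_periodic_shift[of _ y]) auto
  qed
  also have "\<dots> = (\<integral>\<^sup>+l. \<integral>\<^sup>+y. \<kappa> l * G (g (y + l), g y) * indicator centered_cell l \<partial>M \<partial>lborel)"
    by (rule L.Fubini') (simp add: centered_cell_def)
  also have "\<dots> = (\<integral>\<^sup>+l. \<kappa> l * (\<integral>\<^sup>+y. G (f (y + l), f y) \<partial>M) * indicator centered_cell l \<partial>lborel)"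
  proof (rule nn_integral_cong)
    fix l :: "real^3"
    have "(\<integral>\<^sup>+y. \<kappa> l * G (g (y + l), g y) * indicator centered_cell l \<partial>M) 
       = (\<integral>\<^sup>+y. (\<kappa> l * indicator centered_cell l) * G (g (y + l), g y) \<partial>M)"
      by (simp add: ac_simps)
    also have "\<dots> = (\<kappa> l * indicator centered_cell l) * (\<integral>\<^sup>+y. G (g (y + l), g y) \<partial>M)"
      by (rule nn_integral_cmult) measurable
    also have "(\<integral>\<^sup>+y. G (g (y + l), g y) \<partial>M) = (\<integral>\<^sup>+y. G (f (y + l), f y) \<partial>M)"
      by (rule nn_integral_cong_AE) (use eqM[of l] eq0 in \<open>eventually_elim, simp\<close>)
    finally show "(\<integral>\<^sup>+y. \<kappa> l * G (g (y + l), g y) * indicator centered_cell l \<partial>M) 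
       = \<kappa> l * (\<integral>\<^sup>+y. G (f (y + l), f y) \<partial>M) * indicator centered_cell l"
      by (simp add: ac_simps)
  qed
  finally show ?thesis unfolding M_def .
qed

subsection \<open>The kernel\<close>

text \<open>The normalising integral over one period. The even power makes the kernel nonnegative
  and of period 1, and it peaks at 0 with width of order N^(-1/2).\<close>

definition cker_mass :: "nat \<Rightarrow> real" where
  "cker_mass N = integral\<^sup>L lborel (\<lambda>s. indicator {-(1/2)..1/2} s *\<^sub>R cos (pi * s) ^ (2 * N))"

definition cker :: "nat \<Rightarrow> real \<Rightarrow> real" where
  "cker N s = cos (pi * s) ^ (2 * N) / cker_mass N"

definition cker' :: "nat \<Rightarrow> real \<Rightarrow> real" where
  "cker' N s = - (2 * real N * pi * cos (pi * s) ^ (2 * N - 1) * sin (pi * s)) / cker_mass N"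

text \<open>The difference of the two sides vanishes at 0 and has derivative u sin u. The inequality
  later bounds |s| times the kernel by a small multiple of its derivative.\<close>

lemma u_cos_le_sin:
  assumes "0 \<le> u" "u \<le> pi" shows "u * cos u \<le> sin u"
proof -
  have "(\<lambda>u. sin u - u * cos u) 0 \<le> (\<lambda>u. sin u - u * cos u) u"
  proof (rule DERIV_nonneg_imp_nondecreasing[OF assms(1)])
    fix x assume x: "0 \<le> x" "x \<le> u"
    have "((\<lambda>u. sin u - u * cos u) has_real_derivative x * sin x) (at x)"
      by (auto intro!: derivative_eq_intros)
    moreover have "0 \<le> x * sin x" using x assms sin_ge_zero by auto
    ultimately show "\<exists>y. ((\<lambda>u. sin u - u * cos u) has_real_derivative y) (at x) \<and> 0 \<le> y" by blast
  qed
  then show ?thesis by simp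
qed

lemma cos_ge_minus_sq_half: "1 - x\<^sup>2 / 2 \<le> cos (x::real)"
proof -
  have "\<bar>sin (x / 2)\<bar> \<le> \<bar>x / 2\<bar>" by (rule abs_sin_x_le_abs_x)
  then have "(sin (x / 2))\<^sup>2 \<le> (x / 2)\<^sup>2" by (rule abs_le_square_iff[THEN iffD1])
  moreover have "cos x = 1 - 2 * (sin (x / 2))\<^sup>2" using cos_double_sin[of "x / 2"] by simp
  ultimately show ?thesis by (simp add: power_divide)
qed

lemma cos_pi_half_interval:
  assumes "s \<in> {-(1/2)..1/2}" shows "0 \<le> cos (pi * s)"
proof (rule cos_ge_zero)
  show "- (pi / 2) \<le> pi * s" using assms mult_left_mono[of "-(1/2)" s pi] by auto
  show "pi * s \<le> pi / 2" using assms mult_left_mono[of s "1/2" pi] by auto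
qed

lemma cker_mass_integrable:
  "integrable lborel (\<lambda>s. indicator {-(1/2)..1/2::real} s *\<^sub>R cos (pi * s) ^ (2 * N))"
proof -
  have "continuous_on {-(1/2)..1/2} (\<lambda>s::real. cos (pi * s) ^ (2 * N))" by (intro continuous_intros)
  from borel_integrable_atLeastAtMost'[OF this] show ?thesis by (simp add: set_integrable_def)
qed

text \<open>Since cos x is at least 1 - x^2/2, Bernoulli's inequality keeps cos^(2 N) above 1/2 on
  an interval of length of order N^(-1/2). The reciprocal of the mass is the height of the kernel,
  so this also bounds the kernel from above.\<close>

lemma cker_mass_lower:
  assumes N: "N \<ge> 1"
  shows "1 \<le> cker_mass N * pi * sqrt (2 * real N)" "0 < cker_mass N"
proof -
  \<comment> \<open>Chosen so that N (pi h)^2 = 1/2; an interval of length 2 h with values at least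
    1/2 then contributes h to the mass.\<close>
  define h where "h = 1 / (pi * sqrt (2 * real N))"
  have hpos: "0 < h" using N by (simp add: h_def)
  have h2: "real N * (pi * h)\<^sup>2 = 1/2" using N by (simp add: h_def power_divide power_mult_distrib field_simps)
  have "1 * 1 \<le> sqrt (2 * real N)" using N by (simp add: real_le_rsqrt)
  have "h \<le> 1/2"
  proof -
    have "2 * 1 \<le> pi * sqrt (2 * real N)" using N pi_ge_two by (intro mult_mono) (auto simp: real_le_rsqrt)
    then show ?thesis by (simp add: h_def field_simps)
  qed
  have lower: "1/2 \<le> cos (pi * s) ^ (2 * N)" if s: "\<bar>s\<bar> \<le> h" for s
  proof -
    have "s\<^sup>2 \<le> h\<^sup>2" using s by (simp add: abs_le_square_iff[symmetric] hpos)
    then have "real N * (pi * s)\<^sup>2 \<le> 1/2"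
      using h2 by (metis mult_left_mono of_nat_0_le_iff power_mult_distrib zero_le_power2)
    then have b: "real N * (pi * s)\<^sup>2 \<le> 1/2" .
    have "(pi * s)\<^sup>2 \<le> real N * (pi * s)\<^sup>2" using N by (simp add: mult_right_mono[of 1 "real N", simplified])
    then have b1: "(pi * s)\<^sup>2 \<le> 1/2" using b by linarith
    have "1 - real N * (pi * s)\<^sup>2 = 1 + real (2 * N) * (- ((pi * s)\<^sup>2 / 2))" by simp
    also have "\<dots> \<le> (1 + (- ((pi * s)\<^sup>2 / 2))) ^ (2 * N)"
      by (rule Bernoulli_inequality) (use b1 in auto)
    also have "\<dots> \<le> cos (pi * s) ^ (2 * N)"
      using b1 cos_ge_minus_sq_half[of "pi * s"] by (intro power_mono) auto
    finally show ?thesis using b by linarith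
  qed
  have "h = integral\<^sup>L lborel (\<lambda>s. indicator {-h..h} s *\<^sub>R (1/2::real))"
    using hpos by simp
  also have "\<dots> \<le> cker_mass N"
    unfolding cker_mass_def
  proof (rule integral_mono[OF _ cker_mass_integrable])
    show "integrable lborel (\<lambda>s. indicator {-h..h} s *\<^sub>R (1/2::real))" using hpos by simp
    fix s
    show "indicator {-h..h} s *\<^sub>R (1/2) \<le> indicator {-(1/2)..1/2} s *\<^sub>R cos (pi * s) ^ (2 * N)"
      using lower[of s] \<open>h \<le> 1/2\<close> by (auto simp: indicator_def)
  qed
  finally have "h \<le> cker_mass N" .
  then show "0 < cker_mass N" using hpos by linarith
  have "1 = h * (pi * sqrt (2 * real N))" using N by (simp add: h_def)
  also have "\<dots> \<le> cker_mass N * (pi * sqrt (2 * real N))"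
    by (rule mult_right_mono[OF \<open>h \<le> cker_mass N\<close>]) simp
  finally show "1 \<le> cker_mass N * pi * sqrt (2 * real N)" by (simp add: mult.assoc)
qed

lemma cker_nonneg: "0 \<le> cker N s"
proof -
  have "0 \<le> cker_mass N" unfolding cker_mass_def by (rule Bochner_Integration.integral_nonneg) auto
  then show ?thesis by (simp add: cker_def)
qed

lemma cker_has_derivative: "(cker N has_real_derivative cker' N s) (at s)"
  unfolding cker_def[abs_def] cker'_def
  by (rule DERIV_cdivide) (auto intro!: derivative_eq_intros simp: ac_simps)

lemma cker_continuous [continuous_intros]: "continuous_on A (cker N)" "continuous_on A (cker' N)"
  unfolding cker_def[abs_def] cker'_def[abs_def] divide_inverse by (intro continuous_intros)+

lemma cker_borel [measurable]: "cker N \<in> borel_measurable borel" "cker' N \<in> borel_measurable borel"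
  using cker_continuous by (auto intro: borel_measurable_continuous_onI)

lemma nn_integral_cker:
  assumes "N \<ge> 1"
  shows "(\<integral>\<^sup>+s. ennreal (cker N s) * indicator {-(1/2)..1/2} s \<partial>lborel) = 1"
proof -
  have "(\<integral>\<^sup>+s. ennreal (cker N s) * indicator {-(1/2)..1/2} s \<partial>lborel)
     = (\<integral>\<^sup>+s. ennreal (indicator {-(1/2)..1/2} s *\<^sub>R cos (pi * s) ^ (2 * N) / cker_mass N) \<partial>lborel)"
    by (rule nn_integral_cong) (auto simp: cker_def indicator_def)
  also have "\<dots> = ennreal (LINT s|lborel. indicator {-(1/2)..1/2} s *\<^sub>R cos (pi * s) ^ (2 * N) / cker_mass N)"
    using cker_mass_lower[OF assms] cker_mass_integrable[of N]
    by (intro nn_integral_eq_integral) auto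
  also have "(LINT s|lborel. indicator {-(1/2)..1/2} s *\<^sub>R cos (pi * s) ^ (2 * N) / cker_mass N) = 1"
    using cker_mass_lower[OF assms] by (simp add: cker_mass_def[symmetric] del: real_scaleR_def)
  finally show ?thesis by simp
qed

text \<open>The kernel falls away from 0 on both sides. This removes the absolute values in the two
  integrals of \<open>cker'\<close> below and leaves them to the fundamental theorem.\<close>

lemma cker'_sign:
  assumes "s \<in> {-(1/2)..1/2}"
  shows "s \<ge> 0 \<Longrightarrow> cker' N s \<le> 0" "s \<le> 0 \<Longrightarrow> cker' N s \<ge> 0"
proof -
  have m: "0 \<le> cker_mass N" unfolding cker_mass_def by (rule Bochner_Integration.integral_nonneg) auto
  have c: "0 \<le> cos (pi * s) ^ (2 * N - 1)" using cos_pi_half_interval[OF assms] by simp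
  have 1: "0 \<le> sin (pi * s)" if "s \<ge> 0"
    using that assms by (intro sin_ge_zero) (auto simp: mult_le_cancel_left2)
  have 2: "0 \<le> sin (pi * (-s))" if "s \<le> 0"
    using that assms mult_left_mono[of "-s" 1 pi] by (intro sin_ge_zero) (auto simp: mult_nonneg_nonpos)
  show "s \<ge> 0 \<Longrightarrow> cker' N s \<le> 0"
    unfolding cker'_def using m c 1 by (auto intro!: divide_nonpos_nonneg mult_nonneg_nonneg)
  show "s \<le> 0 \<Longrightarrow> cker' N s \<ge> 0"
    unfolding cker'_def using m c 2 by (auto intro!: divide_nonpos_nonneg mult_nonneg_nonpos)
qed

lemma nn_integral_split_0:
  assumes [measurable]: "f \<in> borel_measurable borel"
  shows "(\<integral>\<^sup>+s. f s * indicator {-(1/2)..1/2::real} s \<partial>lborel) \<le> 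
    (\<integral>\<^sup>+s. f s * indicator {-(1/2)..0} s \<partial>lborel) + (\<integral>\<^sup>+s. f s * indicator {0..1/2} s \<partial>lborel)"
  by (subst nn_integral_add[symmetric]) (auto intro!: nn_integral_mono simp: indicator_def)

text \<open>By the sign of the derivative the integrand is - s K'(s). Integration by parts leaves
  the integral of K, which is 1, because s K(s) vanishes at both ends of the period.\<close>

lemma nn_integral_cker'_moment:
  assumes N: "N \<ge> 1"
  shows "(\<integral>\<^sup>+s. ennreal (\<bar>cker' N s\<bar> * \<bar>s\<bar>) * indicator {-(1/2)..1/2} s \<partial>lborel) \<le> 1"
proof -
  have bz: "cker N (1/2) = 0" "cker N (-(1/2)) = 0" using N by (simp_all add: cker_def)
  have int: "integrable lborel (\<lambda>s. indicator {-(1/2)..1/2} s *\<^sub>R f s)" if "continuous_on {-(1/2)..1/2} f" for f :: "real \<Rightarrow> real"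
    using borel_integrable_atLeastAtMost'[OF that] by (simp add: set_integrable_def)
  have k1: "(LINT s|lborel. indicator {-(1/2)..1/2} s *\<^sub>R cker N s) = 1"
  proof -
    have "(LINT s|lborel. indicator {-(1/2)..1/2} s *\<^sub>R cker N s)
        = (LINT s|lborel. indicator {-(1/2)..1/2} s *\<^sub>R cos (pi * s) ^ (2 * N) / cker_mass N)"
      by (rule Bochner_Integration.integral_cong) (auto simp: cker_def)
    then show ?thesis
      using cker_mass_lower[OF N] by (simp add: cker_mass_def[symmetric] del: real_scaleR_def)
  qed
  have "(\<integral>\<^sup>+s. ennreal (\<bar>cker' N s\<bar> * \<bar>s\<bar>) * indicator {-(1/2)..1/2} s \<partial>lborel)
     = (\<integral>\<^sup>+s. ennreal (indicator {-(1/2)..1/2} s *\<^sub>R (- s * cker' N s)) \<partial>lborel)"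
  proof (rule nn_integral_cong)
    fix s :: real
    have "\<bar>cker' N s\<bar> * \<bar>s\<bar> = - s * cker' N s" if "s \<in> {-(1/2)..1/2}"
      using cker'_sign[OF that, of N] by (cases "s \<ge> 0") auto
    then show "ennreal (\<bar>cker' N s\<bar> * \<bar>s\<bar>) * indicator {-(1/2)..1/2} s = ennreal (indicator {-(1/2)..1/2} s *\<^sub>R (- s * cker' N s))"
      by (auto simp: indicator_def)
  qed
  also have "\<dots> = ennreal (LINT s|lborel. indicator {-(1/2)..1/2} s *\<^sub>R (- s * cker' N s))"
  proof (rule nn_integral_eq_integral)
    show "integrable lborel (\<lambda>s. indicator {-(1/2)..1/2} s *\<^sub>R (- s * cker' N s))"
      by (rule int) (intro continuous_intros)
    show "AE s in lborel. 0 \<le> indicator {-(1/2)..1/2} s *\<^sub>R (- s * cker' N s)"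
    proof (rule AE_I2)
      fix s :: real
      show "0 \<le> indicator {-(1/2)..1/2} s *\<^sub>R (- s * cker' N s)"
        using cker'_sign[of s N] by (cases "s \<ge> 0") (auto simp: indicator_def mult_nonneg_nonpos mult_nonpos_nonneg)
    qed
  qed
  also have "(LINT s|lborel. indicator {-(1/2)..1/2} s *\<^sub>R (- s * cker' N s))
     = (LINT s|lborel. indicator {-(1/2)..1/2} s *\<^sub>R cker N s - indicator {-(1/2)..1/2} s *\<^sub>R (cker N s + s * cker' N s))"
    by (rule Bochner_Integration.integral_cong) (auto simp: algebra_simps)
  also have "\<dots> = (LINT s|lborel. indicator {-(1/2)..1/2} s *\<^sub>R cker N s)
       - (LINT s|lborel. indicator {-(1/2)..1/2} s *\<^sub>R (cker N s + s * cker' N s))"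
    by (intro Bochner_Integration.integral_diff int continuous_intros)
  also have "(LINT s|lborel. indicator {-(1/2)..1/2} s *\<^sub>R (cker N s + s * cker' N s))
     = (1/2) * cker N (1/2) - (-(1/2)) * cker N (-(1/2))"
  proof (rule integral_FTC_atLeastAtMost[where F = "\<lambda>s. s * cker N s"])
    fix s :: real
    have "((\<lambda>s. s * cker N s) has_real_derivative (cker N s + s * cker' N s)) (at s)"
      by (auto intro!: derivative_eq_intros cker_has_derivative simp: algebra_simps)
    then show "((\<lambda>s. s * cker N s) has_vector_derivative (cker N s + s * cker' N s)) (at s within {-(1/2)..1/2})"
      by (simp add: has_real_derivative_iff_has_vector_derivative has_vector_derivative_at_within)
  qed (auto intro!: continuous_intros)
  finally show ?thesis using k1 bz by simp
qed

text \<open>The total variation of a function that rises from 0 to its peak and falls back to 0 is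
  twice the peak, here 1 / \<open>cker_mass N\<close>.\<close>

lemma nn_integral_cker':
  assumes N: "N \<ge> 1"
  shows "(\<integral>\<^sup>+s. ennreal \<bar>cker' N s\<bar> * indicator {-(1/2)..1/2} s \<partial>lborel) \<le> ennreal (2 / cker_mass N)"
proof -
  have m: "0 < cker_mass N" using cker_mass_lower[OF N] by blast
  have bz: "cker N (1/2) = 0" "cker N (-(1/2)) = 0" "cker N 0 = 1 / cker_mass N" using N by (simp_all add: cker_def)
  have "(\<integral>\<^sup>+s. ennreal \<bar>cker' N s\<bar> * indicator {-(1/2)..0} s \<partial>lborel)
      = (\<integral>\<^sup>+s. ennreal (cker' N s) * indicator {-(1/2)..0} s \<partial>lborel)"
    using cker'_sign[of _ N] by (intro nn_integral_cong) (auto simp: indicator_def)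
  also have "\<dots> = ennreal (cker N 0 - cker N (-(1/2)))"
    using cker'_sign[of _ N] by (intro nn_integral_FTC_Icc cker_has_derivative) auto
  finally have 1: "(\<integral>\<^sup>+s. ennreal \<bar>cker' N s\<bar> * indicator {-(1/2)..0} s \<partial>lborel) = ennreal (1 / cker_mass N)"
    by (simp add: bz)
  have "(\<integral>\<^sup>+s. ennreal \<bar>cker' N s\<bar> * indicator {0..1/2} s \<partial>lborel)
      = (\<integral>\<^sup>+s. ennreal (- cker' N s) * indicator {0..1/2} s \<partial>lborel)"
    using cker'_sign[of _ N] by (intro nn_integral_cong) (auto simp: indicator_def)
  also have "\<dots> = ennreal ((\<lambda>s. - cker N s) (1/2) - (\<lambda>s. - cker N s) 0)"
    using cker'_sign[of _ N] by (intro nn_integral_FTC_Icc DERIV_minus cker_has_derivative) auto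
  finally have 2: "(\<integral>\<^sup>+s. ennreal \<bar>cker' N s\<bar> * indicator {0..1/2} s \<partial>lborel) = ennreal (1 / cker_mass N)"
    by (simp add: bz)
  have "(\<integral>\<^sup>+s. ennreal \<bar>cker' N s\<bar> * indicator {-(1/2)..1/2} s \<partial>lborel) \<le> ennreal (1 / cker_mass N) + ennreal (1 / cker_mass N)"
    using nn_integral_split_0[of "\<lambda>s. ennreal \<bar>cker' N s\<bar>"] 1 2 by simp
  also have "\<dots> = ennreal (2 / cker_mass N)" using m by (simp flip: ennreal_plus)
  finally show ?thesis .
qed

text \<open>K and K' share the factor cos^(2 N - 1). What remains to compare is |s| cos(pi s) with
  |sin(pi s)| / pi, and the factor 2 N pi of the derivative supplies the gain 1 / N.\<close>

lemma cker_moment_pointwise: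
  assumes N: "N \<ge> 1" and s: "s \<in> {-(1/2)..1/2}"
  shows "cker N s * \<bar>s\<bar> \<le> \<bar>cker' N s\<bar> / (2 * real N * pi\<^sup>2)"
proof -
  have m: "0 < cker_mass N" using cker_mass_lower[OF N] by blast
  have c: "0 \<le> cos (pi * s)" by (rule cos_pi_half_interval[OF s])
  have "(pi * \<bar>s\<bar>) * cos (pi * \<bar>s\<bar>) \<le> sin (pi * \<bar>s\<bar>)"
    using s by (intro u_cos_le_sin) (auto simp: mult_le_cancel_left2)
  also have "cos (pi * \<bar>s\<bar>) = cos (pi * s)" by (simp add: abs_if)
  also have "sin (pi * \<bar>s\<bar>) \<le> \<bar>sin (pi * s)\<bar>" by (simp add: abs_if) 
  finally have *: "\<bar>s\<bar> * cos (pi * s) \<le> \<bar>sin (pi * s)\<bar> / pi" by (simp add: field_simps)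
  have "2 * N = Suc (2 * N - 1)" using N by simp
  then have "cos (pi * s) ^ (2 * N) = cos (pi * s) ^ (2 * N - 1) * cos (pi * s)" by (metis power_Suc2)
  then have "cker N s * \<bar>s\<bar> = cos (pi * s) ^ (2 * N - 1) / cker_mass N * (\<bar>s\<bar> * cos (pi * s))"
    by (simp add: cker_def)
  also have "\<dots> \<le> cos (pi * s) ^ (2 * N - 1) / cker_mass N * (\<bar>sin (pi * s)\<bar> / pi)"
    using c m by (intro mult_left_mono[OF *]) auto
  also have "\<dots> = \<bar>cker' N s\<bar> / (2 * real N * pi\<^sup>2)"
    using c m N by (simp add: cker'_def abs_mult abs_divide power2_eq_square field_simps)
  finally show ?thesis .
qed

lemma nn_integral_cker_moment:
  assumes N: "N \<ge> 1"
  shows "(\<integral>\<^sup>+s. ennreal (cker N s * \<bar>s\<bar>) * indicator {-(1/2)..1/2} s \<partial>lborel) \<le> ennreal (1 / (cker_mass N * real N * pi\<^sup>2))"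
proof -
  have m: "0 < cker_mass N" using cker_mass_lower[OF N] by blast
  have "(\<integral>\<^sup>+s. ennreal (cker N s * \<bar>s\<bar>) * indicator {-(1/2)..1/2} s \<partial>lborel)
     \<le> (\<integral>\<^sup>+s. ennreal (1 / (2 * real N * pi\<^sup>2)) * (ennreal \<bar>cker' N s\<bar> * indicator {-(1/2)..1/2} s) \<partial>lborel)"
    using cker_moment_pointwise[OF N]
    by (intro nn_integral_mono) (auto simp: indicator_def ennreal_mult[symmetric] intro!: ennreal_leI)
  also have "\<dots> = ennreal (1 / (2 * real N * pi\<^sup>2)) * (\<integral>\<^sup>+s. ennreal \<bar>cker' N s\<bar> * indicator {-(1/2)..1/2} s \<partial>lborel)"
    by (rule nn_integral_cmult) auto
  also have "\<dots> \<le> ennreal (1 / (2 * real N * pi\<^sup>2)) * ennreal (2 / cker_mass N)"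
    by (intro mult_left_mono nn_integral_cker'[OF N]) auto
  also have "\<dots> = ennreal (1 / (cker_mass N * real N * pi\<^sup>2))"
    using m by (simp add: ennreal_mult[symmetric] field_simps)
  finally show ?thesis .
qed

text \<open>Constants polynomial in N are good enough, as they meet an exponentially small power of
  cos(pi e). The case e = 0 gives the bounds without decay, used for the coordinates that may be
  close to 0. One exponent, 2 N - 1, serves kernel and derivative.\<close>

lemma cker_bounds:
  assumes N: "N \<ge> 1" and s: "s \<in> {-(1/2)..1/2}" and e: "e \<le> \<bar>s\<bar>" "0 \<le> e"
  shows "cker N s \<le> 2 * pi * real N * cos (pi * e) ^ (2 * N - 1)"
    and "\<bar>cker' N s\<bar> \<le> 2 * pi * real N * (2 * pi * real N * cos (pi * e) ^ (2 * N - 1))"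
proof -
  note ml = cker_mass_lower[OF N]
  have c: "0 \<le> cos (pi * s)" by (rule cos_pi_half_interval[OF s])
  have inv: "1 / cker_mass N \<le> 2 * pi * real N"
  proof -
    have "sqrt (2 * real N) \<le> 2 * real N" using N by (intro real_le_lsqrt) (auto simp: power2_eq_square)
    then have "cker_mass N * pi * sqrt (2 * real N) \<le> cker_mass N * pi * (2 * real N)"
      using ml(2) by (intro mult_left_mono) auto
    then have "1 \<le> cker_mass N * pi * (2 * real N)" using ml(1) by linarith
    then show ?thesis using ml(2) by (simp add: field_simps)
  qed
  have "cos (pi * s) = cos (pi * \<bar>s\<bar>)" by (simp add: abs_if)
  also have "\<dots> \<le> cos (pi * e)"
    using s e by (intro cos_monotone_0_pi_le) (auto simp: mult_le_cancel_left2)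
  finally have ce: "cos (pi * s) \<le> cos (pi * e)" .
  have c': "0 \<le> cos (pi * e)" using c ce by linarith
  have p: "cos (pi * s) ^ (2 * N - 1) \<le> cos (pi * e) ^ (2 * N - 1)" by (rule power_mono[OF ce c])
  have "cos (pi * s) ^ (2 * N) \<le> cos (pi * s) ^ (2 * N - 1)" by (rule power_decreasing) (use c in auto)
  then have "cos (pi * s) ^ (2 * N) \<le> cos (pi * e) ^ (2 * N - 1)" using p by linarith
  then have "cos (pi * s) ^ (2 * N) * (1 / cker_mass N) \<le> cos (pi * e) ^ (2 * N - 1) * (2 * pi * real N)"
    using inv c c' ml by (intro mult_mono) auto
  then show "cker N s \<le> 2 * pi * real N * cos (pi * e) ^ (2 * N - 1)" by (simp add: cker_def mult.commute)
  have "\<bar>cker' N s\<bar> = 2 * real N * pi * (cos (pi * s) ^ (2 * N - 1) * (1 / cker_mass N)) * \<bar>sin (pi * s)\<bar>"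
    using c ml by (simp add: cker'_def abs_mult)
  also have "\<dots> \<le> 2 * real N * pi * (cos (pi * s) ^ (2 * N - 1) * (1 / cker_mass N)) * 1"
    using c ml by (intro mult_left_mono) auto
  also have "\<dots> \<le> 2 * real N * pi * (cos (pi * e) ^ (2 * N - 1) * (2 * pi * real N))"
    unfolding mult_1_right
    using inv c c' ml p by (intro mult_left_mono mult_mono) auto
  finally show "\<bar>cker' N s\<bar> \<le> 2 * pi * real N * (2 * pi * real N * cos (pi * e) ^ (2 * N - 1))" by (simp add: ac_simps)
qed

section \<open>The product kernel on the torus and its gradient\<close>

definition ker :: "nat \<Rightarrow> real^3 \<Rightarrow> real" where
  "ker N x = (\<Prod>i\<in>UNIV. cker N (x $ i))"

definition gker :: "nat \<Rightarrow> real^3 \<Rightarrow> real^3" where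
  "gker N x = (\<chi> i. cker' N (x $ i) * (\<Prod>j\<in>UNIV - {i}. cker N (x $ j)))"

lemma cker_even: "cker N (- s) = cker N s"
  by (simp add: cker_def)

lemma cker'_odd: "cker' N (- s) = - cker' N s"
  by (simp add: cker'_def)

lemma ker_nonneg: "0 \<le> ker N x"
  unfolding ker_def by (intro prod_nonneg) (simp add: cker_nonneg)

lemma ker_even: "ker N (x - y) = ker N (y - x)"
  unfolding ker_def by (intro prod.cong refl) (metis cker_even minus_diff_eq vector_minus_component vector_uminus_component)

lemma gker_odd: "gker N (x - y) = - gker N (y - x)"
proof -
  have "cker N (x $ j - y $ j) = cker N (y $ j - x $ j)" "cker' N (x $ j - y $ j) = - cker' N (y $ j - x $ j)" for j
    by (metis cker_even minus_diff_eq, metis cker'_odd minus_diff_eq)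
  then show ?thesis by (simp add: gker_def vec_eq_iff)
qed

lemma ker_has_derivative: "(ker N has_derivative (\<lambda>h. gker N x \<bullet> h)) (at x)"
proof -
  have "(ker N has_derivative (\<lambda>h. \<Sum>i\<in>UNIV. cker' N (x $ i) * h $ i * (\<Prod>j\<in>UNIV - {i}. cker N (x $ j)))) (at x)"
    unfolding ker_def[abs_def]
  proof (rule has_derivative_prod)
    fix i
    have "((\<lambda>x::real^3. x $ i) has_derivative (\<lambda>h. h $ i)) (at x)"
      by (intro bounded_linear_imp_has_derivative bounded_linear_vec_nth)
    moreover have "(cker N has_derivative (\<lambda>h. cker' N (x $ i) * h)) (at (x $ i))"
      using cker_has_derivative by (simp add: has_field_derivative_def)
    ultimately show "((\<lambda>x. cker N (x $ i)) has_derivative (\<lambda>h. cker' N (x $ i) * h $ i)) (at x)"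
      by (rule has_derivative_compose)
  qed
  moreover have "(\<Sum>i\<in>UNIV. cker' N (x $ i) * h $ i * (\<Prod>j\<in>UNIV - {i}. cker N (x $ j))) = gker N x \<bullet> h" for h
    by (simp add: gker_def inner_vec_def mult_ac)
  ultimately show ?thesis by simp
qed

lemma ker_continuous: "continuous_on A (ker N)"
  unfolding ker_def[abs_def] cker_def[abs_def] divide_inverse by (intro continuous_intros)

lemma gker_continuous: "continuous_on A (gker N)"
  unfolding gker_def[abs_def] cker_def[abs_def] cker'_def[abs_def] divide_inverse
  by (intro continuous_intros continuous_on_vec_lambda)

lemma cker_pi_periodic:
  "cos (pi * (s + 1)) = - cos (pi * s)" "sin (pi * (s + 1)) = - sin (pi * s)"
  by (simp_all add: distrib_left)

lemma cker_periodic: "cker N (s + 1) = cker N s" "N \<ge> 1 \<Longrightarrow> cker' N (s + 1) = cker' N s"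
  unfolding cker_def cker'_def cker_pi_periodic by (simp_all add: power_minus_odd)

lemma ker_periodic: "torus_periodic (ker N)"
  unfolding torus_periodic_def
proof (intro allI)
  fix x :: "real^3" and i
  have "cker N ((x + axis i 1) $ j) = cker N (x $ j)" for j
    by (cases "j = i") (auto simp: axis_def cker_periodic)
  then show "ker N (x + axis i 1) = ker N x" by (simp add: ker_def)
qed

lemma gker_periodic: 
  assumes "N \<ge> 1" shows "torus_periodic (gker N)"
  unfolding torus_periodic_def
proof (intro allI)
  fix x :: "real^3" and i
  have "cker N ((x + axis i 1) $ j) = cker N (x $ j)" "cker' N ((x + axis i 1) $ j) = cker' N (x $ j)" for j
    by (cases "j = i", auto simp: axis_def cker_periodic(1) cker_periodic(2)[OF assms])
  then show "gker N (x + axis i 1) = gker N x" by (simp add: gker_def)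
qed

subsection \<open>Integrals of the kernel\<close>

lemma nn_integral_prod_vec:
  fixes f :: "'n::finite \<Rightarrow> real \<Rightarrow> ennreal"
  assumes [measurable]: "\<And>i. f i \<in> borel_measurable borel"
  shows "(\<integral>\<^sup>+x. (\<Prod>i\<in>UNIV. f i (x $ i)) \<partial>lborel) = (\<Prod>i\<in>UNIV. \<integral>\<^sup>+s. f i s \<partial>lborel)"
proof -
  \<comment> \<open>\<open>THE\<close> inverts the enumeration of the basis vectors, so that a
    product over \<open>Basis\<close> becomes one over coordinates.\<close>
  define g where "g b = f (THE i. b = axis i (1::real))" for b :: "real^'n"
  have the: "(THE i. axis j (1::real) = axis i 1) = j" for j :: 'n
    by (rule the_equality) (auto simp: axis_eq_axis)
  have inj: "inj (\<lambda>i::'n. axis i (1::real))" by (auto simp: inj_def axis_eq_axis)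
  have B: "(Basis :: (real^'n) set) = range (\<lambda>i. axis i 1)" by (auto simp: Basis_vec_def)
  have "(\<integral>\<^sup>+x. (\<Prod>b\<in>Basis. g b (x \<bullet> b)) \<partial>lborel) = (\<Prod>b\<in>Basis. \<integral>\<^sup>+s. g b s \<partial>lborel)"
    by (rule nn_integral_lborel_prod) (auto simp: g_def)
  then show ?thesis
    unfolding B by (simp add: prod.reindex[OF inj] g_def the inner_axis)
qed

lemma centered_cell_indicator:
  "indicator centered_cell x = (\<Prod>i\<in>UNIV. indicator {-(1/2)..1/2} (x $ i) :: ennreal)"
proof (cases "x \<in> centered_cell")
  case True
  then have "x $ i \<in> {-(1/2)..1/2}" for i by (auto simp: centered_cell_def mem_box_cart dest: spec[of _ i])
  then show ?thesis using True by simp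
next
  case False
  then obtain i where "x $ i \<notin> {-(1/2)..1/2}" by (auto simp: centered_cell_def mem_box_cart)
  then have "(\<Prod>i\<in>UNIV. indicator {-(1/2)..1/2} (x $ i) :: ennreal) = 0"
    by (intro prod_zero bexI[of _ i]) (simp_all add: indicator_def)
  then show ?thesis using False by simp
qed

lemma nn_integral_ker_cell:
  assumes "N \<ge> 1"
  shows "(\<integral>\<^sup>+x. ennreal (ker N x) * indicator centered_cell x \<partial>lborel) = 1"
proof -
  have "(\<integral>\<^sup>+x. ennreal (ker N x) * indicator centered_cell x \<partial>lborel)
     = (\<integral>\<^sup>+x. (\<Prod>i\<in>UNIV. (\<lambda>s. ennreal (cker N s) * indicator {-(1/2)..1/2} s) (x $ i)) \<partial>(lborel :: (real^3) measure))"
    by (intro nn_integral_cong) (simp add: centered_cell_indicator ker_def prod.distrib prod_ennreal cker_nonneg)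
  also have "\<dots> = (\<Prod>i\<in>(UNIV :: 3 set). \<integral>\<^sup>+s. ennreal (cker N s) * indicator {-(1/2)..1/2} s \<partial>lborel)"
    by (rule nn_integral_prod_vec) auto
  finally show ?thesis using nn_integral_cker[OF assms] by simp
qed

text \<open>The integral factors into one-dimensional ones. For i = j the derivative meets |s| in
  the same factor, with integral at most 1. For i \<noteq> j a total variation of order N^(1/2)
  meets a first moment of order N^(-1/2); their product is at most 2 / (mass^2 N pi^2), and the
  lower bound of the mass makes this at most 4, whatever N is.\<close>

lemma nn_integral_gker_moment_component:
  fixes i j :: 3
  assumes N: "N \<ge> 1"
  shows "(\<integral>\<^sup>+x. ennreal (\<bar>gker N x $ i\<bar> * \<bar>x $ j\<bar>) * indicator centered_cell x \<partial>lborel) \<le> 4"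
proof -
  define J where "J = {-(1/2)..1/2::real}"
  define f where "f m s = ennreal ((if m = i then \<bar>cker' N s\<bar> else cker N s) * (if m = j then \<bar>s\<bar> else 1)) * indicator J s" for m :: 3 and s
  have [measurable]: "f m \<in> borel_measurable borel" for m unfolding f_def J_def by measurable
  have "(\<integral>\<^sup>+x. ennreal (\<bar>gker N x $ i\<bar> * \<bar>x $ j\<bar>) * indicator centered_cell x \<partial>lborel)
     = (\<integral>\<^sup>+x. (\<Prod>m\<in>UNIV. f m (x $ m)) \<partial>(lborel :: (real^3) measure))"
  proof (rule nn_integral_cong)
    fix x :: "real^3"
    have "(\<Prod>m\<in>UNIV. (if m = i then \<bar>cker' N (x $ m)\<bar> else cker N (x $ m)) * (if m = j then \<bar>x $ m\<bar> else 1))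
       = (\<Prod>m\<in>UNIV. (if m = i then \<bar>cker' N (x $ m)\<bar> else cker N (x $ m))) * (\<Prod>m\<in>UNIV. (if m = j then \<bar>x $ m\<bar> else 1))"
      by (rule prod.distrib)
    also have "(\<Prod>m\<in>UNIV. (if m = j then \<bar>x $ m\<bar> else 1)) = \<bar>x $ j\<bar>" by simp
    also have "(\<Prod>m\<in>UNIV. (if m = i then \<bar>cker' N (x $ m)\<bar> else cker N (x $ m))) = \<bar>gker N x $ i\<bar>"
    proof -
      have "(\<Prod>m\<in>UNIV. (if m = i then \<bar>cker' N (x $ m)\<bar> else cker N (x $ m)))
          = (if i = i then \<bar>cker' N (x $ i)\<bar> else cker N (x $ i)) * (\<Prod>m\<in>UNIV - {i}. (if m = i then \<bar>cker' N (x $ m)\<bar> else cker N (x $ m)))"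
        by (rule prod.remove) auto
      also have "(\<Prod>m\<in>UNIV - {i}. (if m = i then \<bar>cker' N (x $ m)\<bar> else cker N (x $ m))) = (\<Prod>m\<in>UNIV - {i}. cker N (x $ m))"
        by (rule prod.cong) auto
      finally show ?thesis by (simp add: gker_def abs_mult abs_prod cker_nonneg)
    qed
    finally have *: "(\<Prod>m\<in>UNIV. (if m = i then \<bar>cker' N (x $ m)\<bar> else cker N (x $ m)) * (if m = j then \<bar>x $ m\<bar> else 1))
       = \<bar>gker N x $ i\<bar> * \<bar>x $ j\<bar>" .
    show "ennreal (\<bar>gker N x $ i\<bar> * \<bar>x $ j\<bar>) * indicator centered_cell x = (\<Prod>m\<in>UNIV. f m (x $ m))"
    proof -
      have "(\<Prod>m\<in>UNIV. f m (x $ m)) = (\<Prod>m\<in>UNIV. ennreal ((if m = i then \<bar>cker' N (x $ m)\<bar> else cker N (x $ m)) * (if m = j then \<bar>x $ m\<bar> else 1)))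
          * (\<Prod>m\<in>UNIV. indicator J (x $ m))"
        unfolding f_def by (rule prod.distrib)
      also have "(\<Prod>m\<in>UNIV. ennreal ((if m = i then \<bar>cker' N (x $ m)\<bar> else cker N (x $ m)) * (if m = j then \<bar>x $ m\<bar> else 1)))
          = ennreal (\<bar>gker N x $ i\<bar> * \<bar>x $ j\<bar>)"
        unfolding *[symmetric] by (rule prod_ennreal) (simp add: cker_nonneg)
      finally show ?thesis by (simp add: J_def centered_cell_indicator)
    qed
  qed
  also have "\<dots> = (\<Prod>m\<in>UNIV. \<integral>\<^sup>+s. f m s \<partial>lborel)"
    by (rule nn_integral_prod_vec) measurable
  also have "\<dots> \<le> 4"
  proof -
    have other: "(\<integral>\<^sup>+s. f m s \<partial>lborel) = 1" if "m \<noteq> i" "m \<noteq> j" for m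
      using nn_integral_cker[OF N] that by (simp add: f_def J_def)
    show ?thesis
    proof (cases "i = j")
      case True
      have "(\<Prod>m\<in>UNIV. \<integral>\<^sup>+s. f m s \<partial>lborel) = (\<integral>\<^sup>+s. f i s \<partial>lborel)"
      proof -
        have "(\<Prod>m\<in>UNIV. \<integral>\<^sup>+s. f m s \<partial>lborel) = (\<integral>\<^sup>+s. f i s \<partial>lborel) * (\<Prod>m\<in>UNIV - {i}. \<integral>\<^sup>+s. f m s \<partial>lborel)"
          by (rule prod.remove) auto
        also have "(\<Prod>m\<in>UNIV - {i}. \<integral>\<^sup>+s. f m s \<partial>lborel) = 1"
          using other True by (intro prod.neutral) auto
        finally show ?thesis by simp
      qed
      also have "\<dots> \<le> 1" using nn_integral_cker'_moment[OF N] True by (simp add: f_def J_def)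
      finally show ?thesis by (rule order_trans) simp
    next
      case False
      have "(\<Prod>m\<in>UNIV. \<integral>\<^sup>+s. f m s \<partial>lborel) = (\<integral>\<^sup>+s. f i s \<partial>lborel) * ((\<integral>\<^sup>+s. f j s \<partial>lborel) * (\<Prod>m\<in>UNIV - {i} - {j}. \<integral>\<^sup>+s. f m s \<partial>lborel))"
      proof -
        have "(\<Prod>m\<in>UNIV. \<integral>\<^sup>+s. f m s \<partial>lborel) = (\<integral>\<^sup>+s. f i s \<partial>lborel) * (\<Prod>m\<in>UNIV - {i}. \<integral>\<^sup>+s. f m s \<partial>lborel)"
          by (rule prod.remove) auto
        also have "(\<Prod>m\<in>UNIV - {i}. \<integral>\<^sup>+s. f m s \<partial>lborel) = (\<integral>\<^sup>+s. f j s \<partial>lborel) * (\<Prod>m\<in>UNIV - {i} - {j}. \<integral>\<^sup>+s. f m s \<partial>lborel)"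
          by (rule prod.remove) (use False in auto)
        finally show ?thesis .
      qed
      also have "(\<Prod>m\<in>UNIV - {i} - {j}. \<integral>\<^sup>+s. f m s \<partial>lborel) = 1" using other by (intro prod.neutral) auto
      also have "(\<integral>\<^sup>+s. f i s \<partial>lborel) * ((\<integral>\<^sup>+s. f j s \<partial>lborel) * 1)
        \<le> ennreal (2 / cker_mass N) * ennreal (1 / (cker_mass N * real N * pi\<^sup>2))"
        using nn_integral_cker'[OF N] nn_integral_cker_moment[OF N] False
        by (intro mult_mono) (auto simp: f_def J_def)
      also have "\<dots> = ennreal (2 / (cker_mass N ^ 2 * real N * pi\<^sup>2))"
        using cker_mass_lower[OF N] by (simp add: ennreal_mult[symmetric] power2_eq_square field_simps)
      also have "2 / (cker_mass N ^ 2 * real N * pi\<^sup>2) \<le> 4"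
      proof -
        have "1\<^sup>2 \<le> (cker_mass N * pi * sqrt (2 * real N))\<^sup>2"
          using cker_mass_lower(1)[OF N] by (intro power_mono) auto
        then have "1 \<le> cker_mass N ^ 2 * pi\<^sup>2 * (2 * real N)" by (simp add: power_mult_distrib)
        then show ?thesis using cker_mass_lower(2)[OF N] N by (simp add: field_simps)
      qed
      finally show ?thesis by (simp add: ennreal_leI)
    qed
  qed
  finally show ?thesis .
qed

text \<open>Bounding both Euclidean norms by sums of coordinates gives nine component integrals of
  at most 4 each.\<close>

lemma nn_integral_gker_moment:
  assumes N: "N \<ge> 1"
  shows "(\<integral>\<^sup>+x. ennreal (norm (gker N x) * norm x) * indicator centered_cell x \<partial>lborel) \<le> 36"
proof -
  have [measurable]: "gker N \<in> borel_measurable borel" using gker_continuous by (rule borel_measurable_continuous_onI)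
  have [measurable]: "(\<lambda>x. gker N x $ i) \<in> borel_measurable borel" for i
    by (intro borel_measurable_continuous_onI continuous_intros gker_continuous)
  have [measurable]: "centered_cell \<in> sets borel" by (simp add: centered_cell_def)
  have "(\<integral>\<^sup>+x. ennreal (norm (gker N x) * norm x) * indicator centered_cell x \<partial>lborel)
     \<le> (\<integral>\<^sup>+x. (\<Sum>i\<in>UNIV. \<Sum>j\<in>UNIV. ennreal (\<bar>gker N x $ i\<bar> * \<bar>x $ j\<bar>) * indicator centered_cell x) \<partial>lborel)"
  proof (rule nn_integral_mono)
    fix x :: "real^3"
    have "norm (gker N x) * norm x \<le> (\<Sum>i\<in>UNIV. \<bar>gker N x $ i\<bar>) * (\<Sum>j\<in>UNIV. \<bar>x $ j\<bar>)"
      by (intro mult_mono norm_le_l1_cart sum_nonneg) auto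
    also have "\<dots> = (\<Sum>i\<in>UNIV. \<Sum>j\<in>UNIV. \<bar>gker N x $ i\<bar> * \<bar>x $ j\<bar>)" by (rule sum_product)
    finally show "ennreal (norm (gker N x) * norm x) * indicator centered_cell x
       \<le> (\<Sum>i\<in>UNIV. \<Sum>j\<in>UNIV. ennreal (\<bar>gker N x $ i\<bar> * \<bar>x $ j\<bar>) * indicator centered_cell x)"
      by (auto simp: indicator_def sum_nonneg intro!: ennreal_leI)
  qed
  also have "\<dots> = (\<Sum>i\<in>UNIV. \<Sum>j\<in>UNIV. \<integral>\<^sup>+x. ennreal (\<bar>gker N x $ i\<bar> * \<bar>x $ j\<bar>) * indicator centered_cell x \<partial>lborel)"
  proof -
    define h where "h i j x = ennreal (\<bar>gker N x $ i\<bar> * \<bar>x $ j\<bar>) * indicator centered_cell x" for i j :: 3 and x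
    have [measurable]: "h i j \<in> borel_measurable borel" for i j unfolding h_def by measurable
    have "(\<integral>\<^sup>+x. (\<Sum>i\<in>UNIV. \<Sum>j\<in>UNIV. h i j x) \<partial>lborel) = (\<Sum>i\<in>UNIV. \<integral>\<^sup>+x. (\<Sum>j\<in>UNIV. h i j x) \<partial>lborel)"
      by (rule nn_integral_sum) measurable
    also have "\<dots> = (\<Sum>i\<in>UNIV. \<Sum>j\<in>UNIV. \<integral>\<^sup>+x. h i j x \<partial>lborel)"
      by (intro sum.cong refl nn_integral_sum) measurable
    finally show ?thesis by (simp only: h_def)
  qed
  also have "\<dots> \<le> (\<Sum>i\<in>(UNIV::3 set). \<Sum>j\<in>(UNIV::3 set). 4)"
    by (intro sum_mono nn_integral_gker_moment_component[OF N])
  also have "\<dots> = 36" by simp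
  finally show ?thesis .
qed

text \<open>If the norm is at least 3 e, some coordinate has modulus at least e, and that one factor
  carries the decay. The remaining factors are bounded by powers of 2 pi N: one for each value of
  the kernel, two for its derivative.\<close>

lemma gker_tail:
  assumes N: "N \<ge> 1" and e: "0 \<le> e" "e \<le> 1/2" and x: "x \<in> centered_cell" "3 * e \<le> norm x"
  shows "ker N x \<le> (2 * pi * real N) ^ 3 * cos (pi * e) ^ (2 * N - 1)"
    and "norm (gker N x) \<le> 3 * (2 * pi * real N) ^ 4 * cos (pi * e) ^ (2 * N - 1)"
proof -
  define A where "A = 2 * pi * real N"
  define q where "q = cos (pi * e) ^ (2 * N - 1)"
  have A1: "1 \<le> A"
  proof -
    have "1 * 1 \<le> (2 * pi) * real N" using N pi_ge_two by (intro mult_mono) auto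
    then show ?thesis by (simp add: A_def)
  qed
  have q01: "0 \<le> q" "q \<le> 1" using e cos_pi_half_interval[of e] by (auto simp: q_def power_le_one)
  have J: "x $ i \<in> {-(1/2)..1/2}" for i using x(1) by (auto simp: centered_cell_def mem_box_cart dest: spec[of _ i])
  have "\<exists>i. e \<le> \<bar>x $ i\<bar>"
  proof (rule ccontr)
    assume "\<not> ?thesis"
    then have "(\<Sum>i\<in>UNIV. \<bar>x $ i\<bar>) < (\<Sum>i\<in>(UNIV::3 set). e)" by (intro sum_strict_mono) (auto simp: not_le)
    then show False using norm_le_l1_cart[of x] x(2) by simp
  qed
  then obtain i where i: "e \<le> \<bar>x $ i\<bar>" by blast
  have k: "cker N (x $ j) \<le> A" "\<bar>cker' N (x $ j)\<bar> \<le> A * A" for j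
    using cker_bounds[OF N J[of j], of 0] by (auto simp: A_def)
  have ki: "cker N (x $ i) \<le> A * q" "\<bar>cker' N (x $ i)\<bar> \<le> A * (A * q)"
    using cker_bounds[OF N J[of i] i e(1)] by (auto simp: A_def q_def)
  have "ker N x = cker N (x $ i) * (\<Prod>j\<in>UNIV - {i}. cker N (x $ j))"
    unfolding ker_def by (rule prod.remove) auto
  also have "\<dots> \<le> (A * q) * (\<Prod>j\<in>UNIV - {i}. A)"
    using ki k A1 q01 by (intro mult_mono prod_mono prod_nonneg) (auto simp: cker_nonneg)
  also have "\<dots> = A ^ 3 * q" by (simp add: power3_eq_cube power2_eq_square)
  finally show "ker N x \<le> (2 * pi * real N) ^ 3 * cos (pi * e) ^ (2 * N - 1)" by (simp add: A_def q_def)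
  have comp: "\<bar>gker N x $ j\<bar> \<le> A ^ 4 * q" for j
  proof -
    have "\<bar>gker N x $ j\<bar> = \<bar>cker' N (x $ j)\<bar> * (\<Prod>m\<in>UNIV - {j}. cker N (x $ m))"
      by (simp add: gker_def abs_mult abs_prod cker_nonneg)
    also have "\<dots> \<le> A ^ 4 * q"
    proof (cases "i = j")
      case True
      have "\<bar>cker' N (x $ j)\<bar> * (\<Prod>m\<in>UNIV - {j}. cker N (x $ m)) \<le> (A * (A * q)) * (\<Prod>m\<in>UNIV - {j}. A)"
        using ki k A1 q01 True by (intro mult_mono prod_mono prod_nonneg) (auto simp: cker_nonneg)
      also have "\<dots> = A ^ 4 * q" by (simp add: power4_eq_xxxx power2_eq_square)
      finally show ?thesis .
    next
      case False
      have "(\<Prod>m\<in>UNIV - {j}. cker N (x $ m)) = cker N (x $ i) * (\<Prod>m\<in>UNIV - {j} - {i}. cker N (x $ m))"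
        using False by (intro prod.remove) auto
      also have "\<dots> \<le> (A * q) * (\<Prod>m\<in>UNIV - {j} - {i}. A)"
        using ki k A1 q01 by (intro mult_mono prod_mono prod_nonneg) (auto simp: cker_nonneg)
      also have "\<dots> = A * q * A" using False by (simp add: card_Diff_singleton)
      finally have "\<bar>cker' N (x $ j)\<bar> * (\<Prod>m\<in>UNIV - {j}. cker N (x $ m)) \<le> (A * A) * (A * q * A)"
        using k A1 q01 by (intro mult_mono) (auto intro!: prod_nonneg simp: cker_nonneg)
      then show ?thesis by (simp add: power4_eq_xxxx mult_ac)
    qed
    finally show ?thesis .
  qed
  have "norm (gker N x) \<le> (\<Sum>j\<in>UNIV. \<bar>gker N x $ j\<bar>)" by (rule norm_le_l1_cart)
  also have "\<dots> \<le> (\<Sum>j\<in>(UNIV::3 set). A ^ 4 * q)" by (intro sum_mono comp)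
  finally show "norm (gker N x) \<le> 3 * (2 * pi * real N) ^ 4 * cos (pi * e) ^ (2 * N - 1)" by (simp add: A_def q_def)
qed

lemma gker_tail_tendsto_0:
  assumes "0 < e" "e < 1/2"
  shows "(\<lambda>N. 3 * (2 * pi * real N) ^ 4 * cos (pi * e) ^ (2 * N - 1)) \<longlonglongrightarrow> 0"
proof -
  define \<theta> where "\<theta> = cos (pi * e)"
  have "pi * e < pi * (1/2)" using assms by (intro mult_strict_left_mono) auto
  then have "cos (pi / 2) < \<theta>" unfolding \<theta>_def using assms by (intro cos_monotone_0_pi) auto
  then have "0 < \<theta>" by simp
  have "\<theta> < cos 0" unfolding \<theta>_def using assms by (intro cos_monotone_0_pi) (auto simp: mult_le_cancel_left2)
  then have "\<theta> < 1" by simp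
  define a where "a = - ln \<theta>"
  have a: "0 < a" "\<theta> = exp (- a)" using \<open>0 < \<theta>\<close> \<open>\<theta> < 1\<close> by (auto simp: a_def)
  have "filterlim (\<lambda>N. a * real N) at_top sequentially"
    using a by (intro filterlim_tendsto_pos_mult_at_top[OF tendsto_const] filterlim_real_sequentially) auto
  then have "(\<lambda>N. (a * real N) ^ 4 / exp (a * real N)) \<longlonglongrightarrow> 0"
    by (rule filterlim_compose[OF tendsto_power_div_exp_0])
  then have lim: "(\<lambda>N. (3 * (2 * pi) ^ 4 / a ^ 4) * ((a * real N) ^ 4 / exp (a * real N))) \<longlonglongrightarrow> 0"
    by (rule tendsto_mult_right_zero)
  show ?thesis
  proof (rule tendsto_sandwich[OF _ _ tendsto_const lim])
    show "\<forall>\<^sub>F N in sequentially. 0 \<le> 3 * (2 * pi * real N) ^ 4 * cos (pi * e) ^ (2 * N - 1)"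
      using \<open>0 < \<theta>\<close> by (simp add: \<theta>_def)
    show "\<forall>\<^sub>F N in sequentially. 3 * (2 * pi * real N) ^ 4 * cos (pi * e) ^ (2 * N - 1)
      \<le> (3 * (2 * pi) ^ 4 / a ^ 4) * ((a * real N) ^ 4 / exp (a * real N))"
    proof (rule eventually_sequentiallyI)
      fix N :: nat assume "1 \<le> N"
      then have "\<theta> ^ (2 * N - 1) \<le> \<theta> ^ N" using \<open>0 < \<theta>\<close> \<open>\<theta> < 1\<close> by (intro power_decreasing) auto
      also have "\<theta> ^ N = 1 / exp (a * real N)"
        unfolding a(2) by (simp add: exp_of_nat_mult[symmetric] exp_minus field_simps)
      finally have "3 * (2 * pi * real N) ^ 4 * \<theta> ^ (2 * N - 1) \<le> 3 * (2 * pi * real N) ^ 4 * (1 / exp (a * real N))"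
        by (intro mult_left_mono) auto
      also have "\<dots> = (3 * (2 * pi) ^ 4 / a ^ 4) * ((a * real N) ^ 4 / exp (a * real N))"
        using a by (simp add: power_mult_distrib field_simps)
      finally show "3 * (2 * pi * real N) ^ 4 * cos (pi * e) ^ (2 * N - 1)
        \<le> (3 * (2 * pi) ^ 4 / a ^ 4) * ((a * real N) ^ 4 / exp (a * real N))" by (simp add: \<theta>_def)
    qed
  qed
qed

subsection \<open>Finite rank of the kernel\<close>

definition smooth_periodic :: "(real^3 \<Rightarrow> real) \<Rightarrow> bool" where
  "smooth_periodic a \<longleftrightarrow> smooth a \<and> torus_periodic a"

definition space_grad :: "(real^3 \<Rightarrow> real) \<Rightarrow> real^3 \<Rightarrow> real^3" where
  "space_grad a x = (\<chi> i. frechet_derivative a (at x) (axis i 1))"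

lemma space_grad_has_derivative:
  assumes "smooth a" shows "(a has_derivative (\<lambda>h. space_grad a x \<bullet> h)) (at x)"
proof -
  have l: "linear (frechet_derivative a (at x))"
    by (rule linear_frechet_derivative[OF smooth_differentiable[OF assms]])
  have "frechet_derivative a (at x) h = space_grad a x \<bullet> h" for h
  proof -
    have "frechet_derivative a (at x) h = frechet_derivative a (at x) (\<Sum>i\<in>UNIV. h $ i *\<^sub>R axis i 1)"
      using basis_expansion[of h] by (simp add: scalar_mult_eq_scaleR)
    also have "\<dots> = space_grad a x \<bullet> h"
      by (simp add: linear_sum[OF l] linear_cmul[OF l] space_grad_def inner_vec_def mult.commute)
    finally show ?thesis .
  qed
  then have "frechet_derivative a (at x) = (\<lambda>h. space_grad a x \<bullet> h)" by (rule ext)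
  then show ?thesis using smooth_has_derivative[OF assms, of x] by metis
qed

lemma space_grad_continuous:
  assumes "smooth a" shows "continuous_on A (space_grad a)"
  unfolding space_grad_def[abs_def]
  by (intro continuous_on_vec_lambda smooth_continuous smooth_frechet_derivative_Basis[OF assms]) (auto simp: axis_in_Basis_iff)

lemma smooth_periodic_const: "smooth_periodic (\<lambda>x. c)"
  by (simp add: smooth_periodic_def smooth_const torus_periodic_def)

lemma smooth_periodic_mult: "smooth_periodic a \<Longrightarrow> smooth_periodic b \<Longrightarrow> smooth_periodic (\<lambda>x. a x * b x)"
  by (simp add: smooth_periodic_def smooth_mult torus_periodic_def)

lemma smooth_periodic_trig: "smooth_periodic (\<lambda>x. cos (2 * pi * x $ i))" "smooth_periodic (\<lambda>x. sin (2 * pi * x $ i))"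
proof -
  have p: "2 * pi * (s + axis j 1 $ i) = 2 * pi * s \<or> 2 * pi * (s + axis j 1 $ i) = 2 * pi * s + 2 * pi" for s :: real and j :: 3
    by (cases "j = i") (auto simp: axis_def algebra_simps)
  then have q: "cos (2 * pi * (s + axis j 1 $ i)) = cos (2 * pi * s)" "sin (2 * pi * (s + axis j 1 $ i)) = sin (2 * pi * s)" for s :: real and j :: 3
    by (metis cos_periodic, metis sin_periodic)
  show "smooth_periodic (\<lambda>x. cos (2 * pi * x $ i))" "smooth_periodic (\<lambda>x. sin (2 * pi * x $ i))"
    using smooth_trig_component[of 1 "2 * pi" i 0] smooth_trig_component[of 0 "2 * pi" i 1] q
    by (simp_all add: smooth_periodic_def torus_periodic_def)
qed

text \<open>Membership in the algebraic tensor product of the smooth periodic functions with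
  themselves. Lists make a sum of two such kernels a concatenation.\<close>

definition finite_rank :: "(real^3 \<Rightarrow> real^3 \<Rightarrow> real) \<Rightarrow> bool" where
  "finite_rank k \<longleftrightarrow> (\<exists>xs. (\<forall>(a, b)\<in>set xs. smooth_periodic a \<and> smooth_periodic b) \<and>
     (\<forall>x y. k x y = (\<Sum>(a, b)\<leftarrow>xs. a x * b y)))"

lemma finite_rank_prod:
  assumes "smooth_periodic a" "smooth_periodic b" shows "finite_rank (\<lambda>x y. a x * b y)"
  unfolding finite_rank_def using assms by (intro exI[of _ "[(a, b)]"]) auto

lemma finite_rank_const: "finite_rank (\<lambda>x y. c)"
  using finite_rank_prod[OF smooth_periodic_const[of c] smooth_periodic_const[of 1]] by simp

lemma finite_rank_add:
  assumes "finite_rank k" "finite_rank l" shows "finite_rank (\<lambda>x y. k x y + l x y)"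
proof -
  obtain xs ys where "\<forall>(a, b)\<in>set xs. smooth_periodic a \<and> smooth_periodic b" "\<forall>x y. k x y = (\<Sum>(a, b)\<leftarrow>xs. a x * b y)"
     "\<forall>(a, b)\<in>set ys. smooth_periodic a \<and> smooth_periodic b" "\<forall>x y. l x y = (\<Sum>(a, b)\<leftarrow>ys. a x * b y)"
    using assms unfolding finite_rank_def by blast
  then show ?thesis unfolding finite_rank_def by (intro exI[of _ "xs @ ys"]) auto
qed

lemma finite_rank_mult:
  assumes "finite_rank k" "finite_rank l" shows "finite_rank (\<lambda>x y. k x y * l x y)"
proof -
  obtain xs ys where xs: "\<forall>(a, b)\<in>set xs. smooth_periodic a \<and> smooth_periodic b" "\<forall>x y. k x y = (\<Sum>(a, b)\<leftarrow>xs. a x * b y)"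
    and ys: "\<forall>(a, b)\<in>set ys. smooth_periodic a \<and> smooth_periodic b" "\<forall>x y. l x y = (\<Sum>(a, b)\<leftarrow>ys. a x * b y)"
    using assms unfolding finite_rank_def by blast
  have "finite_rank (\<lambda>x y. (\<Sum>(a, b)\<leftarrow>xs. a x * b y) * (\<Sum>(a, b)\<leftarrow>ys. a x * b y))"
    using xs(1)
  proof (induction xs)
    case Nil
    then show ?case using finite_rank_const[of 0] by simp
  next
    case (Cons p xs)
    obtain a b where p: "p = (a, b)" by fastforce
    have "finite_rank (\<lambda>x y. a x * b y * (\<Sum>(a, b)\<leftarrow>ys. a x * b y))"
      using ys(1)
    proof (induction ys)
      case Nil
      then show ?case using finite_rank_const[of 0] by simp
    next
      case (Cons q ys)
      obtain c d where q: "q = (c, d)" by fastforce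
      have "finite_rank (\<lambda>x y. (a x * c x) * (b y * d y))"
        using Cons.prems \<open>\<forall>(a, b)\<in>set (p # xs). smooth_periodic a \<and> smooth_periodic b\<close>
        by (intro finite_rank_prod smooth_periodic_mult) (auto simp: p q)
      from finite_rank_add[OF this Cons.IH] Cons.prems show ?case
        by (simp add: q algebra_simps)
    qed
    from finite_rank_add[OF this Cons.IH] Cons.prems show ?case
      by (simp add: p algebra_simps)
  qed
  then show ?thesis by (simp add: xs(2) ys(2))
qed

lemma finite_rank_power: "finite_rank k \<Longrightarrow> finite_rank (\<lambda>x y. k x y ^ n)"
  by (induction n) (auto intro: finite_rank_const finite_rank_mult)

lemma finite_rank_big_prod: "(\<And>i. i \<in> I \<Longrightarrow> finite_rank (k i)) \<Longrightarrow> finite_rank (\<lambda>x y. \<Prod>i\<in>I. k i x y)"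
  by (induction I rule: infinite_finite_induct) (auto intro: finite_rank_const finite_rank_mult)

text \<open>The double angle formula turns cos^2 of a difference into 1/2 plus half a cosine of a
  difference, and the addition theorem separates the two variables. Powers and products preserve
  separation.\<close>

lemma ker_finite_rank_list: "finite_rank (\<lambda>x y. ker N (x - y))"
proof -
  have "finite_rank (\<lambda>x y. cker N ((x - y) $ i))" for i
  proof -
    have eq: "cker N ((x - y) $ i) = (1/2 + ((1/2 * cos (2 * pi * x $ i)) * cos (2 * pi * y $ i)
        + (1/2 * sin (2 * pi * x $ i)) * sin (2 * pi * y $ i))) ^ N * inverse (cker_mass N)" for x y :: "real^3"
    proof -
      have "(cos (pi * (x $ i - y $ i)))\<^sup>2 = 1/2 + 1/2 * cos (2 * (pi * (x $ i - y $ i)))"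
        unfolding cos_double_cos by (simp add: diff_divide_distrib)
      also have "2 * (pi * (x $ i - y $ i)) = 2 * pi * x $ i - 2 * pi * y $ i" by (simp add: algebra_simps)
      finally have "(cos (pi * (x $ i - y $ i)))\<^sup>2 = 1/2 + ((1/2 * cos (2 * pi * x $ i)) * cos (2 * pi * y $ i)
        + (1/2 * sin (2 * pi * x $ i)) * sin (2 * pi * y $ i))" by (simp add: cos_diff algebra_simps)
      then show ?thesis unfolding cker_def power_mult vector_minus_component divide_inverse by (simp only:)
    qed
    have "finite_rank (\<lambda>x y. (1/2 * cos (2 * pi * x $ i)) * cos (2 * pi * y $ i))"
      by (rule finite_rank_prod[OF smooth_periodic_mult[OF smooth_periodic_const smooth_periodic_trig(1)] smooth_periodic_trig(1)])
    moreover have "finite_rank (\<lambda>x y. (1/2 * sin (2 * pi * x $ i)) * sin (2 * pi * y $ i))"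
      by (rule finite_rank_prod[OF smooth_periodic_mult[OF smooth_periodic_const smooth_periodic_trig(2)] smooth_periodic_trig(2)])
    ultimately show ?thesis
      unfolding eq by (rule finite_rank_mult[OF finite_rank_power[OF finite_rank_add[OF finite_rank_const finite_rank_add]] finite_rank_const])
  qed
  then have "finite_rank (\<lambda>x y. \<Prod>i\<in>UNIV. (\<lambda>x y. cker N ((x - y) $ i)) x y)"
    by (rule finite_rank_big_prod)
  then show ?thesis by (simp only: ker_def)
qed

lemma ker_finite_rank:
  obtains n :: nat and a b where "\<And>k. k < n \<Longrightarrow> smooth_periodic (a k)" "\<And>k. k < n \<Longrightarrow> smooth_periodic (b k)"
    "\<And>x y. ker N (x - y) = (\<Sum>k<n. a k x * b k y)"
proof -
  obtain xs where xs: "\<forall>(a, b)\<in>set xs. smooth_periodic a \<and> smooth_periodic b" "\<forall>x y. ker N (x - y) = (\<Sum>(a, b)\<leftarrow>xs. a x * b y)"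
    using ker_finite_rank_list unfolding finite_rank_def by blast
  show thesis
  proof (rule that[of "length xs" "\<lambda>k. fst (xs ! k)" "\<lambda>k. snd (xs ! k)"])
    show "smooth_periodic (fst (xs ! k))" "smooth_periodic (snd (xs ! k))" if "k < length xs" for k
      using xs(1) nth_mem[OF that] by (auto simp: case_prod_beta)
    show "ker N (x - y) = (\<Sum>k<length xs. fst (xs ! k) x * snd (xs ! k) y)" for x y
      using xs(2) by (simp add: sum_list_sum_nth case_prod_beta atLeast0LessThan)
  qed
qed

locale ker_expansion =
  fixes N n :: nat and a b :: "nat \<Rightarrow> real^3 \<Rightarrow> real"
  assumes N: "N \<ge> 1" and a: "\<And>k. k < n \<Longrightarrow> smooth_periodic (a k)" and b: "\<And>k. k < n \<Longrightarrow> smooth_periodic (b k)"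
    and ker: "\<And>x y. ker N (x - y) = (\<Sum>k<n. a k x * b k y)"
begin

text \<open>The kernel and its expansion are the same function, so their derivatives agree.
  Differentiating in x hits the functions a; differentiating in y, as in \<open>gker_right\<close>,
  hits the functions b and produces a sign.\<close>

lemma gker_left: "gker N (x - y) = (\<Sum>k<n. b k y *\<^sub>R space_grad (a k) x)"
proof -
  have "((\<lambda>x. ker N (x - y)) has_derivative (\<lambda>h. gker N (x - y) \<bullet> h)) (at x)"
    by (rule has_derivative_compose[OF _ ker_has_derivative]) (auto intro!: derivative_eq_intros)
  moreover have "((\<lambda>x. \<Sum>k<n. a k x * b k y) has_derivative (\<lambda>h. \<Sum>k<n. (space_grad (a k) x \<bullet> h) * b k y)) (at x)"
    using a by (intro has_derivative_sum has_derivative_mult_left space_grad_has_derivative) (auto simp: smooth_periodic_def)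
  ultimately have "(\<lambda>h. gker N (x - y) \<bullet> h) = (\<lambda>h. \<Sum>k<n. (space_grad (a k) x \<bullet> h) * b k y)"
    unfolding ker by (rule has_derivative_unique)
  then have "gker N (x - y) \<bullet> h = (\<Sum>k<n. b k y *\<^sub>R space_grad (a k) x) \<bullet> h" for h
    by (simp only: fun_eq_iff inner_sum_left inner_scaleR_left mult.commute[of "b _ y"])
  then show ?thesis using vector_eq_rdot by blast
qed

lemma gker_right: "gker N (x - y) = - (\<Sum>k<n. a k x *\<^sub>R space_grad (b k) y)"
proof -
  have "((\<lambda>y. ker N (x - y)) has_derivative (\<lambda>h. gker N (x - y) \<bullet> (- h))) (at y)"
    by (rule has_derivative_compose[OF _ ker_has_derivative]) (auto intro!: derivative_eq_intros)
  moreover have "((\<lambda>y. \<Sum>k<n. a k x * b k y) has_derivative (\<lambda>h. \<Sum>k<n. a k x * (space_grad (b k) y \<bullet> h))) (at y)"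
    using b by (intro has_derivative_sum has_derivative_mult_right space_grad_has_derivative) (auto simp: smooth_periodic_def)
  ultimately have "(\<lambda>h. gker N (x - y) \<bullet> (- h)) = (\<lambda>h. \<Sum>k<n. a k x * (space_grad (b k) y \<bullet> h))"
    unfolding ker by (rule has_derivative_unique)
  then have "gker N (x - y) \<bullet> (- h) = (\<Sum>k<n. a k x *\<^sub>R space_grad (b k) y) \<bullet> h" for h
    by (simp only: fun_eq_iff inner_sum_left inner_scaleR_left)
  then have "(- gker N (x - y)) \<bullet> h = (\<Sum>k<n. a k x *\<^sub>R space_grad (b k) y) \<bullet> h" for h
    by (simp only: inner_minus_left inner_minus_right)
  then have "- gker N (x - y) = (\<Sum>k<n. a k x *\<^sub>R space_grad (b k) y)" using vector_eq_rdot by blast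
  then show ?thesis by (metis minus_minus)
qed

end

section \<open>Mean values of the kernel and of its gradient\<close>

abbreviation torus :: "(real^3) measure" where "torus \<equiv> lebesgue_on torus_cell"

lemma integrable_torus_continuous: "continuous_on UNIV f \<Longrightarrow> integrable torus (f :: _ \<Rightarrow> 'b::{banach, second_countable_topology})"
  unfolding torus_cell_def by (rule integrable_lebesgue_on_continuous)

lemma ker_integral:
  assumes "N \<ge> 1" shows "(LINT y|torus. ker N (x - y)) = 1"
proof -
  have c: "continuous_on UNIV (\<lambda>y. ker N (x - y))"
    by (intro continuous_on_compose2[OF ker_continuous[of UNIV]] continuous_intros) auto
  then have [measurable]: "(\<lambda>y. ker N (x - y)) \<in> borel_measurable borel" by (rule borel_measurable_continuous_onI)
  have "torus_periodic (\<lambda>y. ker N (y - x))"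
    using ker_periodic unfolding torus_periodic_def by (metis add_diff_eq diff_add_eq)
  then have per: "torus_periodic (\<lambda>y. ennreal (ker N (x - y)))"
    unfolding torus_periodic_def ker_even[of N x] by simp
  have "ennreal (LINT y|torus. ker N (x - y)) = (\<integral>\<^sup>+y. ennreal (ker N (x - y)) \<partial>torus)"
    using integrable_torus_continuous[OF c] by (intro nn_integral_eq_integral[symmetric]) (auto simp: ker_nonneg)
  also have "\<dots> = (\<integral>\<^sup>+l. ennreal (ker N (x - (x + l))) * indicator centered_cell l \<partial>lborel)"
    by (rule nn_integral_periodic_shift[OF _ per]) measurable
  also have "\<dots> = 1"
  proof -
    have "ker N (x - (x + l)) = ker N l" for l using ker_even[of N 0 l] by simp
    then show ?thesis using nn_integral_ker_cell[OF assms] by presburger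
  qed
  finally show ?thesis
    using ker_nonneg by (simp add: ennreal_eq_1)
qed

text \<open>The mean of the kernel is the constant 1 as a function of x. Through the finite
  expansion this is a finite sum in x, which can be differentiated termwise, with no derivative
  under an integral.\<close>

lemma gker_integral:
  assumes "N \<ge> 1" shows "(LINT y|torus. gker N (x - y)) = 0"
proof -
  obtain n a b where ex: "ker_expansion N n a b"
    using ker_finite_rank[of N] assms unfolding ker_expansion_def by metis
  interpret ker_expansion N n a b by (rule ex)
  have ib: "integrable torus (b k)" if "k < n" for k
    using b[OF that] by (intro integrable_torus_continuous smooth_continuous) (auto simp: smooth_periodic_def)
  have one: "(\<Sum>k<n. a k x * integral\<^sup>L torus (b k)) = 1" for x
    using ker_integral[OF assms, of x] ib by (simp add: ker Bochner_Integration.integral_sum)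
  have "((\<lambda>x. \<Sum>k<n. a k x * integral\<^sup>L torus (b k)) has_derivative (\<lambda>h. \<Sum>k<n. (space_grad (a k) x \<bullet> h) * integral\<^sup>L torus (b k))) (at x)"
    using a by (intro has_derivative_sum has_derivative_mult_left space_grad_has_derivative) (auto simp: smooth_periodic_def)
  then have "(\<lambda>h. \<Sum>k<n. (space_grad (a k) x \<bullet> h) * integral\<^sup>L torus (b k)) = (\<lambda>h. 0)"
    unfolding one by (rule has_derivative_unique) simp
  then have "(\<Sum>k<n. integral\<^sup>L torus (b k) *\<^sub>R space_grad (a k) x) \<bullet> h = 0 \<bullet> h" for h
    by (simp only: fun_eq_iff inner_sum_left inner_scaleR_left inner_zero_left mult.commute[of "integral\<^sup>L _ _"])
  then have "(\<Sum>k<n. integral\<^sup>L torus (b k) *\<^sub>R space_grad (a k) x) = 0" using vector_eq_rdot by blast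
  then show ?thesis
    unfolding gker_left using ib by (simp add: Bochner_Integration.integral_sum)
qed

subsection \<open>Trilinear identities at a fixed time\<close>

interpretation torus: finite_measure torus
  by (rule finite_measure_torus)

interpretation torus2: pair_sigma_finite torus torus ..

abbreviation torus2 :: "((real^3) \<times> (real^3)) measure" where "torus2 \<equiv> torus \<Otimes>\<^sub>M torus"

lemma id_measurable_torus [measurable]: "(\<lambda>x. x) \<in> borel_measurable torus"
  by (rule borel_measurable_torusI) simp

section \<open>Double integrals over pairs of points\<close>

lemma integrable_torus2_bound:
  fixes H :: "(real^3) \<times> (real^3) \<Rightarrow> 'b::{banach, second_countable_topology}"
  assumes f: "integrable torus f" and h: "integrable torus h" and H[measurable]: "H \<in> borel_measurable torus2"
    and le: "\<And>x y. x \<in> torus_cell \<Longrightarrow> y \<in> torus_cell \<Longrightarrow> norm (H (x, y)) \<le> C * (f x * h y :: real)"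
  shows "integrable torus2 H"
proof (rule Bochner_Integration.integrable_bound)
  have [measurable]: "f \<in> borel_measurable torus" "h \<in> borel_measurable torus" using f h by auto
  show "integrable torus2 (\<lambda>(x, y). C * (f x * h y))"
  proof (rule torus2.Fubini_integrable)
    have "integrable torus (\<lambda>x. (\<bar>C\<bar> * \<bar>f x\<bar>) * (LINT y|torus. \<bar>h y\<bar>))" using f by auto
    then show "integrable torus (\<lambda>x. LINT y|torus. norm (case (x, y) of (x, y) \<Rightarrow> C * (f x * h y)))"
      by (simp add: abs_mult mult.assoc)
    show "AE x in torus. integrable torus (\<lambda>y. case (x, y) of (x, y) \<Rightarrow> C * (f x * h y))"
      using h by simp
  qed measurable
  show "AE z in torus2. norm (H z) \<le> norm (case z of (x, y) \<Rightarrow> C * (f x * h y))"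
    using le by (intro AE_I2) (auto simp: space_pair_measure simp del: norm_mult intro: order_trans[OF _ abs_ge_self])
qed fact

lemma integral_torus2_swap:
  fixes f :: "(real^3) \<times> (real^3) \<Rightarrow> real"
  assumes "f \<in> borel_measurable torus2"
  shows "integral\<^sup>L torus2 (\<lambda>(x, y). f (y, x)) = integral\<^sup>L torus2 f"
  using torus2.integral_product_swap[OF assms] by simp

lemma integral_torus2_inner:
  fixes f h :: "real^3 \<Rightarrow> real^3"
  assumes f: "integrable torus f" and h: "integrable torus h"
  shows "integrable torus2 (\<lambda>(x, y). f x \<bullet> h y)"
    and "integral\<^sup>L torus2 (\<lambda>(x, y). f x \<bullet> h y) = integral\<^sup>L torus f \<bullet> integral\<^sup>L torus h"
proof -
  have [measurable]: "f \<in> borel_measurable torus" "h \<in> borel_measurable torus" using f h by auto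
  show i: "integrable torus2 (\<lambda>(x, y). f x \<bullet> h y)"
    by (rule integrable_torus2_bound[of "\<lambda>x. norm (f x)" "\<lambda>y. norm (h y)" _ 1])
       (use f h in \<open>auto simp: Cauchy_Schwarz_ineq2\<close>)
  have "integral\<^sup>L torus2 (\<lambda>(x, y). f x \<bullet> h y) = (LINT x|torus. LINT y|torus. f x \<bullet> h y)"
    using torus2.integral_fst'[OF i] by simp
  also have "\<dots> = (LINT x|torus. f x \<bullet> integral\<^sup>L torus h)" using h by simp
  also have "\<dots> = integral\<^sup>L torus f \<bullet> integral\<^sup>L torus h" using f by simp
  finally show "integral\<^sup>L torus2 (\<lambda>(x, y). f x \<bullet> h y) = integral\<^sup>L torus f \<bullet> integral\<^sup>L torus h" .
qed

lemma bounded_differences: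
  fixes g :: "real^3 \<Rightarrow> 'b::real_normed_vector"
  assumes "continuous_on UNIV g"
  obtains B where "0 \<le> B" "\<And>x y. x \<in> torus_cell \<Longrightarrow> y \<in> torus_cell \<Longrightarrow> norm (g (x - y)) \<le> B"
proof -
  have "compact (g ` cbox (- One) One)"
    by (intro compact_continuous_image continuous_on_subset[OF assms]) auto
  then obtain B where B: "\<And>l. l \<in> cbox (- One) One \<Longrightarrow> norm (g l) \<le> B"
    using compact_imp_bounded bounded_iff by (metis image_eqI)
  show thesis
  proof (rule that[of "max 0 B"])
    fix x y assume "x \<in> torus_cell" "y \<in> torus_cell"
    then have "x - y \<in> cbox (- One) One"
      by (auto simp: mem_torus_cell mem_box_cart) (smt (verit))+
    then show "norm (g (x - y)) \<le> max 0 B" using B by fastforce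
  qed simp
qed

lemma trilinear_bound:
  fixes a c d g :: "'a::real_inner"
  assumes "norm g \<le> B"
  shows "\<bar>(a \<bullet> g) * (c \<bullet> d)\<bar> \<le> B * (norm a * norm c * norm d)"
proof -
  have "\<bar>(a \<bullet> g) * (c \<bullet> d)\<bar> \<le> (norm a * norm g) * (norm c * norm d)"
    unfolding abs_mult by (intro mult_mono Cauchy_Schwarz_ineq2) auto
  also have "\<dots> \<le> (norm a * B) * (norm c * norm d)"
    using assms by (intro mult_right_mono mult_left_mono) auto
  finally show ?thesis by (simp add: mult_ac)
qed

text \<open>A single time slice, with the integrability that gives a meaning to each term when the
  trilinear forms are multiplied out. Evaluating all three fields at one point requires |v|^2
  |w|.\<close>

locale torus_fields =
  fixes v w :: "real^3 \<Rightarrow> real^3"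
  assumes v [measurable]: "v \<in> borel_measurable torus" and w [measurable]: "w \<in> borel_measurable torus"
    and v1: "integrable torus (\<lambda>x. norm (v x))"
    and v2: "integrable torus (\<lambda>x. norm (v x) * norm (v x))"
    and w1: "integrable torus (\<lambda>x. norm (w x))"
    and vw: "integrable torus (\<lambda>x. norm (v x) * norm (w x))"
    and v2w: "integrable torus (\<lambda>x. norm (v x) * norm (v x) * norm (w x))"
begin

lemma one_integrable: "integrable torus (\<lambda>x. 1::real)" by simp

definition increments :: "(real^3 \<Rightarrow> ennreal) \<Rightarrow> ennreal" where
  "increments \<kappa> = (\<integral>\<^sup>+(x, y). \<kappa> (x - y) * ennreal ((norm (v x - v y))\<^sup>2 * norm (w x - w y)) \<partial>torus2)"

end

text \<open>g stands for \<open>gker N\<close>. The assumptions \<open>div_v\<close> and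
  \<open>div_w\<close> are the weak divergence conditions at one time, tested with translates of the
  kernel.\<close>

locale torus_flux = torus_fields +
  fixes g :: "real^3 \<Rightarrow> real^3"
  assumes g_cont: "continuous_on UNIV g"
    and g_odd: "\<And>x y. g (x - y) = - g (y - x)"
    and g_int: "\<And>x. (LINT y|torus. g (x - y)) = 0"
    and div_v: "\<And>x. (LINT y|torus. v y \<bullet> g (x - y)) = 0"
    and div_w: "\<And>x. (LINT y|torus. w y \<bullet> g (x - y)) = 0"
begin

lemma g_borel [measurable]: "g \<in> borel_measurable borel"
  using g_cont by (rule borel_measurable_continuous_onI)

text \<open>Terms in which all fields sit at x vanish because g has mean zero in y. If they sit at
  y, exchanging the points costs only a sign.\<close>

lemma integral_against_g:
  fixes f :: "real^3 \<Rightarrow> real^3"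
  assumes f: "integrable torus (\<lambda>x. norm (f x))" and [measurable]: "f \<in> borel_measurable torus"
  shows "integrable torus2 (\<lambda>(x, y). f x \<bullet> g (x - y))" "integral\<^sup>L torus2 (\<lambda>(x, y). f x \<bullet> g (x - y)) = 0"
    "integrable torus2 (\<lambda>(x, y). f y \<bullet> g (x - y))" "integral\<^sup>L torus2 (\<lambda>(x, y). f y \<bullet> g (x - y)) = 0"
proof -
  obtain B where B: "0 \<le> B" "\<And>x y. x \<in> torus_cell \<Longrightarrow> y \<in> torus_cell \<Longrightarrow> norm (g (x - y)) \<le> B"
    using bounded_differences[OF g_cont] by metis
  have gy: "integrable torus (\<lambda>y. g (x - y))" for x
    by (intro integrable_torus_continuous continuous_on_compose2[OF g_cont] continuous_intros) auto
  have bd: "norm (f x \<bullet> g (s - t)) \<le> B * norm (f x)" if "s \<in> torus_cell" "t \<in> torus_cell" for s t x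
    using Cauchy_Schwarz_ineq2[of "f x" "g (s - t)"] mult_left_mono[OF B(2)[OF that], of "norm (f x)"] by (simp add: mult.commute)
  show i1: "integrable torus2 (\<lambda>(x, y). f x \<bullet> g (x - y))"
    by (rule integrable_torus2_bound[OF f one_integrable, of _ B]) (use bd in auto)
  show i2: "integrable torus2 (\<lambda>(x, y). f y \<bullet> g (x - y))"
    by (rule integrable_torus2_bound[OF one_integrable f, of _ B]) (use bd in auto)
  have "integral\<^sup>L torus2 (\<lambda>(x, y). f x \<bullet> g (x - y)) = (LINT x|torus. LINT y|torus. f x \<bullet> g (x - y))"
    using torus2.integral_fst'[OF i1] by simp
  then show z: "integral\<^sup>L torus2 (\<lambda>(x, y). f x \<bullet> g (x - y)) = 0" using gy g_int by simp
  have "integral\<^sup>L torus2 (\<lambda>(x, y). f y \<bullet> g (x - y)) = integral\<^sup>L torus2 (\<lambda>z. - (case z of (x, y) \<Rightarrow> f y \<bullet> g (y - x)))"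
  proof (rule Bochner_Integration.integral_cong[OF refl], clarify)
    show "f y \<bullet> g (x - y) = - (f y \<bullet> g (y - x))" for x y unfolding g_odd[of x y] by simp
  qed
  also have "\<dots> = - integral\<^sup>L torus2 (\<lambda>(x, y). (\<lambda>(x, y). f x \<bullet> g (x - y)) (y, x))" by simp
  also have "\<dots> = - integral\<^sup>L torus2 (\<lambda>(x, y). f x \<bullet> g (x - y))" using i1 by (subst integral_torus2_swap) auto
  finally show "integral\<^sup>L torus2 (\<lambda>(x, y). f y \<bullet> g (x - y)) = 0" using z by simp
qed

text \<open>Terms in which one field meets g at one point and everything else sits at the other
  vanish by the divergence condition. With s the pressure, this is also how the pressure
  disappears.\<close>

lemma integral_against_div:
  fixes s :: "real^3 \<Rightarrow> real" and u :: "real^3 \<Rightarrow> real^3"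
  assumes s: "integrable torus s" and u: "integrable torus (\<lambda>x. norm (u x))" and [measurable]: "u \<in> borel_measurable torus"
    and div: "\<And>x. (LINT y|torus. u y \<bullet> g (x - y)) = 0"
  shows "integrable torus2 (\<lambda>(x, y). s x * (u y \<bullet> g (x - y)))" "integral\<^sup>L torus2 (\<lambda>(x, y). s x * (u y \<bullet> g (x - y))) = 0"
    "integrable torus2 (\<lambda>(x, y). s y * (u x \<bullet> g (x - y)))" "integral\<^sup>L torus2 (\<lambda>(x, y). s y * (u x \<bullet> g (x - y))) = 0"
proof -
  have [measurable]: "s \<in> borel_measurable torus" using s by auto
  obtain B where B: "0 \<le> B" "\<And>x y. x \<in> torus_cell \<Longrightarrow> y \<in> torus_cell \<Longrightarrow> norm (g (x - y)) \<le> B"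
    using bounded_differences[OF g_cont] by metis
  have s': "integrable torus (\<lambda>x. \<bar>s x\<bar>)" using s by simp
  have bd: "norm (s x * (u y \<bullet> g (p - q))) \<le> B * (\<bar>s x\<bar> * norm (u y))" if "p \<in> torus_cell" "q \<in> torus_cell" for p q x y
  proof -
    have "\<bar>u y \<bullet> g (p - q)\<bar> \<le> norm (u y) * B"
      using Cauchy_Schwarz_ineq2[of "u y" "g (p - q)"] mult_left_mono[OF B(2)[OF that], of "norm (u y)"] by simp
    from mult_left_mono[OF this, of "\<bar>s x\<bar>"] show ?thesis by (simp add: abs_mult mult_ac)
  qed
  show i1: "integrable torus2 (\<lambda>(x, y). s x * (u y \<bullet> g (x - y)))"
    by (rule integrable_torus2_bound[OF s' u, of _ B]) (use bd in auto)
  show i2: "integrable torus2 (\<lambda>(x, y). s y * (u x \<bullet> g (x - y)))"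
    by (rule integrable_torus2_bound[OF u s', of _ B]) (use bd in \<open>auto simp: mult.commute[of "norm _"]\<close>)
  have "integral\<^sup>L torus2 (\<lambda>(x, y). s x * (u y \<bullet> g (x - y))) = (LINT x|torus. LINT y|torus. s x * (u y \<bullet> g (x - y)))"
    using torus2.integral_fst'[OF i1] by simp
  then show z: "integral\<^sup>L torus2 (\<lambda>(x, y). s x * (u y \<bullet> g (x - y))) = 0" using div by simp
  have "integral\<^sup>L torus2 (\<lambda>(x, y). s y * (u x \<bullet> g (x - y))) = integral\<^sup>L torus2 (\<lambda>z. - (case z of (x, y) \<Rightarrow> s y * (u x \<bullet> g (y - x))))"
  proof (rule Bochner_Integration.integral_cong[OF refl], clarify)
    show "s y * (u x \<bullet> g (x - y)) = - (s y * (u x \<bullet> g (y - x)))" for x y unfolding g_odd[of x y] by simp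
  qed
  also have "\<dots> = - integral\<^sup>L torus2 (\<lambda>(x, y). (\<lambda>(x, y). s x * (u y \<bullet> g (x - y))) (y, x))" by simp
  also have "\<dots> = - integral\<^sup>L torus2 (\<lambda>(x, y). s x * (u y \<bullet> g (x - y)))" using i1 by (subst integral_torus2_swap) auto
  finally show "integral\<^sup>L torus2 (\<lambda>(x, y). s y * (u x \<bullet> g (x - y))) = 0" using z by simp
qed

text \<open>The time derivative of the mollified helicity without its pressure part: the first
  product stems from transport in the momentum equation, the second and third from transport and
  stretching in the vorticity equation. Their signs reflect that the latter is tested in y.\<close>

definition "flux = integral\<^sup>L torus2 (\<lambda>(x, y). (v x \<bullet> g (x - y)) * (v x \<bullet> w y)
    - (v y \<bullet> g (x - y)) * (v x \<bullet> w y) + (w y \<bullet> g (x - y)) * (v x \<bullet> v y))"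

lemma flux_integrable:
  "integrable torus2 (\<lambda>(x, y). (v x \<bullet> g (x - y)) * (v x \<bullet> w y))" (is ?t1)
  "integrable torus2 (\<lambda>(x, y). (v y \<bullet> g (x - y)) * (v x \<bullet> w y))" (is ?t2)
  "integrable torus2 (\<lambda>(x, y). (w y \<bullet> g (x - y)) * (v x \<bullet> v y))" (is ?t3)
proof -
  obtain B where B: "\<And>x y. x \<in> torus_cell \<Longrightarrow> y \<in> torus_cell \<Longrightarrow> norm (g (x - y)) \<le> B"
    using bounded_differences[OF g_cont] by metis
  show ?t1
  proof (rule integrable_torus2_bound[OF v2 w1, of _ B])
    fix x y assume "x \<in> torus_cell" "y \<in> torus_cell"
    from trilinear_bound[OF B[OF this], of "v x" "v x" "w y"]
    show "norm (case (x, y) of (x, y) \<Rightarrow> (v x \<bullet> g (x - y)) * (v x \<bullet> w y)) \<le> B * (norm (v x) * norm (v x) * norm (w y))"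
      by simp
  qed measurable
  show ?t2
  proof (rule integrable_torus2_bound[OF v1 vw, of _ B])
    fix x y assume "x \<in> torus_cell" "y \<in> torus_cell"
    from trilinear_bound[OF B[OF this], of "v y" "v x" "w y"]
    show "norm (case (x, y) of (x, y) \<Rightarrow> (v y \<bullet> g (x - y)) * (v x \<bullet> w y)) \<le> B * (norm (v x) * (norm (v y) * norm (w y)))"
      by (simp add: mult.left_commute mult.assoc)
  qed measurable
  show ?t3
  proof (rule integrable_torus2_bound[OF v1 vw, of _ B])
    fix x y assume "x \<in> torus_cell" "y \<in> torus_cell"
    from trilinear_bound[OF B[OF this], of "w y" "v x" "v y"]
    show "norm (case (x, y) of (x, y) \<Rightarrow> (w y \<bullet> g (x - y)) * (v x \<bullet> v y)) \<le> B * (norm (v x) * (norm (v y) * norm (w y)))"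
      by (simp add: mult.left_commute mult.commute mult.assoc)
  qed measurable
qed

text \<open>
  The antisymmetry of \<open>g\<close> under exchange of \<open>x\<close> and \<open>y\<close> and the two divergence conditions turn the
  flux into an expression in increments only.
\<close>

lemma flux_bound: "ennreal \<bar>flux\<bar> \<le> increments (\<lambda>l. ennreal (norm (g l)))"
proof -
  obtain B where B: "\<And>x y. x \<in> torus_cell \<Longrightarrow> y \<in> torus_cell \<Longrightarrow> norm (g (x - y)) \<le> B"
    using bounded_differences[OF g_cont] by metis
  let ?I = "integral\<^sup>L torus2"
  define T1 where "T1 = (\<lambda>(x, y). (v x \<bullet> g (x - y)) * (v x \<bullet> w y))"
  define T2 where "T2 = (\<lambda>(x, y). (v y \<bullet> g (x - y)) * (v x \<bullet> w y))"
  define T3 where "T3 = (\<lambda>(x, y). (w y \<bullet> g (x - y)) * (v x \<bullet> v y))"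
  \<comment> \<open>Primed functions arise by exchanging the points in the fields while keeping g (x
    - y). As g is odd, their integrals are the negatives of the unprimed ones.\<close>
  define T1' where "T1' = (\<lambda>(x, y). (v y \<bullet> g (x - y)) * (v y \<bullet> w x))"
  define T2' where "T2' = (\<lambda>(x, y). (v x \<bullet> g (x - y)) * (v y \<bullet> w x))"
  define T3' where "T3' = (\<lambda>(x, y). (w x \<bullet> g (x - y)) * (v y \<bullet> v x))"
  note iT = flux_integrable[folded T1_def T2_def T3_def]
  have swap: "integrable torus2 f' \<and> ?I f' = - ?I f"
    if f: "integrable torus2 f" and f': "\<And>x y. f' (x, y) = - f (y, x)" for f f' :: "(real^3) \<times> (real^3) \<Rightarrow> real"
  proof -
    have eq: "f' = (\<lambda>z. - (case z of (x, y) \<Rightarrow> f (y, x)))" using f' by auto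
    have "integrable torus2 (\<lambda>(x, y). f (y, x))" using torus2.integrable_product_swap[OF f] .
    moreover have "?I (\<lambda>(x, y). f (y, x)) = ?I f" using f by (intro integral_torus2_swap) auto
    ultimately show ?thesis unfolding eq by (simp only: Bochner_Integration.integral_minus Bochner_Integration.integrable_minus)
  qed
  have "T1' (x, y) = - T1 (y, x)" for x y
    unfolding T1_def T1'_def prod.case g_odd[of x y] by simp
  then have s1: "integrable torus2 T1'" "?I T1' = - ?I T1" using swap[OF iT(1), of T1'] by blast+
  have "T2' (x, y) = - T2 (y, x)" for x y
    unfolding T2_def T2'_def prod.case g_odd[of x y] by simp
  then have s2: "integrable torus2 T2'" "?I T2' = - ?I T2" using swap[OF iT(2), of T2'] by blast+
  have "T3' (x, y) = - T3 (y, x)" for x y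
    unfolding T3_def T3'_def prod.case g_odd[of x y] by simp
  then have s3: "integrable torus2 T3'" "?I T3' = - ?I T3" using swap[OF iT(3), of T3'] by blast+
  have f1: "integrable torus (\<lambda>x. norm ((v x \<bullet> w x) *\<^sub>R v x))"
    by (rule Bochner_Integration.integrable_bound[OF v2w])
       (auto simp: abs_mult mult_ac intro!: AE_I2 mult_left_mono Cauchy_Schwarz_ineq2)
  have f2: "integrable torus (\<lambda>x. norm ((v x \<bullet> v x) *\<^sub>R w x))"
    by (rule Bochner_Integration.integrable_bound[OF v2w]) (auto simp: abs_mult dot_square_norm power2_eq_square)
  have sv: "integrable torus (\<lambda>x. v x \<bullet> w x)"
    by (rule Bochner_Integration.integrable_bound[OF vw]) (auto intro!: AE_I2 Cauchy_Schwarz_ineq2)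
  have svv: "integrable torus (\<lambda>x. v x \<bullet> v x)"
    by (rule Bochner_Integration.integrable_bound[OF v2]) (auto simp: norm_eq_sqrt_inner)
  have [measurable]: "(\<lambda>x. (v x \<bullet> w x) *\<^sub>R v x) \<in> borel_measurable torus" "(\<lambda>x. (v x \<bullet> v x) *\<^sub>R w x) \<in> borel_measurable torus"
    by measurable
  \<comment> \<open>The F terms have all fields at one point, the A terms separate off a divergence;
    every one of them integrates to zero.\<close>
  define F1 where "F1 = (\<lambda>(x, y). ((v x \<bullet> w x) *\<^sub>R v x) \<bullet> g (x - y))"
  define F2 where "F2 = (\<lambda>(x, y). ((v y \<bullet> w y) *\<^sub>R v y) \<bullet> g (x - y))"
  define F3 where "F3 = (\<lambda>(x, y). ((v x \<bullet> v x) *\<^sub>R w x) \<bullet> g (x - y))"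
  define F4 where "F4 = (\<lambda>(x, y). ((v y \<bullet> v y) *\<^sub>R w y) \<bullet> g (x - y))"
  define A1 where "A1 = (\<lambda>(x, y). (v x \<bullet> w x) * (v y \<bullet> g (x - y)))"
  define A2 where "A2 = (\<lambda>(x, y). (v y \<bullet> w y) * (v x \<bullet> g (x - y)))"
  define A3 where "A3 = (\<lambda>(x, y). (v x \<bullet> v x) * (w y \<bullet> g (x - y)))"
  define A4 where "A4 = (\<lambda>(x, y). (v y \<bullet> v y) * (w x \<bullet> g (x - y)))"
  note F = integral_against_g[OF f1, folded F1_def F2_def] integral_against_g[OF f2, folded F3_def F4_def]
  note A = integral_against_div[OF sv v1 v div_v, folded A1_def A2_def] integral_against_div[OF svv w1 w div_w, folded A3_def A4_def]
  \<comment> \<open>Multiplied out, (\<delta>v . g)(\<delta>v . \<delta>w) retains, after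
    integration, - 2 T1 + 2 T2, each term being joined by its mirror image. Likewise |\<delta>v|^2
    (\<delta>w . g) retains 4 T3, the mixed product v x . v y occurring twice. Hence the weights
    -1/2 and 1/4.\<close>
  define R where "R = (\<lambda>(x, y). - (1/2) * (((v x - v y) \<bullet> g (x - y)) * ((v x - v y) \<bullet> (w x - w y)))
      + (1/4) * (((v x - v y) \<bullet> (v x - v y)) * ((w x - w y) \<bullet> g (x - y))))"
  define P where "P z = - (1/2) * (F1 z - T1 z - T2' z + A2 z - A1 z + T2 z + T1' z - F2 z)
     + (1/4) * (F3 z - A3 z - 2 * T3' z + 2 * T3 z + A4 z - F4 z)" for z
  have RP: "R = P"
  proof (rule ext, clarify)
    fix x y
    show "R (x, y) = P (x, y)"
      unfolding R_def P_def T1_def T2_def T3_def T1'_def T2'_def T3'_def F1_def F2_def F3_def F4_def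
        A1_def A2_def A3_def A4_def prod.case inner_diff_left inner_diff_right
        inner_scaleR_left inner_commute[of "v y" "v x"]
      by (simp add: algebra_simps add_divide_distrib diff_divide_distrib)
  qed
  have iP: "integrable torus2 P"
    unfolding P_def using F A iT s1 s2 s3 by simp
  have "?I P = ?I T1 - ?I T2 + ?I T3"
    unfolding P_def using F A iT s1 s2 s3 by (simp add: diff_divide_distrib)
  also have "\<dots> = flux"
  proof -
    have "flux = ?I (\<lambda>z. T1 z - T2 z + T3 z)"
      unfolding flux_def by (rule Bochner_Integration.integral_cong) (auto simp: T1_def T2_def T3_def)
    then show ?thesis using iT by simp
  qed
  finally have "ennreal \<bar>flux\<bar> \<le> (\<integral>\<^sup>+z. ennreal \<bar>R z\<bar> \<partial>torus2)"
    using integral_norm_bound_ennreal[OF iP] by (simp add: RP)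
  also have "\<dots> \<le> increments (\<lambda>l. ennreal (norm (g l)))"
    unfolding increments_def
  proof (rule nn_integral_mono, safe)
    fix x y :: "real^3"
    let ?dv = "v x - v y" and ?dw = "w x - w y" and ?g = "g (x - y)"
    have "\<bar>(?dv \<bullet> ?g) * (?dv \<bullet> ?dw)\<bar> \<le> norm ?g * (norm ?dv * norm ?dv * norm ?dw)"
      by (rule trilinear_bound) simp
    moreover have "\<bar>(?dw \<bullet> ?g) * (?dv \<bullet> ?dv)\<bar> \<le> norm ?g * (norm ?dw * norm ?dv * norm ?dv)"
      by (rule trilinear_bound) simp
    ultimately have "\<bar>R (x, y)\<bar> \<le> norm ?g * ((norm ?dv)\<^sup>2 * norm ?dw)"
      unfolding R_def by (simp add: power2_eq_square mult_ac)
    then show "ennreal \<bar>R (x, y)\<bar> \<le> ennreal (norm ?g) * ennreal ((norm ?dv)\<^sup>2 * norm ?dw)"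
      by (simp add: ennreal_mult[symmetric] ennreal_leI)
  qed
  finally show ?thesis .
qed

end

context torus_fields begin

text \<open>As the kernel is symmetric with mass 1, the error equals half the double integral of
  \<kappa> times \<delta>v . \<delta>w. Young's inequality trades this bilinear expression for the
  cubic one that already controls the flux, at the expense of \<eta> times the L1 norm of w.\<close>

lemma helicity_approximation:
  fixes \<kappa> :: "real^3 \<Rightarrow> real"
  assumes c: "continuous_on UNIV \<kappa>" and nonneg: "\<And>l. 0 \<le> \<kappa> l" and even: "\<And>x y. \<kappa> (x - y) = \<kappa> (y - x)"
    and one: "\<And>x. (LINT y|torus. \<kappa> (x - y)) = 1" and \<eta>: "0 < \<eta>"
  shows "integrable torus2 (\<lambda>(x, y). \<kappa> (x - y) * (v x \<bullet> w y))"
    and "ennreal \<bar>(LINT x|torus. v x \<bullet> w x) - integral\<^sup>L torus2 (\<lambda>(x, y). \<kappa> (x - y) * (v x \<bullet> w y))\<bar>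
    \<le> ennreal (\<eta> * (LINT x|torus. norm (w x))) + ennreal (1 / \<eta>) * increments (\<lambda>l. ennreal (\<kappa> l))"
proof -
  have [measurable]: "\<kappa> \<in> borel_measurable borel" using c by (rule borel_measurable_continuous_onI)
  obtain B where B0: "0 \<le> B" and B: "\<And>x y. x \<in> torus_cell \<Longrightarrow> y \<in> torus_cell \<Longrightarrow> norm (\<kappa> (x - y)) \<le> B"
    using bounded_differences[OF c] by metis
  let ?I = "integral\<^sup>L torus2"
  have bd: "norm (\<kappa> (x - y) * (a \<bullet> b)) \<le> B * (norm a * norm b)" if "x \<in> torus_cell" "y \<in> torus_cell" for x y and a b :: "real^3"
    using B[OF that] B0 unfolding real_norm_def abs_mult by (intro mult_mono Cauchy_Schwarz_ineq2) auto
  define H where "H = (\<lambda>(x, y). \<kappa> (x - y) * (v x \<bullet> w y))"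
  define H' where "H' = (\<lambda>(x, y). \<kappa> (x - y) * (v y \<bullet> w x))"
  define D where "D = (\<lambda>(x, y). \<kappa> (x - y) * (v x \<bullet> w x))"
  define D' where "D' = (\<lambda>(x, y). \<kappa> (x - y) * (v y \<bullet> w y))"
  have iH: "integrable torus2 H"
    unfolding H_def by (rule integrable_torus2_bound[OF v1 w1, of _ B]) (use bd in auto)
  then show "integrable torus2 (\<lambda>(x, y). \<kappa> (x - y) * (v x \<bullet> w y))" by (simp add: H_def)
  have iD: "integrable torus2 D"
    unfolding D_def by (rule integrable_torus2_bound[OF vw one_integrable, of _ B]) (use bd in auto)
  have swap: "integrable torus2 f' \<and> ?I f' = ?I f"
    if f: "integrable torus2 f" and f': "\<And>x y. f' (x, y) = f (y, x)" for f f' :: "(real^3) \<times> (real^3) \<Rightarrow> real"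
  proof -
    have eq: "f' = (\<lambda>(x, y). f (y, x))" using f' by auto
    show ?thesis unfolding eq using torus2.integrable_product_swap[OF f] f by (auto intro!: integral_torus2_swap)
  qed
  have sH: "integrable torus2 H'" "?I H' = ?I H" using swap[OF iH, of H'] even unfolding H_def H'_def prod.case by metis+
  have sD: "integrable torus2 D'" "?I D' = ?I D" using swap[OF iD, of D'] even unfolding D_def D'_def prod.case by metis+
  have kint: "integrable torus (\<lambda>y. \<kappa> (x - y))" for x
    by (intro integrable_torus_continuous continuous_on_compose2[OF c] continuous_intros) auto
  have "?I D = (LINT x|torus. LINT y|torus. \<kappa> (x - y) * (v x \<bullet> w x))"
    using torus2.integral_fst'[OF iD] by (simp add: D_def)
  then have ID: "?I D = (LINT x|torus. v x \<bullet> w x)" using kint one by simp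
  \<comment> \<open>Multiplied out, two of the four products have both fields at the same point and
    integrate to the helicity; the other two integrate to its mollification.\<close>
  define R where "R = (\<lambda>(x, y). (1/2) * (\<kappa> (x - y) * ((v x - v y) \<bullet> (w x - w y))))"
  have Req: "R = (\<lambda>z. (1/2) * (D z - H z - H' z + D' z))"
    by (auto simp: R_def D_def H_def H'_def D'_def fun_eq_iff inner_diff_left inner_diff_right algebra_simps
        add_divide_distrib diff_divide_distrib)
  have iR: "integrable torus2 R" unfolding Req using iH iD sH sD by simp
  have IR: "?I R = ?I D - ?I H" unfolding Req using iH iD sH sD by simp
  have k1: "(\<integral>\<^sup>+(x, y). ennreal (\<kappa> (x - y)) * ennreal (norm (w x)) \<partial>torus2) = ennreal (LINT x|torus. norm (w x))"
  proof -
    have "(\<integral>\<^sup>+y. ennreal (\<kappa> (x - y)) \<partial>torus) = 1" for x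
      using nn_integral_eq_integral[OF kint, of x] nonneg one by simp
    then have "(\<integral>\<^sup>+x. \<integral>\<^sup>+y. ennreal (\<kappa> (x - y)) * ennreal (norm (w x)) \<partial>torus \<partial>torus) = (\<integral>\<^sup>+x. ennreal (norm (w x)) \<partial>torus)"
      by (subst nn_integral_multc) auto
    also have "\<dots> = ennreal (LINT x|torus. norm (w x))"
      using w1 by (intro nn_integral_eq_integral) auto
    finally show ?thesis by (subst torus.nn_integral_fst[symmetric]) (auto simp: case_prod_beta)
  qed
  have k2: "(\<integral>\<^sup>+(x, y). ennreal (\<kappa> (x - y)) * ennreal (norm (w y)) \<partial>torus2) = ennreal (LINT x|torus. norm (w x))"
  proof -
    have "(\<integral>\<^sup>+(x, y). ennreal (\<kappa> (x - y)) * ennreal (norm (w y)) \<partial>torus2) = (\<integral>\<^sup>+y. \<integral>\<^sup>+x. ennreal (\<kappa> (x - y)) * ennreal (norm (w y)) \<partial>torus \<partial>torus)"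
      by (subst torus2.nn_integral_snd[symmetric]) (auto simp: case_prod_beta)
    also have "\<dots> = (\<integral>\<^sup>+x. \<integral>\<^sup>+y. ennreal (\<kappa> (x - y)) * ennreal (norm (w x)) \<partial>torus \<partial>torus)"
      by (intro nn_integral_cong arg_cong2[where f = "(*)"] arg_cong[where f = ennreal] even refl)
    also have "\<dots> = (\<integral>\<^sup>+(x, y). ennreal (\<kappa> (x - y)) * ennreal (norm (w x)) \<partial>torus2)"
      by (subst torus.nn_integral_fst[symmetric]) (auto simp: case_prod_beta)
    finally show ?thesis using k1 by simp
  qed
  have "ennreal \<bar>?I R\<bar> \<le> (\<integral>\<^sup>+z. ennreal \<bar>R z\<bar> \<partial>torus2)"
    using integral_norm_bound_ennreal[OF iR] by simp
  also have "\<dots> \<le> (\<integral>\<^sup>+z. ennreal (\<eta> / 2) * (case z of (x, y) \<Rightarrow> ennreal (\<kappa> (x - y)) * ennreal (norm (w x)))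
      + (ennreal (\<eta> / 2) * (case z of (x, y) \<Rightarrow> ennreal (\<kappa> (x - y)) * ennreal (norm (w y)))
      + ennreal (1 / \<eta>) * (case z of (x, y) \<Rightarrow> ennreal (\<kappa> (x - y)) * ennreal ((norm (v x - v y))\<^sup>2 * norm (w x - w y)))) \<partial>torus2)"
  proof (rule nn_integral_mono, safe)
    fix x y :: "real^3"
    define p q where "p = norm (v x - v y)" and "q = norm (w x - w y)"
    have pq: "0 \<le> p" "0 \<le> q" by (auto simp: p_def q_def)
    have "0 \<le> (p - \<eta>)\<^sup>2 + p\<^sup>2" by simp
    then have "\<eta> * (2 * p) \<le> \<eta>\<^sup>2 + 2 * p\<^sup>2" by (simp add: power2_eq_square algebra_simps)
    then have "p / 2 \<le> \<eta> / 4 + 1 / (2 * \<eta>) * p\<^sup>2" using \<eta> by (simp add: field_simps power2_eq_square)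
    moreover have "1 / (2 * \<eta>) * p\<^sup>2 \<le> 1 / \<eta> * p\<^sup>2" using \<eta> by (simp add: field_simps)
    ultimately have p: "p / 2 \<le> \<eta> / 2 + 1 / \<eta> * p\<^sup>2" using \<eta> by linarith
    have q: "q \<le> norm (w x) + norm (w y)" unfolding q_def by (rule norm_triangle_ineq4)
    have "\<bar>(v x - v y) \<bullet> (w x - w y)\<bar> / 2 \<le> p / 2 * q"
      using Cauchy_Schwarz_ineq2[of "v x - v y" "w x - w y"] by (simp add: p_def q_def)
    also have "\<dots> \<le> (\<eta> / 2 + 1 / \<eta> * p\<^sup>2) * q" using p pq by (intro mult_right_mono) auto
    also have "\<dots> = \<eta> / 2 * q + 1 / \<eta> * (p\<^sup>2 * q)" by (simp add: algebra_simps)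
    also have "\<dots> \<le> \<eta> / 2 * (norm (w x) + norm (w y)) + 1 / \<eta> * (p\<^sup>2 * q)"
      using q \<eta> by (intro add_right_mono mult_left_mono) auto
    finally have "\<bar>(v x - v y) \<bullet> (w x - w y)\<bar> / 2 \<le> \<eta> / 2 * (norm (w x) + norm (w y)) + 1 / \<eta> * (p\<^sup>2 * q)" .
    from mult_left_mono[OF this nonneg[of "x - y"]]
    have *: "\<kappa> (x - y) * (\<bar>(v x - v y) \<bullet> (w x - w y)\<bar> / 2)
        \<le> \<kappa> (x - y) * (\<eta> / 2 * (norm (w x) + norm (w y)) + 1 / \<eta> * (p\<^sup>2 * q))" .
    have "\<bar>R (x, y)\<bar> = \<kappa> (x - y) * (\<bar>(v x - v y) \<bullet> (w x - w y)\<bar> / 2)"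
      unfolding R_def prod.case abs_mult using nonneg[of "x - y"] by simp
    also note *
    also have "\<kappa> (x - y) * (\<eta> / 2 * (norm (w x) + norm (w y)) + 1 / \<eta> * (p\<^sup>2 * q))
       = \<eta> / 2 * (\<kappa> (x - y) * norm (w x)) + (\<eta> / 2 * (\<kappa> (x - y) * norm (w y)) + 1 / \<eta> * (\<kappa> (x - y) * (p\<^sup>2 * q)))"
      by (simp only: distrib_left mult.left_commute add.assoc)
    finally have "\<bar>R (x, y)\<bar> \<le> \<eta> / 2 * (\<kappa> (x - y) * norm (w x)) + (\<eta> / 2 * (\<kappa> (x - y) * norm (w y)) + 1 / \<eta> * (\<kappa> (x - y) * (p\<^sup>2 * q)))" .
    then have "ennreal \<bar>R (x, y)\<bar> \<le> ennreal (\<eta> / 2 * (\<kappa> (x - y) * norm (w x)) + (\<eta> / 2 * (\<kappa> (x - y) * norm (w y)) + 1 / \<eta> * (\<kappa> (x - y) * (p\<^sup>2 * q))))"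
      by (rule ennreal_leI)
    also have "\<dots> = ennreal (\<eta> / 2) * (ennreal (\<kappa> (x - y)) * ennreal (norm (w x)))
      + (ennreal (\<eta> / 2) * (ennreal (\<kappa> (x - y)) * ennreal (norm (w y))) + ennreal (1 / \<eta>) * (ennreal (\<kappa> (x - y)) * ennreal (p\<^sup>2 * q)))"
    proof -
      have e: "ennreal (a * (\<kappa> (x - y) * b)) = ennreal a * (ennreal (\<kappa> (x - y)) * ennreal b)"
        "0 \<le> a * (\<kappa> (x - y) * b)" if "0 \<le> a" "0 \<le> b" for a b
        using that nonneg[of "x - y"] by (simp_all only: ennreal_mult' mult_nonneg_nonneg)
      have n: "0 \<le> \<eta> / 2" "0 \<le> 1 / \<eta>" "0 \<le> p\<^sup>2 * q" using \<eta> pq by auto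
      show ?thesis
        using e[OF n(1) norm_ge_zero[of "w x"]] e[OF n(1) norm_ge_zero[of "w y"]] e[OF n(2) n(3)]
        by (simp only: ennreal_plus add_nonneg_nonneg)
    qed
    finally show "ennreal \<bar>R (x, y)\<bar> \<le> ennreal (\<eta> / 2) * (ennreal (\<kappa> (x - y)) * ennreal (norm (w x)))
      + (ennreal (\<eta> / 2) * (ennreal (\<kappa> (x - y)) * ennreal (norm (w y))) + ennreal (1 / \<eta>) * (ennreal (\<kappa> (x - y)) * ennreal ((norm (v x - v y))\<^sup>2 * norm (w x - w y))))"
      by (simp add: p_def q_def)
  qed
  also have "\<dots> = ennreal (\<eta> / 2) * ennreal (LINT x|torus. norm (w x)) + (ennreal (\<eta> / 2) * ennreal (LINT x|torus. norm (w x))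
      + ennreal (1 / \<eta>) * increments (\<lambda>l. ennreal (\<kappa> l)))"
  proof -
    define a1 where "a1 = (\<lambda>(x, y). ennreal (\<kappa> (x - y)) * ennreal (norm (w x)))"
    define a2 where "a2 = (\<lambda>(x, y). ennreal (\<kappa> (x - y)) * ennreal (norm (w y)))"
    define a3 where "a3 = (\<lambda>(x, y). ennreal (\<kappa> (x - y)) * ennreal ((norm (v x - v y))\<^sup>2 * norm (w x - w y)))"
    have [measurable]: "a1 \<in> borel_measurable torus2" "a2 \<in> borel_measurable torus2" "a3 \<in> borel_measurable torus2"
      unfolding a1_def a2_def a3_def by measurable
    have "(\<integral>\<^sup>+z. ennreal (\<eta> / 2) * a1 z + (ennreal (\<eta> / 2) * a2 z + ennreal (1 / \<eta>) * a3 z) \<partial>torus2)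
        = ennreal (\<eta> / 2) * integral\<^sup>N torus2 a1 + (ennreal (\<eta> / 2) * integral\<^sup>N torus2 a2 + ennreal (1 / \<eta>) * integral\<^sup>N torus2 a3)"
      by (simp add: nn_integral_add nn_integral_cmult)
    then show ?thesis
      unfolding increments_def k1[folded a1_def] k2[folded a2_def] a3_def[symmetric] unfolding a1_def a2_def a3_def .
  qed
  also have "\<dots> = ennreal (\<eta> * (LINT x|torus. norm (w x))) + ennreal (1 / \<eta>) * increments (\<lambda>l. ennreal (\<kappa> l))"
    using \<eta> by (simp add: ennreal_mult[symmetric] add.assoc[symmetric] flip: ennreal_plus)
  finally show "ennreal \<bar>(LINT x|torus. v x \<bullet> w x) - integral\<^sup>L torus2 (\<lambda>(x, y). \<kappa> (x - y) * (v x \<bullet> w y))\<bar>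
    \<le> ennreal (\<eta> * (LINT x|torus. norm (w x))) + ennreal (1 / \<eta>) * increments (\<lambda>l. ennreal (\<kappa> l))"
    by (simp add: IR ID H_def)
qed

end

subsection \<open>Bounds for the increments\<close>

text \<open>With m the larger of the two right-hand terms, a is at most m^(1/q) and b at most
  m^(1/n), and the exponents add up to 1. It is used for the exponents in space, for p and m in
  time, and for r1 and r2.\<close>

lemma square_mult_le_powr_sum:
  fixes a b q n :: real
  assumes "0 \<le> a" "0 \<le> b" "0 < q" "0 < n" "2 / q + 1 / n = 1"
  shows "a\<^sup>2 * b \<le> a powr q + b powr n"
proof -
  define m where "m = max (a powr q) (b powr n)"
  have m0: "0 \<le> m" by (simp add: m_def le_max_iff_disj)
  have a: "a \<le> m powr (1 / q)"
  proof -
    have "a = (a powr q) powr (1 / q)" using assms by (simp add: powr_powr)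
    also have "\<dots> \<le> m powr (1 / q)" using assms by (intro powr_mono2) (auto simp: m_def)
    finally show ?thesis .
  qed
  have b: "b \<le> m powr (1 / n)"
  proof -
    have "b = (b powr n) powr (1 / n)" using assms by (simp add: powr_powr)
    also have "\<dots> \<le> m powr (1 / n)" using assms by (intro powr_mono2) (auto simp: m_def)
    finally show ?thesis .
  qed
  have "a\<^sup>2 * b \<le> (m powr (1 / q))\<^sup>2 * m powr (1 / n)"
    using a b assms by (intro mult_mono power_mono) auto
  also have "\<dots> = m powr (1 / q + 1 / q + 1 / n)" by (simp only: powr_add power2_eq_square)
  also have "1 / q + 1 / q + 1 / n = 1" using assms(5) by simp
  also have "m powr 1 = m" using m0 by simp
  also have "m \<le> a powr q + b powr n" by (simp add: m_def)
  finally show ?thesis .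
qed

text \<open>The constant 2 spares the sharp form of Hoelder's inequality.\<close>

lemma nn_integral_square_mult_le:
  fixes f :: "'a \<Rightarrow> 'b::{real_normed_vector}" and h :: "'a \<Rightarrow> 'c::{real_normed_vector}"
  assumes f: "integrable M (\<lambda>x. norm (f x) powr q)" and h: "integrable M (\<lambda>x. norm (h x) powr n)"
    and qn: "0 < q" "0 < n" "2 / q + 1 / n = 1"
  shows "(\<integral>\<^sup>+x. ennreal ((norm (f x))\<^sup>2 * norm (h x)) \<partial>M)
    \<le> ennreal (2 * ((LINT x|M. norm (f x) powr q) powr (1 / q))\<^sup>2 * (LINT x|M. norm (h x) powr n) powr (1 / n))"
proof -
  define A where "A = (LINT x|M. norm (f x) powr q) powr (1 / q)"
  define B where "B = (LINT x|M. norm (h x) powr n) powr (1 / n)"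
  have f0: "0 \<le> (LINT x|M. norm (f x) powr q)" and h0: "0 \<le> (LINT x|M. norm (h x) powr n)" by auto
  show ?thesis
  proof (cases "A = 0 \<or> B = 0")
    case True
    then have "(LINT x|M. norm (f x) powr q) = 0 \<or> (LINT x|M. norm (h x) powr n) = 0" by (auto simp: A_def B_def)
    then have "AE x in M. (norm (f x))\<^sup>2 * norm (h x) = 0"
    proof
      assume "(LINT x|M. norm (f x) powr q) = 0"
      then have "AE x in M. norm (f x) powr q = 0" using f by (subst (asm) integral_nonneg_eq_0_iff_AE) auto
      then show ?thesis by eventually_elim auto
    next
      assume "(LINT x|M. norm (h x) powr n) = 0"
      then have "AE x in M. norm (h x) powr n = 0" using h by (subst (asm) integral_nonneg_eq_0_iff_AE) auto
      then show ?thesis by eventually_elim auto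
    qed
    then have "(\<integral>\<^sup>+x. ennreal ((norm (f x))\<^sup>2 * norm (h x)) \<partial>M) = (\<integral>\<^sup>+x. 0 \<partial>M)"
    proof (intro nn_integral_cong_AE, eventually_elim)
      case (elim x)
      then show ?case by (metis ennreal_0)
    qed
    then show ?thesis by simp
  next
    case False
    then have AB: "0 < A" "0 < B" by (auto simp: A_def B_def)
    have Aq: "A powr q = (LINT x|M. norm (f x) powr q)" using f0 qn by (simp add: A_def powr_powr)
    have Bn: "B powr n = (LINT x|M. norm (h x) powr n)" using h0 qn by (simp add: B_def powr_powr)
    \<comment> \<open>After division by its norm each of the two powers has integral 1; this is
      where the constant 2 comes from. Vanishing norms were treated separately because of the
      division.\<close>
    define k where "k x = A\<^sup>2 * B * (norm (f x) powr q / A powr q + norm (h x) powr n / B powr n)" for x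
    have ik: "integrable M k" unfolding k_def using f h by simp
    have "(LINT x|M. k x) = A\<^sup>2 * B * ((LINT x|M. norm (f x) powr q) / A powr q + (LINT x|M. norm (h x) powr n) / B powr n)"
      unfolding k_def using f h by simp
    also have "\<dots> = 2 * A\<^sup>2 * B" using AB by (simp flip: Aq Bn)
    finally have Ik: "(LINT x|M. k x) = 2 * A\<^sup>2 * B" .
    have "(\<integral>\<^sup>+x. ennreal ((norm (f x))\<^sup>2 * norm (h x)) \<partial>M) \<le> (\<integral>\<^sup>+x. ennreal (k x) \<partial>M)"
    proof (intro nn_integral_mono ennreal_leI)
      fix x
      have "(norm (f x))\<^sup>2 * norm (h x) = A\<^sup>2 * B * ((norm (f x) / A)\<^sup>2 * (norm (h x) / B))"
        using AB by (simp add: power_divide)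
      also have "\<dots> \<le> A\<^sup>2 * B * ((norm (f x) / A) powr q + (norm (h x) / B) powr n)"
        using AB qn by (intro mult_left_mono square_mult_le_powr_sum) auto
      finally show "(norm (f x))\<^sup>2 * norm (h x) \<le> k x" using AB by (simp add: k_def powr_divide)
    qed
    also have "\<dots> = ennreal (LINT x|M. k x)"
      using AB by (intro nn_integral_eq_integral ik) (auto simp: k_def)
    finally show ?thesis unfolding Ik A_def B_def .
  qed
qed

text \<open>Passing to a Borel representative alters the integrand on a null set for every l, so the
  function of l is literally unchanged.\<close>

lemma increment_integral_measurable:
  fixes f :: "real^3 \<Rightarrow> 'b::euclidean_space"
  assumes per: "torus_periodic f" and f: "f \<in> borel_measurable torus"
    and G[measurable]: "G \<in> borel_measurable (borel :: ('b \<times> 'b) measure)"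
  shows "(\<lambda>l. \<integral>\<^sup>+y. (G (f (y + l), f y) :: ennreal) \<partial>torus) \<in> borel_measurable borel"
proof -
  obtain g where g[measurable]: "g \<in> borel_measurable borel" and gper: "torus_periodic g" and N: "negligible {x. f x \<noteq> g x}"
    by (rule torus_periodic_ex_borel[OF per f])
  have eqM: "AE x in torus. f (x + l) = g (x + l)" for l by (rule AE_torus_shift[OF N])
  have eq0: "AE x in torus. f x = g x" using eqM[of 0] by simp
  have "(\<integral>\<^sup>+y. G (f (y + l), f y) \<partial>torus) = (\<integral>\<^sup>+y. G (g (y + l), g y) \<partial>torus)" for l
    by (rule nn_integral_cong_AE) (use eqM[of l] eq0 in \<open>eventually_elim, simp\<close>)
  moreover have "(\<lambda>l. \<integral>\<^sup>+y. G (g (y + l), g y) \<partial>torus) \<in> borel_measurable borel"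
    by measurable
  ultimately show ?thesis by simp
qed

context torus_fields begin

lemma increments_shift:
  fixes \<kappa> :: "real^3 \<Rightarrow> ennreal"
  assumes pv: "torus_periodic v" and pw: "torus_periodic w"
    and \<kappa>: "\<kappa> \<in> borel_measurable borel" "torus_periodic \<kappa>"
  shows "increments \<kappa> = (\<integral>\<^sup>+l. \<kappa> l * (\<integral>\<^sup>+y. ennreal ((norm (v (y + l) - v y))\<^sup>2 * norm (w (y + l) - w y)) \<partial>torus)
     * indicator centered_cell l \<partial>lborel)"
    and "(\<lambda>l. \<integral>\<^sup>+y. ennreal ((norm (v (y + l) - v y))\<^sup>2 * norm (w (y + l) - w y)) \<partial>torus) \<in> borel_measurable borel"
proof -
  \<comment> \<open>Both fields are packed into one function, so that a single substitution and a
    single Borel representative serve both.\<close>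
  define f where "f x = (v x, w x)" for x
  define G where "G = (\<lambda>(p :: (real^3) \<times> (real^3), q). ennreal ((norm (fst p - fst q))\<^sup>2 * norm (snd p - snd q)))"
  have pf: "torus_periodic f" using pv pw by (simp add: torus_periodic_def f_def)
  have mf: "f \<in> borel_measurable torus" unfolding f_def by measurable
  have mG: "G \<in> borel_measurable borel" 
  proof -
    have "G = (\<lambda>z. ennreal ((norm (fst (fst z) - fst (snd z)))\<^sup>2 * norm (snd (fst z) - snd (snd z))))"
      by (auto simp: G_def)
    moreover have "\<dots> \<in> borel_measurable borel"
      by (intro measurable_compose[OF _ measurable_ennreal] borel_measurable_continuous_onI continuous_intros)
    ultimately show ?thesis by simp
  qed
  show "increments \<kappa> = (\<integral>\<^sup>+l. \<kappa> l * (\<integral>\<^sup>+y. ennreal ((norm (v (y + l) - v y))\<^sup>2 * norm (w (y + l) - w y)) \<partial>torus)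
     * indicator centered_cell l \<partial>lborel)"
    using nn_integral_torus_increments[OF pf mf \<kappa> mG] unfolding increments_def by (simp add: f_def G_def)
  show "(\<lambda>l. \<integral>\<^sup>+y. ennreal ((norm (v (y + l) - v y))\<^sup>2 * norm (w (y + l) - w y)) \<partial>torus) \<in> borel_measurable borel"
    using increment_integral_measurable[OF pf mf mG] by (simp add: f_def G_def)
qed

text \<open>The cell of increments is split at radius d. Inside, the rate E |l| is absorbed by the
  first moment of \<kappa>; outside, \<kappa> is at most \<tau> and the remaining increments are
  bounded by their unweighted total.\<close>

lemma increments_le:
  fixes \<kappa> :: "real^3 \<Rightarrow> real"
  assumes pv: "torus_periodic v" and pw: "torus_periodic w"
    and \<kappa>[measurable]: "\<kappa> \<in> borel_measurable borel" and \<kappa>p: "torus_periodic \<kappa>" and \<kappa>0: "\<And>l. 0 \<le> \<kappa> l"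
    and small: "\<And>l. l \<in> ball 0 d \<Longrightarrow>
      (\<integral>\<^sup>+y. ennreal ((norm (v (y + l) - v y))\<^sup>2 * norm (w (y + l) - w y)) \<partial>torus) \<le> ennreal (E * norm l)"
    and E: "0 \<le> E" and \<tau>: "0 \<le> \<tau>" and tail: "\<And>l. l \<in> centered_cell \<Longrightarrow> l \<notin> ball 0 d \<Longrightarrow> \<kappa> l \<le> \<tau>"
    and mom: "(\<integral>\<^sup>+l. ennreal (\<kappa> l * norm l) * indicator centered_cell l \<partial>lborel) \<le> ennreal C"
    and tot: "increments (\<lambda>l. 1) \<le> ennreal K" and C: "0 \<le> C" and K: "0 \<le> K"
  shows "increments (\<lambda>l. ennreal (\<kappa> l)) \<le> ennreal (E * C + \<tau> * K)"
proof -
  define \<Phi> where "\<Phi> l = (\<integral>\<^sup>+y. ennreal ((norm (v (y + l) - v y))\<^sup>2 * norm (w (y + l) - w y)) \<partial>torus)" for l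
  have p1: "torus_periodic (\<lambda>l. 1::ennreal)" and p2: "torus_periodic (\<lambda>l. ennreal (\<kappa> l))"
    using \<kappa>p by (auto simp: torus_periodic_def)
  have [measurable]: "\<Phi> \<in> borel_measurable borel"
    unfolding \<Phi>_def by (rule increments_shift(2)[OF pv pw _ p1]) simp
  have [measurable]: "centered_cell \<in> sets borel" by (simp add: centered_cell_def)
  have i1: "increments (\<lambda>l. 1) = (\<integral>\<^sup>+l. \<Phi> l * indicator centered_cell l \<partial>lborel)"
    using increments_shift(1)[OF pv pw _ p1] by (simp add: \<Phi>_def)
  have "increments (\<lambda>l. ennreal (\<kappa> l)) = (\<integral>\<^sup>+l. ennreal (\<kappa> l) * \<Phi> l * indicator centered_cell l \<partial>lborel)"
    unfolding \<Phi>_def by (rule increments_shift(1)[OF pv pw _ p2]) measurable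
  also have "\<dots> \<le> (\<integral>\<^sup>+l. ennreal E * (ennreal (\<kappa> l * norm l) * indicator centered_cell l)
      + ennreal \<tau> * (\<Phi> l * indicator centered_cell l) \<partial>lborel)"
  proof (rule nn_integral_mono)
    fix l :: "real^3"
    show "ennreal (\<kappa> l) * \<Phi> l * indicator centered_cell l \<le> ennreal E * (ennreal (\<kappa> l * norm l) * indicator centered_cell l)
      + ennreal \<tau> * (\<Phi> l * indicator centered_cell l)"
    proof (cases "l \<in> ball 0 d")
      case True
      have "ennreal (\<kappa> l) * \<Phi> l \<le> ennreal (\<kappa> l) * ennreal (E * norm l)"
        unfolding \<Phi>_def by (intro mult_left_mono small[OF True]) auto
      also have "\<dots> = ennreal E * ennreal (\<kappa> l * norm l)"
        using \<kappa>0 E by (simp add: ennreal_mult[symmetric] mult_ac)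
      finally show ?thesis by (auto simp: indicator_def intro: add_increasing2)
    next
      case False
      show ?thesis
      proof (cases "l \<in> centered_cell")
        case True
        have "ennreal (\<kappa> l) * \<Phi> l \<le> ennreal \<tau> * \<Phi> l"
          by (intro mult_right_mono ennreal_leI tail[OF True False]) auto
        then show ?thesis using True by (auto intro: add_increasing)
      qed simp
    qed
  qed
  also have "\<dots> = ennreal E * (\<integral>\<^sup>+l. ennreal (\<kappa> l * norm l) * indicator centered_cell l \<partial>lborel)
      + ennreal \<tau> * increments (\<lambda>l. 1)"
    unfolding i1 by (subst nn_integral_add) (auto simp: nn_integral_cmult)
  also have "\<dots> \<le> ennreal E * ennreal C + ennreal \<tau> * ennreal K"
    using mom tot by (intro add_mono mult_left_mono) auto
  also have "\<dots> = ennreal (E * C + \<tau> * K)"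
    using E C \<tau> K by (simp add: ennreal_mult[symmetric] ennreal_plus)
  finally show ?thesis .
qed

end

section \<open>From Lebesgue norms and increment hypotheses to bounds at one time\<close>

lemma Lq_norm_nonneg [simp]: "0 \<le> Lq_norm q f"
  by (simp add: Lq_norm_def)

lemma integrable_torus2_fst:
  assumes "integrable torus (f :: _ \<Rightarrow> real)" shows "integrable torus2 (\<lambda>(x, y). f x)" "integrable torus2 (\<lambda>(x, y). f y)"
    "integral\<^sup>L torus2 (\<lambda>(x, y). f x) = integral\<^sup>L torus f" "integral\<^sup>L torus2 (\<lambda>(x, y). f y) = integral\<^sup>L torus f"
proof -
  have [measurable]: "f \<in> borel_measurable torus" using assms by auto
  have i: "integrable torus (\<lambda>x. \<bar>f x\<bar>)" "integrable torus (\<lambda>x. 1::real)" using assms by auto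
  show 1: "integrable torus2 (\<lambda>(x, y). f x)"
    by (rule integrable_torus2_bound[OF i, of _ 1]) auto
  show 2: "integrable torus2 (\<lambda>(x, y). f y)"
    by (rule integrable_torus2_bound[OF i(2,1), of _ 1]) auto
  show "integral\<^sup>L torus2 (\<lambda>(x, y). f x) = integral\<^sup>L torus f"
    using torus2.integral_fst'[OF 1] by (simp add: measure_torus)
  show "integral\<^sup>L torus2 (\<lambda>(x, y). f y) = integral\<^sup>L torus f"
    using torus2.integral_fst'[OF 2] by (simp add: measure_torus)
qed

text \<open>A difference is at most twice the larger norm, which yields a factor 2^q; the two points
  of the pair yield another 2, at most 2^q. Taking the root of 4^q leaves the constant 4.\<close>

lemma increment_powr_integral:
  fixes f :: "real^3 \<Rightarrow> real^3"
  assumes f: "in_Lq q f" and q: "1 \<le> q"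
  shows "integrable torus2 (\<lambda>z. norm (f (fst z) - f (snd z)) powr q)"
    and "(LINT z|torus2. norm (f (fst z) - f (snd z)) powr q) powr (1 / q) \<le> 4 * Lq_norm q f"
proof -
  have [measurable]: "f \<in> borel_measurable torus" and i: "integrable torus (\<lambda>x. norm (f x) powr q)"
    using f by (auto simp: in_Lq_def)
  note fs = integrable_torus2_fst[OF i]
  define k where "k z = 2 powr q * ((case z of (x, y) \<Rightarrow> norm (f x) powr q) + (case z of (x, y) \<Rightarrow> norm (f y) powr q))" for z
  have ik: "integrable torus2 k" unfolding k_def using fs by simp
  have le: "norm (f (fst z) - f (snd z)) powr q \<le> k z" for z
  proof -
    define m where "m = max (norm (f (fst z))) (norm (f (snd z)))"
    have "norm (f (fst z) - f (snd z)) \<le> norm (f (fst z)) + norm (f (snd z))" by (rule norm_triangle_ineq4)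
    also have "\<dots> \<le> 2 * m" by (simp add: m_def)
    finally have "norm (f (fst z) - f (snd z)) powr q \<le> (2 * m) powr q" using q by (intro powr_mono2) auto
    also have "\<dots> = 2 powr q * m powr q" by (rule powr_mult)
    also have "m powr q \<le> norm (f (fst z)) powr q + norm (f (snd z)) powr q"
      by (cases "norm (f (fst z)) \<le> norm (f (snd z))") (auto simp: m_def max_def)
    finally show ?thesis by (simp add: k_def case_prod_beta)
  qed
  show ii: "integrable torus2 (\<lambda>z. norm (f (fst z) - f (snd z)) powr q)"
  proof (rule Bochner_Integration.integrable_bound[OF ik])
    show "AE z in torus2. norm (norm (f (fst z) - f (snd z)) powr q) \<le> norm (k z)"
      using order_trans[OF le abs_ge_self] by (intro AE_I2) simp
  qed measurable
  have "(LINT z|torus2. norm (f (fst z) - f (snd z)) powr q) \<le> integral\<^sup>L torus2 k"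
    by (rule integral_mono[OF ii ik le])
  also have "\<dots> = 2 powr q * (2 * (LINT x|torus. norm (f x) powr q))"
    unfolding k_def using fs by simp
  also have "\<dots> \<le> 2 powr q * (2 powr q * (LINT x|torus. norm (f x) powr q))"
    using q powr_mono[of 1 q 2] by (intro mult_left_mono mult_right_mono) auto
  also have "\<dots> = 4 powr q * (LINT x|torus. norm (f x) powr q)"
    using powr_mult[of 2 2 q] by simp
  finally have "(LINT z|torus2. norm (f (fst z) - f (snd z)) powr q) powr (1 / q)
     \<le> (4 powr q * (LINT x|torus. norm (f x) powr q)) powr (1 / q)"
    using q by (intro powr_mono2) auto
  also have "\<dots> = 4 * Lq_norm q f"
    using q by (simp add: powr_mult powr_powr Lq_norm_def)
  finally show "(LINT z|torus2. norm (f (fst z) - f (snd z)) powr q) powr (1 / q) \<le> 4 * Lq_norm q f" .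
qed

text \<open>Lower powers are bounded by 1 plus the given power, and |v| |w| by |w| + |v|^2 |w|,
  whose last term is where 2/q + 1/n = 1 enters. The constant is 2 * 4^2 * 4, from the product
  estimate and three increment norms.\<close>

lemma torus_fields_Lq:
  assumes v: "in_Lq q v" and w: "in_Lq n w" and qn: "3 \<le> q" "1 < n" "2 / q + 1 / n = 1"
  shows "torus_fields v w"
    and "torus_fields.increments v w (\<lambda>l. 1) \<le> ennreal (128 * (Lq_norm q v)\<^sup>2 * Lq_norm n w)"
proof -
  have [measurable]: "v \<in> borel_measurable torus" "w \<in> borel_measurable torus"
    and iv: "integrable torus (\<lambda>x. norm (v x) powr q)" and iw: "integrable torus (\<lambda>x. norm (w x) powr n)"
    using v w by (auto simp: in_Lq_def)
  have bound: "s powr r \<le> 1 + s powr p" if "0 < r" "r \<le> p" "0 \<le> s" for s r p :: real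
  proof (cases "s \<le> 1")
    case True
    then have "s powr r \<le> 1" using that powr_mono2[of r s 1] by simp
    then show ?thesis by (simp add: add_increasing2)
  next
    case False
    then have "s powr r \<le> s powr p" using that by (intro powr_mono) auto
    then show ?thesis by simp
  qed
  have b1: "integrable torus (\<lambda>x. norm (v x))"
    by (rule Bochner_Integration.integrable_bound[of torus "\<lambda>x. 1 + norm (v x) powr q"])
       (use iv bound[of 1 q] qn in \<open>auto intro!: AE_I2\<close>)
  have b2: "integrable torus (\<lambda>x. norm (v x) * norm (v x))"
    by (rule Bochner_Integration.integrable_bound[of torus "\<lambda>x. 1 + norm (v x) powr q"])
       (use iv bound[of 2 q] qn in \<open>auto intro!: AE_I2 simp: power2_eq_square[symmetric]\<close>)
  have b3: "integrable torus (\<lambda>x. norm (w x))"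
    by (rule Bochner_Integration.integrable_bound[of torus "\<lambda>x. 1 + norm (w x) powr n"])
       (use iw bound[of 1 n] qn in \<open>auto intro!: AE_I2\<close>)
  have b5: "integrable torus (\<lambda>x. norm (v x) * norm (v x) * norm (w x))"
  proof (rule Bochner_Integration.integrable_bound[of torus "\<lambda>x. norm (v x) powr q + norm (w x) powr n"])
    show "AE x in torus. norm (norm (v x) * norm (v x) * norm (w x)) \<le> norm (norm (v x) powr q + norm (w x) powr n)"
      using square_mult_le_powr_sum[of "norm (v _)" "norm (w _)" q n] qn
      by (intro AE_I2) (auto simp: power2_eq_square)
  qed (use iv iw in auto)
  have b4: "integrable torus (\<lambda>x. norm (v x) * norm (w x))"
  proof (rule Bochner_Integration.integrable_bound[of torus "\<lambda>x. norm (w x) + norm (v x) * norm (v x) * norm (w x)"])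
    have "norm (v x) * norm (w x) \<le> norm (w x) + norm (v x) * norm (v x) * norm (w x)" for x
    proof -
      have "norm (v x) \<le> 1 + norm (v x) * norm (v x)" using bound[of 1 2 "norm (v x)"] by (simp add: power2_eq_square)
      from mult_right_mono[OF this norm_ge_zero[of "w x"]] show ?thesis by (simp add: algebra_simps)
    qed
    then show "AE x in torus. norm (norm (v x) * norm (w x)) \<le> norm (norm (w x) + norm (v x) * norm (v x) * norm (w x))"
      by (intro AE_I2) auto
  qed (use b3 b5 in auto)
  show tf: "torus_fields v w" using b1 b2 b3 b4 b5 by unfold_locales auto
  note pv = increment_powr_integral[OF v] and pw = increment_powr_integral[OF w]
  interpret torus_fields v w by (rule tf)
  have "increments (\<lambda>l. 1) = (\<integral>\<^sup>+z. ennreal ((norm (v (fst z) - v (snd z)))\<^sup>2 * norm (w (fst z) - w (snd z))) \<partial>torus2)"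
    unfolding increments_def by (intro nn_integral_cong) auto
  also have "\<dots> \<le> ennreal (2 * ((LINT z|torus2. norm (v (fst z) - v (snd z)) powr q) powr (1 / q))\<^sup>2
     * (LINT z|torus2. norm (w (fst z) - w (snd z)) powr n) powr (1 / n))"
    by (rule nn_integral_square_mult_le) (use pv(1) pw(1) qn in auto)
  also have "\<dots> \<le> ennreal (2 * (4 * Lq_norm q v)\<^sup>2 * (4 * Lq_norm n w))"
    using pv(2) pw(2) qn by (intro ennreal_leI mult_mono power_mono mult_left_mono) auto
  also have "2 * (4 * Lq_norm q v)\<^sup>2 * (4 * Lq_norm n w) = 128 * (Lq_norm q v)\<^sup>2 * Lq_norm n w"
    by (simp add: power_mult_distrib)
  finally show "increments (\<lambda>l. 1) \<le> ennreal (128 * (Lq_norm q v)\<^sup>2 * Lq_norm n w)" .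
qed

text \<open>Twice 2/9 plus 5/9 is 1, so the product estimate applies with exponents 9/2 and 9/5, and
  |l| \<le> 1 reduces the power 2 \<alpha> + \<beta> to 1. The point l = 0 is separate because a
  limit at 0 says nothing about \<sigma>1 and \<sigma>2 there; all increments vanish anyway.\<close>

lemma increment_product_small:
  fixes v w :: "real^3 \<Rightarrow> real^3"
  assumes v: "in_Lq (9/2) (\<lambda>x. v (x + l) - v x)" "Lq_norm (9/2) (\<lambda>x. v (x + l) - v x) \<le> c1 * norm l powr \<alpha> * s1"
    and w: "in_Lq (9/5) (\<lambda>x. w (x + l) - w x)" "Lq_norm (9/5) (\<lambda>x. w (x + l) - w x) \<le> c2 * norm l powr \<beta> * s2"
    and ab: "1 \<le> 2 * \<alpha> + \<beta>" and l: "norm l \<le> 1" and nn: "0 \<le> c1" "0 \<le> c2" "0 \<le> s1" "0 \<le> s2"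
    and Y: "c1\<^sup>2 * c2 \<le> Y" and e: "l \<noteq> 0 \<Longrightarrow> 2 * s1\<^sup>2 * s2 \<le> \<epsilon>" "0 \<le> \<epsilon>"
  shows "(\<integral>\<^sup>+y. ennreal ((norm (v (y + l) - v y))\<^sup>2 * norm (w (y + l) - w y)) \<partial>torus) \<le> ennreal (\<epsilon> * Y * norm l)"
proof (cases "l = 0")
  case False
  have iv: "integrable torus (\<lambda>x. norm (v (x + l) - v x) powr (9/2))" and iw: "integrable torus (\<lambda>x. norm (w (x + l) - w x) powr (9/5))"
    using v(1) w(1) by (auto simp: in_Lq_def)
  have "(\<integral>\<^sup>+y. ennreal ((norm (v (y + l) - v y))\<^sup>2 * norm (w (y + l) - w y)) \<partial>torus)
     \<le> ennreal (2 * (Lq_norm (9/2) (\<lambda>x. v (x + l) - v x))\<^sup>2 * Lq_norm (9/5) (\<lambda>x. w (x + l) - w x))"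
    unfolding Lq_norm_def by (rule nn_integral_square_mult_le[OF iv iw]) auto
  also have "\<dots> \<le> ennreal (2 * (c1 * norm l powr \<alpha> * s1)\<^sup>2 * (c2 * norm l powr \<beta> * s2))"
    using v(2) w(2) nn by (intro ennreal_leI mult_mono power_mono mult_left_mono) auto
  also have "2 * (c1 * norm l powr \<alpha> * s1)\<^sup>2 * (c2 * norm l powr \<beta> * s2) 
     = (2 * s1\<^sup>2 * s2) * (c1\<^sup>2 * c2) * (norm l powr \<alpha> * norm l powr \<alpha> * norm l powr \<beta>)"
    by (simp add: power2_eq_square mult_ac)
  also have "norm l powr \<alpha> * norm l powr \<alpha> * norm l powr \<beta> = norm l powr (2 * \<alpha> + \<beta>)"
    by (simp flip: powr_add)
  also have "ennreal ((2 * s1\<^sup>2 * s2) * (c1\<^sup>2 * c2) * norm l powr (2 * \<alpha> + \<beta>)) \<le> ennreal (\<epsilon> * Y * norm l)"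
  proof (rule ennreal_leI)
    have "norm l powr (2 * \<alpha> + \<beta>) \<le> norm l powr 1"
      using False l ab by (intro powr_mono') auto
    then have "norm l powr (2 * \<alpha> + \<beta>) \<le> norm l" by simp
    moreover have "0 \<le> c1\<^sup>2 * c2" using nn by simp
    ultimately show "(2 * s1\<^sup>2 * s2) * (c1\<^sup>2 * c2) * norm l powr (2 * \<alpha> + \<beta>) \<le> \<epsilon> * Y * norm l"
      using e(1)[OF False] e(2) Y nn order_trans[OF \<open>0 \<le> c1\<^sup>2 * c2\<close> Y] by (intro mult_mono) auto
  qed
  finally show ?thesis .
qed simp

subsection \<open>Time slices\<close>

lemma borel_measurable_lebesgue_AE:
  assumes g: "g \<in> borel_measurable lebesgue" and ae: "AE x in lebesgue. f x = g x"
  shows "f \<in> borel_measurable lebesgue"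
proof (rule measurableI)
  fix A :: "'b set" assume "A \<in> sets borel"
  then have A: "g -` A \<inter> space lebesgue \<in> sets lebesgue" using g by (rule measurable_sets[rotated])
  have ae': "AE x in lebesgue. x \<in> g -` A \<inter> space lebesgue \<longleftrightarrow> x \<in> f -` A \<inter> space lebesgue"
    using ae by (rule eventually_mono) simp
  show "f -` A \<inter> space lebesgue \<in> sets lebesgue"
    by (rule completion.in_sets_AE[OF ae' A]) (rule Int_lower2)
qed simp

lemma integrable_lebesgue_AE:
  fixes f g :: "'a::euclidean_space \<Rightarrow> 'b::{banach, second_countable_topology}"
  assumes g: "integrable lborel g" and ae: "AE x in lborel. f x = g x"
  shows "integrable lebesgue f" "integral\<^sup>L lebesgue f = integral\<^sup>L lborel g"
proof -
  have gm: "g \<in> borel_measurable lborel" using g by auto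
  have gl: "integrable lebesgue g" using g gm by (subst integrable_completion) auto
  have ae': "AE x in lebesgue. f x = g x" using ae by (rule AE_completion)
  have fm: "f \<in> borel_measurable lebesgue"
    by (rule borel_measurable_lebesgue_AE[OF borel_measurable_integrable[OF gl] ae'])
  have gml: "g \<in> borel_measurable lebesgue" using gl by (rule borel_measurable_integrable)
  show "integrable lebesgue f"
    using integrable_cong_AE[OF fm gml ae'] gl by (rule iffD2)
  show "integral\<^sup>L lebesgue f = integral\<^sup>L lborel g"
    using integral_cong_AE[OF fm gml ae'] integral_completion[OF gm] by (rule trans)
qed

text \<open>Lebesgue measure on a product is the completion of the product measure, not a product
  itself. Fubini is therefore applied to a Borel representative, whose slices agree with those of F
  almost everywhere for almost every t.\<close>

lemma Fubini_lebesgue_on: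
  fixes F :: "'a::euclidean_space \<times> 'b::euclidean_space \<Rightarrow> 'c::euclidean_space"
  assumes F: "integrable (lebesgue_on (S \<times> C)) F" and S: "S \<in> sets borel" and C: "C \<in> sets borel"
  shows "AE t in lebesgue_on S. integrable (lebesgue_on C) (\<lambda>x. F (t, x))"
    and "integrable (lebesgue_on S) (\<lambda>t. LINT x|lebesgue_on C. F (t, x))"
    and "(LINT t|lebesgue_on S. LINT x|lebesgue_on C. F (t, x)) = integral\<^sup>L (lebesgue_on (S \<times> C)) F"
proof -
  have SL: "S \<in> sets lebesgue" and CL: "C \<in> sets lebesgue" using S C by auto
  have SC: "S \<times> C \<in> sets lebesgue" using S C by (intro sets_completionI_sets) (simp add: borel_Times)
  define F0 where "F0 z = indicator (S \<times> C) z *\<^sub>R F z" for z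
  have iF0: "integrable lebesgue F0" unfolding F0_def[abs_def] using F SC by (simp add: integrable_restrict_space)
  then have "F0 \<in> borel_measurable lebesgue" by auto
  then obtain F1 where F1: "F1 \<in> borel_measurable borel" "AE z in lborel. F0 z = F1 z" by (rule lebesgue_ex_borel)
  have iF1l: "integrable lebesgue F1"
  proof (rule integrable_cong_AE_imp[OF iF0])
    show "F1 \<in> borel_measurable lebesgue" using F1(1) by (intro measurable_completion) simp
    show "AE z in lebesgue. F0 z = F1 z" by (rule AE_completion[OF F1(2)])
  qed
  have "F1 \<in> borel_measurable lborel" using F1(1) by simp
  from integrable_completion[OF this] have iF1: "integrable lborel F1" using iF1l by (rule iffD1)
  have I1: "integral\<^sup>L lebesgue F0 = integral\<^sup>L lborel F1" by (rule integrable_lebesgue_AE(2)[OF iF1 F1(2)])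
  have iF1p: "integrable (lborel \<Otimes>\<^sub>M lborel) F1" using iF1 by (simp add: lborel_prod)
  have ae1: "AE t in lborel. AE x in lborel. F0 (t, x) = F1 (t, x)"
    by (rule lborel_pair.AE_pair, subst lborel_prod) (rule F1(2))
  have ae2: "AE t in lborel. integrable lborel (\<lambda>x. F1 (t, x))"
    by (rule lborel_pair.AE_integrable_fst'[OF iF1p])
  have F0eq: "F0 (t, x) = indicator S t *\<^sub>R (indicator C x *\<^sub>R F (t, x))" for t x
    by (auto simp: F0_def indicator_def)
  have ae3: "AE t in lborel. integrable lebesgue (\<lambda>x. F0 (t, x)) \<and> (LINT x|lebesgue. F0 (t, x)) = (LINT x|lborel. F1 (t, x))"
    using ae1 ae2
  proof eventually_elim
    case (elim t)
    then show ?case using integrable_lebesgue_AE[OF elim(2) elim(1)] by simp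
  qed
  have ae3': "AE t in lebesgue. integrable lebesgue (\<lambda>x. F0 (t, x))"
    using AE_completion[OF ae3] by (rule eventually_mono) blast
  have "integrable (lebesgue_on C) (\<lambda>x. F (t, x))" if "integrable lebesgue (\<lambda>x. F0 (t, x))" "t \<in> S" for t
    using that CL by (simp add: integrable_restrict_space F0eq)
  then have "AE t in lebesgue. t \<in> S \<longrightarrow> integrable (lebesgue_on C) (\<lambda>x. F (t, x))"
    by (intro eventually_mono[OF ae3']) blast
  then show "AE t in lebesgue_on S. integrable (lebesgue_on C) (\<lambda>x. F (t, x))"
    using SL by (simp add: AE_restrict_space_iff)
  have slice: "indicator S t *\<^sub>R (LINT x|lebesgue_on C. F (t, x)) = (LINT x|lebesgue. F0 (t, x))" for t
    using CL by (cases "t \<in> S") (simp_all add: F0eq integral_restrict_space)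
  have ae4: "AE t in lborel. (LINT x|lebesgue. F0 (t, x)) = (LINT x|lborel. F1 (t, x))"
    using ae3 by (rule eventually_mono) blast
  have i1: "integrable lborel (\<lambda>t. LINT x|lborel. F1 (t, x))" by (rule lborel_pair.integrable_fst'[OF iF1p])
  note sl = integrable_lebesgue_AE[OF i1 ae4]
  show "integrable (lebesgue_on S) (\<lambda>t. LINT x|lebesgue_on C. F (t, x))"
    using sl(1) SL by (simp add: integrable_restrict_space slice)
  have "(LINT t|lebesgue_on S. LINT x|lebesgue_on C. F (t, x)) = (LINT t|lebesgue. LINT x|lebesgue. F0 (t, x))"
    using SL by (simp add: integral_restrict_space slice)
  also have "\<dots> = integral\<^sup>L (lborel \<Otimes>\<^sub>M lborel) F1"
    unfolding sl(2) by (rule lborel_pair.integral_fst'[OF iF1p])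
  also have "\<dots> = integral\<^sup>L lebesgue F0" by (simp add: I1 lborel_prod)
  also have "\<dots> = integral\<^sup>L (lebesgue_on (S \<times> C)) F" using SC by (simp add: integral_restrict_space F0_def[abs_def])
  finally show "(LINT t|lebesgue_on S. LINT x|lebesgue_on C. F (t, x)) = integral\<^sup>L (lebesgue_on (S \<times> C)) F" .
qed

lemma integrable_mult_continuous:
  fixes F :: "'a::euclidean_space \<Rightarrow> 'b::{banach, second_countable_topology}"
  assumes F: "integrable (lebesgue_on K) F" and K: "compact K" and h: "continuous_on UNIV h"
  shows "integrable (lebesgue_on K) (\<lambda>z. h z *\<^sub>R F z)"
proof -
  have "compact (h ` K)" using K h by (intro compact_continuous_image continuous_on_subset[OF h]) auto
  then obtain B where B: "\<And>z. z \<in> K \<Longrightarrow> \<bar>h z\<bar> \<le> B"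
    by (metis bounded_iff compact_imp_bounded image_eqI real_norm_def)
  have hm: "h \<in> borel_measurable (lebesgue_on K)"
    using borel_measurable_continuous_onI[OF h] by (intro measurable_restrict_space1 measurable_completion) simp
  show ?thesis
  proof (rule Bochner_Integration.integrable_bound)
    show "integrable (lebesgue_on K) (\<lambda>z. B *\<^sub>R F z)" using F by simp
    show "(\<lambda>z. h z *\<^sub>R F z) \<in> borel_measurable (lebesgue_on K)"
      using hm F by (intro borel_measurable_scaleR) auto
    show "AE z in lebesgue_on K. norm (h z *\<^sub>R F z) \<le> norm (B *\<^sub>R F z)"
      using B by (intro AE_I2) (simp add: mult_right_mono order_trans[OF B abs_ge_self])
  qed
qed

lemma integrable_vec_componentwise:
  fixes f :: "'a \<Rightarrow> real^'n"
  assumes "\<And>j. integrable M (\<lambda>x. f x $ j)" shows "integrable M f"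
proof -
  have "integrable M (\<lambda>x. \<Sum>j\<in>UNIV. f x $ j *\<^sub>R (axis j 1 :: real^'n))"
    using assms by (intro Bochner_Integration.integrable_sum integrable_scaleR_left) auto
  moreover have "(\<Sum>j\<in>UNIV. f x $ j *\<^sub>R (axis j 1 :: real^'n)) = f x" for x
    using basis_expansion[of "f x"] by (simp only: scalar_mult_eq_scaleR)
  ultimately show ?thesis by simp
qed

lemma compact_slab: "compact ({a..b::real} \<times> torus_cell)"
  unfolding torus_cell_def by (intro compact_Times) auto

text \<open>The integrand vanishes outside a compact time interval inside (0,T), so local
  integrability in time is enough for Fubini.\<close>

lemma spacetime_integral_slices:
  fixes F :: "real \<times> (real^3) \<Rightarrow> 'c::euclidean_space"
  assumes F: "integrable (lebesgue_on ({a..b} \<times> torus_cell)) F" and ab: "0 < a" "b < T"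
    and out: "\<And>t x. t \<notin> {a..b} \<Longrightarrow> F (t, x) = 0"
  shows "spacetime_integral T F = (LINT t|lebesgue_on {a..b}. LINT x|torus. F (t, x))"
proof -
  have m: "{0<..<T} \<times> torus_cell \<in> sets lebesgue" "{a..b} \<times> torus_cell \<in> sets lebesgue"
    using torus_cell_sets(2) by (auto intro!: sets_completionI_sets borel_Times)
  have "spacetime_integral T F = (LINT z|lebesgue. indicator ({0<..<T} \<times> torus_cell) z *\<^sub>R F z)"
    unfolding spacetime_integral_def using m by (simp add: integral_restrict_space)
  also have "\<dots> = (LINT z|lebesgue. indicator ({a..b} \<times> torus_cell) z *\<^sub>R F z)"
  proof (rule Bochner_Integration.integral_cong[OF refl], clarify)
    fix t :: real and x :: "real^3"
    show "indicator ({0<..<T} \<times> torus_cell) (t, x) *\<^sub>R F (t, x) = indicator ({a..b} \<times> torus_cell) (t, x) *\<^sub>R F (t, x)"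
      using ab out[of t x] by (cases "t \<in> {a..b}") (auto simp: indicator_def)
  qed
  also have "\<dots> = integral\<^sup>L (lebesgue_on ({a..b} \<times> torus_cell)) F"
    using m by (simp add: integral_restrict_space)
  also have "\<dots> = (LINT t|lebesgue_on {a..b}. LINT x|torus. F (t, x))"
    by (rule Fubini_lebesgue_on(3)[symmetric, OF F]) auto
  finally show ?thesis .
qed

section \<open>Reduction of weak equations to scalar equations in time\<close>

lemma smooth_derivative:
  fixes \<psi> :: "real \<Rightarrow> real"
  assumes "smooth \<psi>" "\<And>t. (\<psi> has_real_derivative \<psi>' t) (at t)"
  shows "smooth \<psi>'"
proof -
  obtain \<psi>'' where s: "smooth \<psi>''" and d: "\<And>t. (\<psi> has_real_derivative \<psi>'' t) (at t)"
    using smooth_real_has_derivative[OF assms(1)] by blast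
  have "\<psi>'' = \<psi>'" by (rule ext) (rule DERIV_unique[OF d assms(2)])
  with s show ?thesis by (simp only:)
qed

lemma derivative_zero_outside:
  fixes \<psi> :: "real \<Rightarrow> real"
  assumes d: "\<And>t. (\<psi> has_real_derivative \<psi>' t) (at t)" and z: "\<And>t. t \<notin> {a<..<b} \<Longrightarrow> \<psi> t = 0" and t: "t \<notin> {a..b}"
  shows "\<psi>' t = 0"
proof -
  have "(\<psi> has_real_derivative 0) (at t)"
  proof (rule has_field_derivative_transform_within_open)
    show "((\<lambda>t. 0) has_real_derivative 0) (at t)" by (rule DERIV_const)
    show "open (- {a..b})" by (rule open_Compl) (rule closed_atLeastAtMost)
    show "t \<in> - {a..b}" using t by blast
    show "0 = \<psi> s" if "s \<in> - {a..b}" for s using that by (intro z[symmetric]) auto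
  qed
  with d show ?thesis by (rule DERIV_unique)
qed

text \<open>A and B already contain the spatial factor of a product test function. Only the time
  factor is left free, and Fubini turns the weak equation, component by component, into the setting
  of the du Bois-Reymond lemma.\<close>

lemma weak_derivative_slices:
  fixes A B :: "real \<times> (real^3) \<Rightarrow> real^3"
  assumes ab: "0 < a" "a < b" "b < T"
    and A: "integrable (lebesgue_on ({a..b} \<times> torus_cell)) A"
    and B: "integrable (lebesgue_on ({a..b} \<times> torus_cell)) B"
    and weak: "\<And>\<psi> \<psi>'. smooth \<psi> \<Longrightarrow> (\<And>t. (\<psi> has_real_derivative \<psi>' t) (at t)) \<Longrightarrow>
      (\<And>t. t \<notin> {a<..<b} \<Longrightarrow> \<psi> t = 0) \<Longrightarrow>
      spacetime_integral T (\<lambda>(t, x). \<psi>' t *\<^sub>R A (t, x) + \<psi> t *\<^sub>R B (t, x)) = 0"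
  shows "\<exists>c. AE t in lebesgue_on {a..b}. (LINT x|torus. A (t, x)) $ j
     = c + (LINT s|lebesgue_on {a..t}. (LINT x|torus. B (s, x)) $ j)"
proof (rule du_bois_reymond[OF ab(2)])
  note fA = Fubini_lebesgue_on[OF A] and fB = Fubini_lebesgue_on[OF B]
  have iA: "integrable (lebesgue_on {a..b}) (\<lambda>t. LINT x|torus. A (t, x))" and iB: "integrable (lebesgue_on {a..b}) (\<lambda>t. LINT x|torus. B (t, x))"
    by (rule fA(2), simp_all, rule fB(2), simp_all)
  show cA: "integrable (lebesgue_on {a..b}) (\<lambda>t. (LINT x|torus. A (t, x)) $ j)"
    by (rule integrable_bounded_linear[OF bounded_linear_vec_nth iA])
  show cB: "integrable (lebesgue_on {a..b}) (\<lambda>t. (LINT x|torus. B (t, x)) $ j)"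
    by (rule integrable_bounded_linear[OF bounded_linear_vec_nth iB])
  fix \<psi> \<psi>' :: "real \<Rightarrow> real"
  assume \<psi>: "smooth \<psi>" "\<And>t. (\<psi> has_real_derivative \<psi>' t) (at t)" "\<And>t. t \<notin> {a<..<b} \<Longrightarrow> \<psi> t = 0"
  have s': "smooth \<psi>'" by (rule smooth_derivative[OF \<psi>(1,2)])
  have \<psi>'0: "\<psi>' t = 0" if "t \<notin> {a..b}" for t
    by (rule derivative_zero_outside[OF \<psi>(2,3) that])
  define F where "F z = \<psi>' (fst z) *\<^sub>R A z + \<psi> (fst z) *\<^sub>R B z" for z
  have c: "continuous_on UNIV (\<lambda>z::real \<times> (real^3). \<psi> (fst z))" "continuous_on UNIV (\<lambda>z::real \<times> (real^3). \<psi>' (fst z))"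
    by (rule smooth_continuous[OF smooth_fst[OF \<psi>(1)]], rule smooth_continuous[OF smooth_fst[OF s']])
  have iS: "integrable (lebesgue_on {a..b}) (\<lambda>t. \<psi>' t *\<^sub>R (LINT x|torus. A (t, x)) + \<psi> t *\<^sub>R (LINT x|torus. B (t, x)))"
    by (rule Bochner_Integration.integrable_add[OF integrable_mult_continuous[OF iA compact_Icc smooth_continuous[OF s']]
        integrable_mult_continuous[OF iB compact_Icc smooth_continuous[OF \<psi>(1)]]])
  have iF: "integrable (lebesgue_on ({a..b} \<times> torus_cell)) F"
    unfolding F_def[abs_def]
    by (rule Bochner_Integration.integrable_add[OF integrable_mult_continuous[OF A compact_slab c(2)]
        integrable_mult_continuous[OF B compact_slab c(1)]])
  have "spacetime_integral T F = spacetime_integral T (\<lambda>(t, x). \<psi>' t *\<^sub>R A (t, x) + \<psi> t *\<^sub>R B (t, x))"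
    by (rule arg_cong[where f = "spacetime_integral T"]) (auto simp: F_def)
  also have "\<dots> = 0" by (rule weak[OF \<psi>])
  finally have sF: "spacetime_integral T F = 0" .
  have "spacetime_integral T F = (LINT t|lebesgue_on {a..b}. LINT x|torus. F (t, x))"
  proof (rule spacetime_integral_slices[OF iF ab(1,3)])
    fix t x assume t: "t \<notin> {a..b}"
    then have "\<psi> t = 0" by (intro \<psi>(3)) auto
    then show "F (t, x) = 0" using \<psi>'0[OF t] by (simp add: F_def)
  qed
  with sF have "(LINT t|lebesgue_on {a..b}. LINT x|torus. F (t, x)) = 0" by (simp only:)
  also have "(LINT t|lebesgue_on {a..b}. LINT x|torus. F (t, x))
     = (LINT t|lebesgue_on {a..b}. \<psi>' t *\<^sub>R (LINT x|torus. A (t, x)) + \<psi> t *\<^sub>R (LINT x|torus. B (t, x)))"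
  proof (rule integral_cong_AE)
    have "AE t in lebesgue_on {a..b}. integrable torus (\<lambda>x. A (t, x))" "AE t in lebesgue_on {a..b}. integrable torus (\<lambda>x. B (t, x))"
      by (rule fA(1), simp_all, rule fB(1), simp_all)
    then show "AE t in lebesgue_on {a..b}. (LINT x|torus. F (t, x)) = \<psi>' t *\<^sub>R (LINT x|torus. A (t, x)) + \<psi> t *\<^sub>R (LINT x|torus. B (t, x))"
      by eventually_elim (simp add: F_def)
    show "(\<lambda>t. LINT x|torus. F (t, x)) \<in> borel_measurable (lebesgue_on {a..b})"
      by (rule borel_measurable_integrable[OF Fubini_lebesgue_on(2)[OF iF]]) simp_all
    show "(\<lambda>t. \<psi>' t *\<^sub>R (LINT x|torus. A (t, x)) + \<psi> t *\<^sub>R (LINT x|torus. B (t, x))) \<in> borel_measurable (lebesgue_on {a..b})"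
      using iS by (rule borel_measurable_integrable)
  qed
  finally have "(LINT t|lebesgue_on {a..b}. \<psi>' t *\<^sub>R (LINT x|torus. A (t, x)) + \<psi> t *\<^sub>R (LINT x|torus. B (t, x))) $ j = 0" by simp
  moreover have "(LINT t|lebesgue_on {a..b}. \<psi>' t *\<^sub>R (LINT x|torus. A (t, x)) + \<psi> t *\<^sub>R (LINT x|torus. B (t, x))) $ j
     = (LINT t|lebesgue_on {a..b}. (\<psi>' t *\<^sub>R (LINT x|torus. A (t, x)) + \<psi> t *\<^sub>R (LINT x|torus. B (t, x))) $ j)"
    by (rule integral_bounded_linear[OF bounded_linear_vec_nth iS, symmetric])
  ultimately show "(LINT t|lebesgue_on {a..b}. \<psi>' t * (LINT x|torus. A (t, x)) $ j + \<psi> t * (LINT x|torus. B (t, x)) $ j) = 0"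
    by simp
qed

text \<open>The same lemma with right-hand side 0 shows that the slice integral is a constant, since
  derivatives of test functions are themselves test functions. Testing with a bump of nonzero
  integral makes the constant 0.\<close>

lemma weak_zero_slices:
  fixes B :: "real \<times> (real^3) \<Rightarrow> real"
  assumes ab: "0 < a" "a < b" "b < T"
    and B: "integrable (lebesgue_on ({a..b} \<times> torus_cell)) B"
    and weak: "\<And>\<psi>. smooth \<psi> \<Longrightarrow> (\<And>t. t \<notin> {a<..<b} \<Longrightarrow> \<psi> t = 0) \<Longrightarrow>
      spacetime_integral T (\<lambda>(t, x). \<psi> t * B (t, x)) = 0"
  shows "AE t in lebesgue_on {a..b}. (LINT x|torus. B (t, x)) = 0"
proof -
  have iB: "integrable (lebesgue_on {a..b}) (\<lambda>t. LINT x|torus. B (t, x))"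
    by (rule Fubini_lebesgue_on(2)[OF B]) auto
  have z: "(LINT t|lebesgue_on {a..b}. \<psi> t * (LINT x|torus. B (t, x))) = 0"
    if \<psi>: "smooth \<psi>" "\<And>t. t \<notin> {a<..<b} \<Longrightarrow> \<psi> t = 0" for \<psi>
  proof -
    have c: "continuous_on UNIV (\<lambda>z::real \<times> (real^3). \<psi> (fst z))" by (rule smooth_continuous[OF smooth_fst[OF \<psi>(1)]])
    have iF: "integrable (lebesgue_on ({a..b} \<times> torus_cell)) (\<lambda>(t, x). \<psi> t * B (t, x))"
    proof -
      have "(\<lambda>(t, x). \<psi> t * B (t, x)) = (\<lambda>z. \<psi> (fst z) *\<^sub>R B z)" by auto
      then show ?thesis using integrable_mult_continuous[OF B compact_slab c] by (simp only:)
    qed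
    have "0 = spacetime_integral T (\<lambda>(t, x). \<psi> t * B (t, x))" using weak[OF \<psi>] by simp
    also have "\<dots> = (LINT t|lebesgue_on {a..b}. LINT x|torus. \<psi> t * B (t, x))"
    proof -
      have "\<psi> t = 0" if "t \<notin> {a..b}" for t using that by (intro \<psi>(2)) auto
      then show ?thesis using spacetime_integral_slices[OF iF ab(1,3)] by simp
    qed
    finally show ?thesis by simp
  qed
  have "\<exists>c. AE t in lebesgue_on {a..b}. (LINT x|torus. B (t, x)) = c + integral\<^sup>L (lebesgue_on {a..t}) (\<lambda>t. 0)"
  proof (rule du_bois_reymond[OF ab(2) iB])
    fix \<psi> \<psi>' :: "real \<Rightarrow> real"
    assume \<psi>: "smooth \<psi>" "\<And>t. (\<psi> has_real_derivative \<psi>' t) (at t)" "\<And>t. t \<notin> {a<..<b} \<Longrightarrow> \<psi> t = 0"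
    have s': "smooth \<psi>'" by (rule smooth_derivative[OF \<psi>(1,2)])
    have out: "\<psi>' t = 0" if "t \<notin> {a..b}" for t
      by (rule derivative_zero_outside[OF \<psi>(2,3) that])
    \<comment> \<open>At the end points the derivative vanishes by continuity, as required of a test
      function on the open interval.\<close>
    have "closure (- {a..b}) = - {a<..<b}" using ab(2) by (simp add: closure_complement)
    then have "\<psi>' t = 0" if "t \<notin> {a<..<b}" for t
      using continuous_constant_on_closure[of "- {a..b}" \<psi>' 0 t] smooth_continuous[OF s'] out that by auto
    from z[OF s' this] show "(LINT t|lebesgue_on {a..b}. \<psi>' t * (LINT x|torus. B (t, x)) + \<psi> t * 0) = 0" by simp
  qed simp
  then obtain c where c: "AE t in lebesgue_on {a..b}. (LINT x|torus. B (t, x)) = c" by auto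
  have "0 = (LINT t|lebesgue_on {a..b}. bump a b 1 t * (LINT x|torus. B (t, x)))"
    using z[OF smooth_bump[of a b 1]] bump_outside[of _ a b 1] by simp
  also have "\<dots> = (LINT t|lebesgue_on {a..b}. bump a b 1 t * c)"
  proof (rule integral_cong_AE)
    have bi: "integrable (lebesgue_on {a..b}) (bump a b 1)"
      unfolding cbox_interval[symmetric] by (rule integrable_lebesgue_on_continuous[OF smooth_continuous[OF smooth_bump]])
    then show "(\<lambda>t. bump a b 1 t * (LINT x|torus. B (t, x))) \<in> borel_measurable (lebesgue_on {a..b})"
      "(\<lambda>t. bump a b 1 t * c) \<in> borel_measurable (lebesgue_on {a..b})"
      using iB by (auto intro!: borel_measurable_times)
    show "AE t in lebesgue_on {a..b}. bump a b 1 t * (LINT x|torus. B (t, x)) = bump a b 1 t * c"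
      using c by eventually_elim simp
  qed
  also have "\<dots> = integral\<^sup>L (lebesgue_on {a..b}) (bump a b 1) * c" by simp
  finally have "c = 0" using bump_integral_nonzero[OF ab(2)] by simp
  then show ?thesis using c by simp
qed

text \<open>Multiply out (c + A)(d + B): the mixed terms are primitives of c G and d F, and
  integration by parts exhibits A B as a primitive of F B + G A.\<close>

lemma product_of_primitives:
  fixes V W F G :: "real \<Rightarrow> real"
  assumes F: "integrable (lebesgue_on {a..b}) F" and G: "integrable (lebesgue_on {a..b}) G"
    and V: "AE t in lebesgue_on {a..b}. V t = c + integral\<^sup>L (lebesgue_on {a..t}) F"
    and W: "AE t in lebesgue_on {a..b}. W t = d + integral\<^sup>L (lebesgue_on {a..t}) G"
  shows "integrable (lebesgue_on {a..b}) (\<lambda>t. F t * W t + V t * G t)"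
    and "AE t in lebesgue_on {a..b}. V t * W t = c * d + (LINT s|lebesgue_on {a..t}. F s * W s + V s * G s)"
proof -
  define A where "A t = integral\<^sup>L (lebesgue_on {a..t}) F" for t
  define B where "B t = integral\<^sup>L (lebesgue_on {a..t}) G" for t
  define P where "P t = c * G t + d * F t + (F t * B t + G t * A t)" for t
  have iFB: "integrable (lebesgue_on {a..b}) (\<lambda>t. F t * B t)" "integrable (lebesgue_on {a..b}) (\<lambda>t. G t * A t)"
    unfolding A_def B_def by (intro integrable_mult_indefinite_integral F G)+
  have iP: "integrable (lebesgue_on {a..b}) P" unfolding P_def using iFB F G by simp
  have eq: "AE t in lebesgue_on {a..b}. F t * W t + V t * G t = P t"
    using V W by eventually_elim (simp add: P_def A_def B_def algebra_simps)
  \<comment> \<open>V and W are determined only almost everywhere, so their measurability comes from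
    that of the primitives and the completeness of the measure.\<close>
  have mV: "V \<in> borel_measurable (lebesgue_on {a..b})" "W \<in> borel_measurable (lebesgue_on {a..b})"
  proof -
    have *: "f \<in> borel_measurable (lebesgue_on {a..b})"
      if "g \<in> borel_measurable (lebesgue_on {a..b})" "AE t in lebesgue_on {a..b}. f t = g t" for f g :: "real \<Rightarrow> real"
    proof -
      have "(\<lambda>t. if t \<in> {a..b} then g t else 0) \<in> borel_measurable lebesgue"
        using that(1) by (subst borel_measurable_if) auto
      moreover have "AE t in lebesgue. (if t \<in> {a..b} then f t else 0) = (if t \<in> {a..b} then g t else 0)"
        using that(2) by (simp add: AE_restrict_space_iff)
      ultimately have "(\<lambda>t. if t \<in> {a..b} then f t else 0) \<in> borel_measurable lebesgue"
        by (rule borel_measurable_lebesgue_AE)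
      then show ?thesis by (rule borel_measurable_if_D)
    qed
    show "V \<in> borel_measurable (lebesgue_on {a..b})"
      by (rule *[OF _ V]) (intro borel_measurable_add integrable_indefinite_integral(1)[OF F], simp)
    show "W \<in> borel_measurable (lebesgue_on {a..b})"
      by (rule *[OF _ W]) (intro borel_measurable_add integrable_indefinite_integral(1)[OF G], simp)
  qed
  have meas: "(\<lambda>t. F t * W t + V t * G t) \<in> borel_measurable (lebesgue_on {a..b})"
    using F G mV by (intro borel_measurable_add borel_measurable_times) auto
  show int: "integrable (lebesgue_on {a..b}) (\<lambda>t. F t * W t + V t * G t)"
    using integrable_cong_AE[OF meas _ eq] iP by auto
  have AE_ab: "AE t in lebesgue_on {a..b}. t \<in> {a..b}" by (metis AE_space space_lebesgue_on)
  show "AE t in lebesgue_on {a..b}. V t * W t = c * d + (LINT s|lebesgue_on {a..t}. F s * W s + V s * G s)"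
    using V W AE_ab
  proof eventually_elim
    case (elim t)
    have sub: "{a..t} \<subseteq> {a..b}" using elim(3) by auto
    have iFt: "integrable (lebesgue_on {a..t}) F" and iGt: "integrable (lebesgue_on {a..t}) G"
      and iFBt: "integrable (lebesgue_on {a..t}) (\<lambda>t. F t * B t)" "integrable (lebesgue_on {a..t}) (\<lambda>t. G t * A t)"
      using F G iFB by (auto intro: integrable_lebesgue_on_subset[OF _ sub])
    have eqt: "AE s in lebesgue_on {a..t}. F s * W s + V s * G s = P s"
      using eq sub by (simp add: AE_restrict_space_iff) (auto elim!: AE_mp)
    have "(LINT s|lebesgue_on {a..t}. F s * W s + V s * G s) = integral\<^sup>L (lebesgue_on {a..t}) P"
      using integrable_lebesgue_on_subset[OF int sub] integrable_lebesgue_on_subset[OF iP sub]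
      by (intro integral_cong_AE eqt) auto
    also have "\<dots> = c * B t + d * A t + (LINT s|lebesgue_on {a..t}. F s * B s + G s * A s)"
      unfolding P_def using iFt iGt iFBt by (simp add: A_def B_def)
    also have "(LINT s|lebesgue_on {a..t}. F s * B s + G s * A s) = A t * B t"
      unfolding A_def B_def by (rule integral_by_parts_indefinite[OF iFt iGt])
    finally show ?case using elim by (simp add: A_def B_def algebra_simps)
  qed
qed

subsection \<open>Balance of the mollified helicity\<close>

lemma product_test_function:
  fixes \<psi> :: "real \<Rightarrow> real"
  assumes \<psi>: "smooth \<psi>" "\<And>t. (\<psi> has_real_derivative \<psi>' t) (at t)" "\<forall>t. t \<notin> {\<alpha><..<\<beta>} \<longrightarrow> \<psi> t = 0"
    and ab: "0 < \<alpha>" "\<beta> < T" and a: "smooth_periodic a"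
  defines "\<phi> \<equiv> \<lambda>z. \<psi> (fst z) * a (snd z)"
  shows "test_function T \<phi>" "dt \<phi> (t, x) = \<psi>' t * a x" "grad \<phi> (t, x) = \<psi> t *\<^sub>R space_grad a x"
proof -
  have sa: "smooth a" and pa: "torus_periodic a" using a by (auto simp: smooth_periodic_def)
  have "smooth \<phi>" unfolding \<phi>_def by (rule smooth_mult[OF smooth_fst[OF \<psi>(1)] smooth_snd[OF sa]])
  moreover have "torus_periodic (\<lambda>x. \<phi> (t, x))" for t using pa by (simp add: torus_periodic_def \<phi>_def)
  moreover have "\<phi> (t, x) = 0" if "t \<notin> {\<alpha>..\<beta>}" for t x
  proof -
    have "\<psi> t = 0" using that \<psi>(3) by auto
    then show ?thesis by (simp add: \<phi>_def)
  qed
  ultimately show "test_function T \<phi>" unfolding test_function_def using ab by blast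
  have d1: "((\<lambda>z::real \<times> (real^3). \<psi> (fst z)) has_derivative (\<lambda>h. \<psi>' t * fst h)) (at (t, x))"
  proof (rule has_derivative_compose[of fst fst])
    show "(\<psi> has_derivative (*) (\<psi>' t)) (at (fst (t, x)))"
      using \<psi>(2)[of t] by (simp add: has_field_derivative_def)
  qed (auto intro!: derivative_eq_intros)
  have d2: "((\<lambda>z::real \<times> (real^3). a (snd z)) has_derivative (\<lambda>h. space_grad a x \<bullet> snd h)) (at (t, x))"
  proof (rule has_derivative_compose[of snd snd])
    show "(a has_derivative (\<bullet>) (space_grad a x)) (at (snd (t, x)))"
      using space_grad_has_derivative[OF sa, of x] by simp
  qed (auto intro!: derivative_eq_intros)
  have "(\<phi> has_derivative (\<lambda>h. \<psi> t * (space_grad a x \<bullet> snd h) + \<psi>' t * fst h * a x)) (at (t, x))"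
    unfolding \<phi>_def using has_derivative_mult[OF d1 d2] by simp
  note fd = frechet_derivative_eq[OF this]
  show "dt \<phi> (t, x) = \<psi>' t * a x" by (simp add: dt_def fd)
  show "grad \<phi> (t, x) = \<psi> t *\<^sub>R space_grad a x"
    by (simp add: grad_def fd vec_eq_iff inner_axis)
qed

lemma space_component_continuous:
  assumes "smooth_periodic a"
  shows "continuous_on UNIV (\<lambda>z::real \<times> (real^3). a (snd z))"
    "continuous_on UNIV (\<lambda>z::real \<times> (real^3). space_grad a (snd z) $ i)"
proof -
  have s: "smooth a" using assms by (simp add: smooth_periodic_def)
  show "continuous_on UNIV (\<lambda>z::real \<times> (real^3). a (snd z))"
    by (rule smooth_continuous[OF smooth_snd[OF s]])
  have "continuous_on UNIV (\<lambda>z::real \<times> (real^3). space_grad a (snd z))"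
    by (rule continuous_on_compose2[OF space_grad_continuous[OF s, of UNIV]]) (auto intro: continuous_intros)
  then show "continuous_on UNIV (\<lambda>z::real \<times> (real^3). space_grad a (snd z) $ i)"
    by (rule continuous_on_component)
qed

lemma locally_integrable_slab:
  assumes "locally_integrable T f" "0 < \<alpha>" "\<beta> < T"
  shows "integrable (lebesgue_on ({\<alpha>..\<beta>} \<times> torus_cell)) (\<lambda>z. f (fst z) (snd z))"
proof -
  have "integrable (lebesgue_on ({\<alpha>..\<beta>} \<times> torus_cell)) (\<lambda>(t, x). f t x)"
    using assms unfolding locally_integrable_def by blast
  then show ?thesis by (simp only: case_prod_beta')
qed

lemma momentum_slices:
  assumes ab: "0 < \<alpha>" "\<alpha> < \<beta>" "\<beta> < T" and a: "smooth_periodic a"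
    and v: "locally_integrable T v" and vv: "\<And>i j. locally_integrable T (\<lambda>t x. v t x $ i * v t x $ j)"
    and \<pi>: "locally_integrable T \<pi>" and weak: "weak_momentum T v \<pi>"
  shows "integrable (lebesgue_on {\<alpha>..\<beta>}) (\<lambda>t. LINT x|torus. (v t x \<bullet> space_grad a x) *\<^sub>R v t x + \<pi> t x *\<^sub>R space_grad a x)"
    and "\<exists>c. AE t in lebesgue_on {\<alpha>..\<beta>}. (LINT x|torus. a x *\<^sub>R v t x) $ j
     = c + (LINT s|lebesgue_on {\<alpha>..t}. (LINT x|torus. (v s x \<bullet> space_grad a x) *\<^sub>R v s x + \<pi> s x *\<^sub>R space_grad a x) $ j)"
proof -
  define A where "A z = a (snd z) *\<^sub>R v (fst z) (snd z)" for z
  define B where "B z = (v (fst z) (snd z) \<bullet> space_grad a (snd z)) *\<^sub>R v (fst z) (snd z) + \<pi> (fst z) (snd z) *\<^sub>R space_grad a (snd z)" for z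
  note li = locally_integrable_slab[OF _ ab(1,3)]
  note mc = integrable_mult_continuous[OF _ compact_slab]
  have iA: "integrable (lebesgue_on ({\<alpha>..\<beta>} \<times> torus_cell)) A"
    unfolding A_def[abs_def] by (rule mc[OF li[OF v] space_component_continuous(1)[OF a]])
  have iB: "integrable (lebesgue_on ({\<alpha>..\<beta>} \<times> torus_cell)) B"
  proof (rule integrable_vec_componentwise)
    fix j
    \<comment> \<open>Integrability is known for the products v_i v_j and for the pressure, so each
      component is written as their combination with continuous coefficients.\<close>
    have "B z $ j = (\<Sum>i\<in>UNIV. space_grad a (snd z) $ i *\<^sub>R (v (fst z) (snd z) $ i * v (fst z) (snd z) $ j))
        + space_grad a (snd z) $ j *\<^sub>R \<pi> (fst z) (snd z)" for z
      by (simp add: B_def inner_vec_def sum_distrib_left sum_distrib_right mult_ac)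
    then show "integrable (lebesgue_on ({\<alpha>..\<beta>} \<times> torus_cell)) (\<lambda>z. B z $ j)"
      using mc[OF li[OF vv] space_component_continuous(2)[OF a]] mc[OF li[OF \<pi>] space_component_continuous(2)[OF a]]
      by (simp only: Bochner_Integration.integrable_add Bochner_Integration.integrable_sum)
  qed
  show "integrable (lebesgue_on {\<alpha>..\<beta>}) (\<lambda>t. LINT x|torus. (v t x \<bullet> space_grad a x) *\<^sub>R v t x + \<pi> t x *\<^sub>R space_grad a x)"
    using Fubini_lebesgue_on(2)[OF iB] by (simp add: B_def)
  have "\<exists>c. AE t in lebesgue_on {\<alpha>..\<beta>}. (LINT x|torus. A (t, x)) $ j
     = c + (LINT s|lebesgue_on {\<alpha>..t}. (LINT x|torus. B (s, x)) $ j)"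
  proof (rule weak_derivative_slices[OF ab iA iB])
    fix \<psi> \<psi>' :: "real \<Rightarrow> real"
    assume \<psi>: "smooth \<psi>" "\<And>t. (\<psi> has_real_derivative \<psi>' t) (at t)" "\<And>t. t \<notin> {\<alpha><..<\<beta>} \<Longrightarrow> \<psi> t = 0"
    have out: "\<forall>t. t \<notin> {\<alpha><..<\<beta>} \<longrightarrow> \<psi> t = 0" using \<psi>(3) by blast
    note tf = product_test_function[OF \<psi>(1,2) out ab(1,3) a]
    have "0 = spacetime_integral T (\<lambda>(t, x). (\<psi>' t * a x) *\<^sub>R v t x + (v t x \<bullet> (\<psi> t *\<^sub>R space_grad a x)) *\<^sub>R v t x
       + \<pi> t x *\<^sub>R (\<psi> t *\<^sub>R space_grad a x))"
      using weak[unfolded weak_momentum_def, rule_format, OF tf(1)] by (simp only: tf(2,3))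
    also have "\<dots> = spacetime_integral T (\<lambda>(t, x). \<psi>' t *\<^sub>R A (t, x) + \<psi> t *\<^sub>R B (t, x))"
      by (rule arg_cong[where f = "spacetime_integral T"]) (auto simp: A_def B_def algebra_simps)
    finally show "spacetime_integral T (\<lambda>(t, x). \<psi>' t *\<^sub>R A (t, x) + \<psi> t *\<^sub>R B (t, x)) = 0" by simp
  qed
  then show "\<exists>c. AE t in lebesgue_on {\<alpha>..\<beta>}. (LINT x|torus. a x *\<^sub>R v t x) $ j
     = c + (LINT s|lebesgue_on {\<alpha>..t}. (LINT x|torus. (v s x \<bullet> space_grad a x) *\<^sub>R v s x + \<pi> s x *\<^sub>R space_grad a x) $ j)"
    by (simp only: A_def B_def fst_conv snd_conv)
qed

lemma vorticity_slices:
  assumes ab: "0 < \<alpha>" "\<alpha> < \<beta>" "\<beta> < T" and b: "smooth_periodic b"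
    and w: "locally_integrable T w" and vw: "\<And>i j. locally_integrable T (\<lambda>t x. v t x $ i * w t x $ j)"
    and weak: "weak_vorticity T v w"
  shows "integrable (lebesgue_on {\<alpha>..\<beta>}) (\<lambda>t. LINT x|torus. (v t x \<bullet> space_grad b x) *\<^sub>R w t x - (w t x \<bullet> space_grad b x) *\<^sub>R v t x)"
    and "\<exists>c. AE t in lebesgue_on {\<alpha>..\<beta>}. (LINT x|torus. b x *\<^sub>R w t x) $ j
     = c + (LINT s|lebesgue_on {\<alpha>..t}. (LINT x|torus. (v s x \<bullet> space_grad b x) *\<^sub>R w s x - (w s x \<bullet> space_grad b x) *\<^sub>R v s x) $ j)"
proof -
  define A where "A z = b (snd z) *\<^sub>R w (fst z) (snd z)" for z
  define B where "B z = (v (fst z) (snd z) \<bullet> space_grad b (snd z)) *\<^sub>R w (fst z) (snd z) - (w (fst z) (snd z) \<bullet> space_grad b (snd z)) *\<^sub>R v (fst z) (snd z)" for z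
  note li = locally_integrable_slab[OF _ ab(1,3)]
  note mc = integrable_mult_continuous[OF _ compact_slab]
  have iA: "integrable (lebesgue_on ({\<alpha>..\<beta>} \<times> torus_cell)) A"
    unfolding A_def[abs_def] by (rule mc[OF li[OF w] space_component_continuous(1)[OF b]])
  have iB: "integrable (lebesgue_on ({\<alpha>..\<beta>} \<times> torus_cell)) B"
  proof (rule integrable_vec_componentwise)
    fix j
    have "B z $ j = (\<Sum>i\<in>UNIV. space_grad b (snd z) $ i *\<^sub>R (v (fst z) (snd z) $ i * w (fst z) (snd z) $ j))
        - (\<Sum>i\<in>UNIV. space_grad b (snd z) $ i *\<^sub>R (v (fst z) (snd z) $ j * w (fst z) (snd z) $ i))" for z
      by (simp add: B_def inner_vec_def sum_distrib_left sum_distrib_right mult_ac)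
    then show "integrable (lebesgue_on ({\<alpha>..\<beta>} \<times> torus_cell)) (\<lambda>z. B z $ j)"
      using mc[OF li[OF vw] space_component_continuous(2)[OF b]]
      by (simp only: Bochner_Integration.integrable_diff Bochner_Integration.integrable_sum)
  qed
  show "integrable (lebesgue_on {\<alpha>..\<beta>}) (\<lambda>t. LINT x|torus. (v t x \<bullet> space_grad b x) *\<^sub>R w t x - (w t x \<bullet> space_grad b x) *\<^sub>R v t x)"
    using Fubini_lebesgue_on(2)[OF iB] by (simp add: B_def)
  have "\<exists>c. AE t in lebesgue_on {\<alpha>..\<beta>}. (LINT x|torus. A (t, x)) $ j
     = c + (LINT s|lebesgue_on {\<alpha>..t}. (LINT x|torus. B (s, x)) $ j)"
  proof (rule weak_derivative_slices[OF ab iA iB])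
    fix \<psi> \<psi>' :: "real \<Rightarrow> real"
    assume \<psi>: "smooth \<psi>" "\<And>t. (\<psi> has_real_derivative \<psi>' t) (at t)" "\<And>t. t \<notin> {\<alpha><..<\<beta>} \<Longrightarrow> \<psi> t = 0"
    have out: "\<forall>t. t \<notin> {\<alpha><..<\<beta>} \<longrightarrow> \<psi> t = 0" using \<psi>(3) by blast
    note tf = product_test_function[OF \<psi>(1,2) out ab(1,3) b]
    have "0 = spacetime_integral T (\<lambda>(t, x). (\<psi>' t * b x) *\<^sub>R w t x + (v t x \<bullet> (\<psi> t *\<^sub>R space_grad b x)) *\<^sub>R w t x
       - (w t x \<bullet> (\<psi> t *\<^sub>R space_grad b x)) *\<^sub>R v t x)"
      using weak[unfolded weak_vorticity_def, rule_format, OF tf(1)] by (simp only: tf(2,3))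
    also have "\<dots> = spacetime_integral T (\<lambda>(t, x). \<psi>' t *\<^sub>R A (t, x) + \<psi> t *\<^sub>R B (t, x))"
      by (rule arg_cong[where f = "spacetime_integral T"]) (auto simp: A_def B_def algebra_simps)
    finally show "spacetime_integral T (\<lambda>(t, x). \<psi>' t *\<^sub>R A (t, x) + \<psi> t *\<^sub>R B (t, x)) = 0" by simp
  qed
  then show "\<exists>c. AE t in lebesgue_on {\<alpha>..\<beta>}. (LINT x|torus. b x *\<^sub>R w t x) $ j
     = c + (LINT s|lebesgue_on {\<alpha>..t}. (LINT x|torus. (v s x \<bullet> space_grad b x) *\<^sub>R w s x - (w s x \<bullet> space_grad b x) *\<^sub>R v s x) $ j)"
    by (simp only: A_def B_def fst_conv snd_conv)
qed

text \<open>The exceptional times depend on b. A single kernel involves only finitely many b, so a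
  common null set of times remains.\<close>

lemma div_free_slices:
  assumes ab: "0 < \<alpha>" "\<alpha> < \<beta>" "\<beta> < T" and b: "smooth_periodic b"
    and w: "locally_integrable T w" and weak: "weak_div_free T w"
  shows "AE t in lebesgue_on {\<alpha>..\<beta>}. (LINT x|torus. w t x \<bullet> space_grad b x) = 0"
proof -
  define B where "B z = w (fst z) (snd z) \<bullet> space_grad b (snd z)" for z
  have "B = (\<lambda>z. \<Sum>i\<in>UNIV. space_grad b (snd z) $ i *\<^sub>R (w (fst z) (snd z) $ i))"
    by (simp add: B_def[abs_def] inner_vec_def mult_ac)
  moreover have "integrable (lebesgue_on ({\<alpha>..\<beta>} \<times> torus_cell)) (\<lambda>z. space_grad b (snd z) $ i *\<^sub>R (w (fst z) (snd z) $ i))" for i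
    by (rule integrable_mult_continuous[OF integrable_bounded_linear[OF bounded_linear_vec_nth locally_integrable_slab[OF w ab(1,3)]]
       compact_slab space_component_continuous(2)[OF b]])
  ultimately have iB: "integrable (lebesgue_on ({\<alpha>..\<beta>} \<times> torus_cell)) B"
    by (simp only: Bochner_Integration.integrable_sum)
  have "AE t in lebesgue_on {\<alpha>..\<beta>}. (LINT x|torus. B (t, x)) = 0"
  proof (rule weak_zero_slices[OF ab iB])
    fix \<psi> :: "real \<Rightarrow> real"
    assume \<psi>: "smooth \<psi>" "\<And>t. t \<notin> {\<alpha><..<\<beta>} \<Longrightarrow> \<psi> t = 0"
    obtain \<psi>' where d: "\<And>t. (\<psi> has_real_derivative \<psi>' t) (at t)" using smooth_real_has_derivative[OF \<psi>(1)] by blast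
    have out: "\<forall>t. t \<notin> {\<alpha><..<\<beta>} \<longrightarrow> \<psi> t = 0" using \<psi>(2) by blast
    note tf = product_test_function[OF \<psi>(1) d out ab(1,3) b]
    have "0 = spacetime_integral T (\<lambda>(t, x). w t x \<bullet> (\<psi> t *\<^sub>R space_grad b x))"
      using weak[unfolded weak_div_free_def, rule_format, OF tf(1)] by (simp only: tf(3))
    also have "\<dots> = spacetime_integral T (\<lambda>(t, x). \<psi> t * B (t, x))"
      by (rule arg_cong[where f = "spacetime_integral T"]) (auto simp: B_def)
    finally show "spacetime_integral T (\<lambda>(t, x). \<psi> t * B (t, x)) = 0" by simp
  qed
  then show ?thesis by (simp only: B_def fst_conv snd_conv)
qed

section \<open>Recombining the spatial moments into the flux\<close>

lemma integrable_torus_norm_bound: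
  fixes F :: "real^3 \<Rightarrow> 'b::{banach, second_countable_topology}" and g :: "real^3 \<Rightarrow> 'c::real_normed_vector"
  assumes f: "integrable torus f" and g: "continuous_on UNIV g" and F: "F \<in> borel_measurable torus"
    and le: "\<And>x. norm (F x) \<le> norm (g x) * (f x :: real)" and f0: "\<And>x. 0 \<le> f x"
  shows "integrable torus F"
proof -
  have "compact (g ` torus_cell)"
    unfolding torus_cell_def by (intro compact_continuous_image continuous_on_subset[OF g]) auto
  then obtain B where B: "\<And>x. x \<in> torus_cell \<Longrightarrow> norm (g x) \<le> B"
    by (metis bounded_iff compact_imp_bounded image_eqI)
  show ?thesis
  proof (rule Bochner_Integration.integrable_bound[of torus "\<lambda>x. B * f x"])
    show "AE x in torus. norm (F x) \<le> norm (B * f x)"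
    proof (rule AE_I2)
      fix x assume "x \<in> space torus"
      then have "norm (g x) * f x \<le> B * f x" using B f0 by (intro mult_right_mono) auto
      then show "norm (F x) \<le> norm (B * f x)" using le[of x] by simp
    qed
  qed (use f F in auto)
qed

text \<open>A product of two moments is a double integral, and the sum over k restores the kernel
  under the integral sign. A gradient on a becomes \<open>gker\<close> by \<open>gker_left\<close>,
  a gradient on b its negative by \<open>gker_right\<close>.\<close>

lemma (in ker_expansion) flux_expansion:
  fixes \<pi> :: "real^3 \<Rightarrow> real"
  assumes tf: "torus_fields v w" and dv: "\<And>k. k < n \<Longrightarrow> (LINT x|torus. v x \<bullet> space_grad (b k) x) = 0"
    and dw: "\<And>k. k < n \<Longrightarrow> (LINT x|torus. w x \<bullet> space_grad (b k) x) = 0" and \<pi>: "integrable torus \<pi>"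
  shows "torus_flux v w (gker N)"
    and "(\<Sum>k<n. (LINT x|torus. (v x \<bullet> space_grad (a k) x) *\<^sub>R v x + \<pi> x *\<^sub>R space_grad (a k) x) \<bullet> (LINT x|torus. b k x *\<^sub>R w x)
      + (LINT x|torus. a k x *\<^sub>R v x) \<bullet> (LINT x|torus. (v x \<bullet> space_grad (b k) x) *\<^sub>R w x - (w x \<bullet> space_grad (b k) x) *\<^sub>R v x))
      = torus_flux.flux v w (gker N)"
    and "(\<Sum>k<n. (LINT x|torus. a k x *\<^sub>R v x) \<bullet> (LINT x|torus. b k x *\<^sub>R w x))
      = integral\<^sup>L torus2 (\<lambda>(x, y). ker N (x - y) * (v x \<bullet> w y))"
proof -
  interpret torus_fields v w by (rule tf)
  have sa: "smooth (a k)" and sb: "smooth (b k)" if "k < n" for k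
    using a b that by (auto simp: smooth_periodic_def)
  have bm: "f \<in> borel_measurable torus" if "continuous_on UNIV f" for f :: "real^3 \<Rightarrow> 'z::{banach, second_countable_topology}"
    using integrable_torus_continuous[OF that] by auto
  have ma: "a k \<in> borel_measurable torus" "b k \<in> borel_measurable torus" if "k < n" for k
    using sa sb that by (auto intro!: bm smooth_continuous)
  have mg: "space_grad (a k) \<in> borel_measurable torus" "space_grad (b k) \<in> borel_measurable torus" if "k < n" for k
    using sa sb that by (auto intro!: bm space_grad_continuous)
  have mv: "v \<in> borel_measurable torus" "w \<in> borel_measurable torus" "\<pi> \<in> borel_measurable torus" using v w \<pi> by auto
  have ibd: "integrable torus (\<lambda>x. u x \<bullet> space_grad (b k) x)"
    if "k < n" "integrable torus (\<lambda>x. norm (u x))" "u \<in> borel_measurable torus" for u k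
    by (rule integrable_torus_norm_bound[OF that(2) space_grad_continuous[OF sb[OF that(1)]]])
       (use that mg in \<open>auto simp: mult.commute[of "norm (space_grad _ _)"] Cauchy_Schwarz_ineq2\<close>)
  \<comment> \<open>Orthogonality to the finitely many gradients of the b k yields the divergence
    condition for every translate of the kernel at once, as x enters only through the coefficients a
    k x.\<close>
  have div: "(LINT y|torus. u y \<bullet> gker N (x - y)) = 0"
    if "integrable torus (\<lambda>x. norm (u x))" "u \<in> borel_measurable torus" "\<And>k. k < n \<Longrightarrow> (LINT x|torus. u x \<bullet> space_grad (b k) x) = 0" for u x
  proof -
    have "(LINT y|torus. u y \<bullet> gker N (x - y)) = (LINT y|torus. - (\<Sum>k<n. a k x * (u y \<bullet> space_grad (b k) y)))"
      by (rule Bochner_Integration.integral_cong) (simp_all add: gker_right inner_sum_right)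
    also have "\<dots> = - (\<Sum>k<n. LINT y|torus. a k x * (u y \<bullet> space_grad (b k) y))"
      unfolding Bochner_Integration.integral_minus
      by (subst Bochner_Integration.integral_sum) (use ibd[OF _ that(1,2)] in auto)
    also have "\<dots> = 0" using that(3) by simp
    finally show ?thesis .
  qed
  show fl: "torus_flux v w (gker N)"
  proof unfold_locales
    show "continuous_on UNIV (gker N)" by (rule gker_continuous)
    show "gker N (x - y) = - gker N (y - x)" for x y by (rule gker_odd)
    show "(LINT y|torus. gker N (x - y)) = 0" for x by (rule gker_integral[OF N])
    show "(LINT y|torus. v y \<bullet> gker N (x - y)) = 0" for x by (rule div[OF v1 v dv])
    show "(LINT y|torus. w y \<bullet> gker N (x - y)) = 0" for x by (rule div[OF w1 w dw])
  qed
  interpret fl: torus_flux v w "gker N" by (rule fl)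
  define Fk where "Fk k x = (v x \<bullet> space_grad (a k) x) *\<^sub>R v x + \<pi> x *\<^sub>R space_grad (a k) x" for k x
  define Gk where "Gk k x = (v x \<bullet> space_grad (b k) x) *\<^sub>R w x - (w x \<bullet> space_grad (b k) x) *\<^sub>R v x" for k x
  define Vk where "Vk k x = a k x *\<^sub>R v x" for k x
  define Wk where "Wk k x = b k x *\<^sub>R w x" for k x
  have CS: "\<bar>p \<bullet> q\<bar> * norm r \<le> norm q * (norm p * norm r)" for p q r :: "real^3"
    using mult_right_mono[OF Cauchy_Schwarz_ineq2[of p q] norm_ge_zero[of r]] by (simp add: mult_ac)
  have iF: "integrable torus (Fk k)" if k: "k < n" for k
  proof -
    have "integrable torus (\<lambda>x. (v x \<bullet> space_grad (a k) x) *\<^sub>R v x)"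
      by (rule integrable_torus_norm_bound[OF v2 space_grad_continuous[OF sa[OF k]]])
         (use mv mg[OF k] CS in auto)
    moreover have "integrable torus (\<lambda>x. \<pi> x *\<^sub>R space_grad (a k) x)"
      by (rule integrable_torus_norm_bound[OF integrable_abs[OF \<pi>] space_grad_continuous[OF sa[OF k]]])
         (use mv mg[OF k] in \<open>auto simp: mult.commute\<close>)
    ultimately show ?thesis unfolding Fk_def[abs_def] by simp
  qed
  have iG: "integrable torus (Gk k)" if k: "k < n" for k
  proof -
    have "integrable torus (\<lambda>x. (v x \<bullet> space_grad (b k) x) *\<^sub>R w x)"
      by (rule integrable_torus_norm_bound[OF vw space_grad_continuous[OF sb[OF k]]])
         (use mv mg[OF k] CS in auto)
    moreover have "integrable torus (\<lambda>x. (w x \<bullet> space_grad (b k) x) *\<^sub>R v x)"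
      by (rule integrable_torus_norm_bound[OF vw space_grad_continuous[OF sb[OF k]]])
         (use mv mg[OF k] CS in \<open>auto simp: mult.commute[of "norm (v _)"]\<close>)
    ultimately show ?thesis unfolding Gk_def[abs_def] by simp
  qed
  have iV: "integrable torus (Vk k)" if k: "k < n" for k
    unfolding Vk_def[abs_def]
    by (rule integrable_torus_norm_bound[OF v1 smooth_continuous[OF sa[OF k]]]) (use mv ma[OF k] in auto)
  have iW: "integrable torus (Wk k)" if k: "k < n" for k
    unfolding Wk_def[abs_def]
    by (rule integrable_torus_norm_bound[OF w1 smooth_continuous[OF sb[OF k]]]) (use mv ma[OF k] in auto)
  have iFW: "integrable torus2 (\<lambda>(x, y). Fk k x \<bullet> Wk k y)" "integrable torus2 (\<lambda>(x, y). Vk k x \<bullet> Gk k y)"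
     "integrable torus2 (\<lambda>(x, y). Vk k x \<bullet> Wk k y)" if k: "k < n" for k
    by (rule integral_torus2_inner(1)[OF iF[OF k] iW[OF k]], rule integral_torus2_inner(1)[OF iV[OF k] iG[OF k]],
        rule integral_torus2_inner(1)[OF iV[OF k] iW[OF k]])
  have "(\<Sum>k<n. integral\<^sup>L torus (Fk k) \<bullet> integral\<^sup>L torus (Wk k) + integral\<^sup>L torus (Vk k) \<bullet> integral\<^sup>L torus (Gk k))
     = (\<Sum>k<n. integral\<^sup>L torus2 (\<lambda>(x, y). Fk k x \<bullet> Wk k y) + integral\<^sup>L torus2 (\<lambda>(x, y). Vk k x \<bullet> Gk k y))"
    by (rule sum.cong) (simp_all add: integral_torus2_inner(2)[OF iF iW] integral_torus2_inner(2)[OF iV iG])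
  also have "\<dots> = (\<Sum>k<n. integral\<^sup>L torus2 (\<lambda>z. (case z of (x, y) \<Rightarrow> Fk k x \<bullet> Wk k y) + (case z of (x, y) \<Rightarrow> Vk k x \<bullet> Gk k y)))"
    by (rule sum.cong) (simp_all add: Bochner_Integration.integral_add[OF iFW(1,2)])
  also have "\<dots> = integral\<^sup>L torus2 (\<lambda>z. \<Sum>k<n. (case z of (x, y) \<Rightarrow> Fk k x \<bullet> Wk k y) + (case z of (x, y) \<Rightarrow> Vk k x \<bullet> Gk k y))"
    by (rule Bochner_Integration.integral_sum[symmetric]) (rule Bochner_Integration.integrable_add[OF iFW(1,2)]; simp)
  also have "\<dots> = integral\<^sup>L torus2 (\<lambda>z. (case z of (x, y) \<Rightarrow> (v x \<bullet> gker N (x - y)) * (v x \<bullet> w y)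
    - (v y \<bullet> gker N (x - y)) * (v x \<bullet> w y) + (w y \<bullet> gker N (x - y)) * (v x \<bullet> v y))
    + (case z of (x, y) \<Rightarrow> \<pi> x * (w y \<bullet> gker N (x - y))))"
  proof (rule Bochner_Integration.integral_cong[OF refl], clarify)
    fix x y :: "real^3"
    have 1: "(\<Sum>k<n. Fk k x \<bullet> Wk k y) = (v x \<bullet> gker N (x - y)) * (v x \<bullet> w y) + \<pi> x * (w y \<bullet> gker N (x - y))"
      by (simp add: gker_left Fk_def Wk_def inner_sum_right inner_add_left sum.distrib sum_distrib_left sum_distrib_right
          inner_commute[of "w y"] algebra_simps)
    have 2: "(\<Sum>k<n. Vk k x \<bullet> Gk k y) = - (v y \<bullet> gker N (x - y)) * (v x \<bullet> w y) + (w y \<bullet> gker N (x - y)) * (v x \<bullet> v y)"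
      by (simp add: gker_right Vk_def Gk_def inner_sum_right inner_diff_right sum_subtractf sum_distrib_left sum_distrib_right
          algebra_simps)
    show "(\<Sum>k<n. Fk k x \<bullet> Wk k y + Vk k x \<bullet> Gk k y) = (v x \<bullet> gker N (x - y)) * (v x \<bullet> w y)
    - (v y \<bullet> gker N (x - y)) * (v x \<bullet> w y) + (w y \<bullet> gker N (x - y)) * (v x \<bullet> v y) + \<pi> x * (w y \<bullet> gker N (x - y))"
      unfolding sum.distrib 1 2 by simp
  qed
  also have "\<dots> = fl.flux"
  proof -
    \<comment> \<open>The pressure sits at x and multiplies
      \<open>w y \<bullet> gker N (x - y)\<close>, whose integral in y is zero; only its
      integrability at this time is needed.\<close>
    have p: "integrable torus2 (\<lambda>(x, y). \<pi> x * (w y \<bullet> gker N (x - y)))" "integral\<^sup>L torus2 (\<lambda>(x, y). \<pi> x * (w y \<bullet> gker N (x - y))) = 0"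
      using fl.integral_against_div[OF \<pi> w1 w fl.div_w] by auto
    define t1 where "t1 = (\<lambda>(x, y). (v x \<bullet> gker N (x - y)) * (v x \<bullet> w y))"
    define t2 where "t2 = (\<lambda>(x, y). (v y \<bullet> gker N (x - y)) * (v x \<bullet> w y))"
    define t3 where "t3 = (\<lambda>(x, y). (w y \<bullet> gker N (x - y)) * (v x \<bullet> v y))"
    have "integrable torus2 (\<lambda>z. t1 z - t2 z + t3 z)"
      using fl.flux_integrable[folded t1_def t2_def t3_def] by simp
    then have "integrable torus2 (\<lambda>(x, y). (v x \<bullet> gker N (x - y)) * (v x \<bullet> w y)
    - (v y \<bullet> gker N (x - y)) * (v x \<bullet> w y) + (w y \<bullet> gker N (x - y)) * (v x \<bullet> v y))"
      by (simp add: t1_def t2_def t3_def case_prod_beta')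
    from Bochner_Integration.integral_add[OF this p(1)] show ?thesis unfolding p(2) fl.flux_def by simp
  qed
  finally show "(\<Sum>k<n. (LINT x|torus. (v x \<bullet> space_grad (a k) x) *\<^sub>R v x + \<pi> x *\<^sub>R space_grad (a k) x) \<bullet> (LINT x|torus. b k x *\<^sub>R w x)
      + (LINT x|torus. a k x *\<^sub>R v x) \<bullet> (LINT x|torus. (v x \<bullet> space_grad (b k) x) *\<^sub>R w x - (w x \<bullet> space_grad (b k) x) *\<^sub>R v x))
      = torus_flux.flux v w (gker N)"
    by (simp only: Fk_def[abs_def] Gk_def[abs_def] Vk_def[abs_def] Wk_def[abs_def])
  have "(\<Sum>k<n. integral\<^sup>L torus (Vk k) \<bullet> integral\<^sup>L torus (Wk k)) = (\<Sum>k<n. integral\<^sup>L torus2 (\<lambda>(x, y). Vk k x \<bullet> Wk k y))"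
    by (rule sum.cong) (simp_all add: integral_torus2_inner(2)[OF iV iW])
  also have "\<dots> = integral\<^sup>L torus2 (\<lambda>z. \<Sum>k<n. (case z of (x, y) \<Rightarrow> Vk k x \<bullet> Wk k y))"
    by (rule Bochner_Integration.integral_sum[symmetric]) (rule iFW(3); simp)
  also have "\<dots> = integral\<^sup>L torus2 (\<lambda>(x, y). ker N (x - y) * (v x \<bullet> w y))"
    by (rule Bochner_Integration.integral_cong[OF refl]) (auto simp: ker Vk_def Wk_def sum_distrib_left sum_distrib_right mult_ac)
  finally show "(\<Sum>k<n. (LINT x|torus. a k x *\<^sub>R v x) \<bullet> (LINT x|torus. b k x *\<^sub>R w x))
      = integral\<^sup>L torus2 (\<lambda>(x, y). ker N (x - y) * (v x \<bullet> w y))"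
    by (simp only: Vk_def[abs_def] Wk_def[abs_def])
qed

lemma AE_lebesgue_on_subset:
  assumes "AE x in lebesgue_on B. P x" "A \<subseteq> B" "A \<in> sets lebesgue" "B \<in> sets lebesgue"
  shows "AE x in lebesgue_on A. P x"
proof -
  have "AE x in lebesgue. x \<in> B \<longrightarrow> P x" using assms by (simp add: AE_restrict_space_iff)
  then have "AE x in lebesgue. x \<in> A \<longrightarrow> P x" by (rule eventually_mono) (use assms(2) in blast)
  then show ?thesis using assms by (simp add: AE_restrict_space_iff)
qed

lemma AE_lebesgue_on_Icc_ex:
  assumes "AE x in lebesgue_on {a..b::real}. P x" "a < b"
  shows "\<exists>x\<in>{a..b}. P x"
proof (rule ccontr)
  define M where "M = lebesgue_on {a..b}"
  assume n: "\<not> ?thesis"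
  have "AE x in lebesgue_on {a..b}. x \<in> {a..b}" by (metis AE_space space_lebesgue_on)
  with assms(1) have "AE x in lebesgue_on {a..b}. False"
    by eventually_elim (use n in blast)
  then have "AE x in M. False" by (simp only: M_def)
  then have "emeasure M (space M) = 0" by (simp add: AE_iff_measurable[OF _ refl])
  then show False using assms(2) by (simp add: M_def emeasure_restrict_space)
qed

text \<open>The finite expansion makes the mollified helicity a finite sum of products of moments.
  Each moment is almost everywhere a primitive, hence so is each product, and
  \<open>flux_expansion\<close> identifies the sum of the derivatives.\<close>

lemma mollified_helicity_balance:
  assumes euler: "euler_weak_solution T v w" and N: "N \<ge> 1" and ab: "0 < \<alpha>" "\<alpha> < \<beta>" "\<beta> < T"
    and tf: "AE t in lebesgue_on {0<..<T}. torus_fields (v t) (w t)"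
  shows "\<exists>c S. integrable (lebesgue_on {\<alpha>..\<beta>}) S \<and>
    (AE t in lebesgue_on {\<alpha>..\<beta>}. integral\<^sup>L torus2 (\<lambda>(x, y). ker N (x - y) * (v t x \<bullet> w t y))
        = c + integral\<^sup>L (lebesgue_on {\<alpha>..t}) S) \<and>
    (AE t in lebesgue_on {\<alpha>..\<beta>}. torus_flux (v t) (w t) (gker N) \<and> S t = torus_flux.flux (v t) (w t) (gker N))"
proof -
  obtain \<pi> where \<pi>: "locally_integrable T \<pi>"
      "AE t in lebesgue_on {0<..<T}. has_bochner_integral torus (\<pi> t) 0" "weak_momentum T v \<pi>"
    using euler unfolding euler_weak_solution_def by blast
  have li: "locally_integrable T v" "locally_integrable T w"
    "\<And>i j. locally_integrable T (\<lambda>t x. v t x $ i * v t x $ j)" "\<And>i j. locally_integrable T (\<lambda>t x. v t x $ i * w t x $ j)"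
    and weak: "weak_vorticity T v w" "weak_div_free T v" "weak_div_free T w"
    using euler unfolding euler_weak_solution_def by blast+
  obtain n a b where ex: "ker_expansion N n a b"
    using ker_finite_rank[of N] N unfolding ker_expansion_def by metis
  interpret ker_expansion N n a b by (rule ex)
  define V where "V k t = (LINT x|torus. a k x *\<^sub>R v t x)" for k t
  define W where "W k t = (LINT x|torus. b k x *\<^sub>R w t x)" for k t
  define F where "F k t = (LINT x|torus. (v t x \<bullet> space_grad (a k) x) *\<^sub>R v t x + \<pi> t x *\<^sub>R space_grad (a k) x)" for k t
  define G where "G k t = (LINT x|torus. (v t x \<bullet> space_grad (b k) x) *\<^sub>R w t x - (w t x \<bullet> space_grad (b k) x) *\<^sub>R v t x)" for k t
  define P where "P k j t = F k t $ j * W k t $ j + V k t $ j * G k t $ j" for k j t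
  have prod: "integrable (lebesgue_on {\<alpha>..\<beta>}) (P k j)
      \<and> (\<exists>c. AE t in lebesgue_on {\<alpha>..\<beta>}. V k t $ j * W k t $ j = c + integral\<^sup>L (lebesgue_on {\<alpha>..t}) (P k j))"
    if k: "k < n" for k j
  proof -
    note m = momentum_slices[OF ab a[OF k] li(1,3) \<pi>(1,3), folded F_def V_def]
    note o = vorticity_slices[OF ab b[OF k] li(2,4) weak(1), folded G_def W_def]
    have iF: "integrable (lebesgue_on {\<alpha>..\<beta>}) (\<lambda>t. F k t $ j)"
      by (rule integrable_bounded_linear[OF bounded_linear_vec_nth m(1)])
    have iG: "integrable (lebesgue_on {\<alpha>..\<beta>}) (\<lambda>t. G k t $ j)"
      by (rule integrable_bounded_linear[OF bounded_linear_vec_nth o(1)])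
    obtain c where c: "AE t in lebesgue_on {\<alpha>..\<beta>}. V k t $ j = c + (LINT s|lebesgue_on {\<alpha>..t}. F k s $ j)"
      using m(2) by blast
    obtain d where d: "AE t in lebesgue_on {\<alpha>..\<beta>}. W k t $ j = d + (LINT s|lebesgue_on {\<alpha>..t}. G k s $ j)"
      using o(2) by blast
    show ?thesis
      using product_of_primitives[OF iF iG c d] unfolding P_def by blast
  qed
  then have "\<forall>k j. \<exists>c. k < n \<longrightarrow> (AE t in lebesgue_on {\<alpha>..\<beta>}. V k t $ j * W k t $ j = c + integral\<^sup>L (lebesgue_on {\<alpha>..t}) (P k j))"
    by blast
  then have "\<exists>c. \<forall>k j. k < n \<longrightarrow> (AE t in lebesgue_on {\<alpha>..\<beta>}. V k t $ j * W k t $ j = c k j + integral\<^sup>L (lebesgue_on {\<alpha>..t}) (P k j))"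
    by (simp only: choice_iff)
  then obtain c where c: "\<And>k j. k < n \<Longrightarrow> AE t in lebesgue_on {\<alpha>..\<beta>}. V k t $ j * W k t $ j = c k j + integral\<^sup>L (lebesgue_on {\<alpha>..t}) (P k j)"
    by blast
  \<comment> \<open>S rather than the flux is integrated in time: its integrability is inherited
    from the moments, while the flux agrees with it only at almost every t.\<close>
  define S where "S t = (\<Sum>k<n. \<Sum>j\<in>UNIV. P k j t)" for t
  define c0 where "c0 = (\<Sum>k<n. \<Sum>j\<in>UNIV. c k j)"
  have iS: "integrable (lebesgue_on {\<alpha>..\<beta>}) S"
    unfolding S_def using prod by (intro Bochner_Integration.integrable_sum) auto
  have "AE t in lebesgue_on {0<..<T}. torus_fields (v t) (w t) \<and> integrable torus (\<pi> t)"
    using tf \<pi>(2) by eventually_elim (auto simp: has_bochner_integral_iff)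
  then have tf': "AE t in lebesgue_on {\<alpha>..\<beta>}. torus_fields (v t) (w t) \<and> integrable torus (\<pi> t)"
    by (rule AE_lebesgue_on_subset) (use ab in auto)
  have dv: "AE t in lebesgue_on {\<alpha>..\<beta>}. \<forall>k\<in>{..<n}. (LINT x|torus. v t x \<bullet> space_grad (b k) x) = 0"
    by (rule AE_finite_allI) (use div_free_slices[OF ab b li(1) weak(2)] in auto)
  have dw: "AE t in lebesgue_on {\<alpha>..\<beta>}. \<forall>k\<in>{..<n}. (LINT x|torus. w t x \<bullet> space_grad (b k) x) = 0"
    by (rule AE_finite_allI) (use div_free_slices[OF ab b li(2) weak(3)] in auto)
  have allc: "AE t in lebesgue_on {\<alpha>..\<beta>}. \<forall>k\<in>{..<n}. \<forall>j\<in>UNIV. V k t $ j * W k t $ j = c k j + integral\<^sup>L (lebesgue_on {\<alpha>..t}) (P k j)"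
    by (rule AE_finite_allI, simp, rule AE_finite_allI) (use c in auto)
  have AE_ab: "AE t in lebesgue_on {\<alpha>..\<beta>}. t \<in> {\<alpha>..\<beta>}" by (metis AE_space space_lebesgue_on)
  have flux: "torus_flux (v t) (w t) (gker N)" "S t = torus_flux.flux (v t) (w t) (gker N)"
    "(\<Sum>k<n. \<Sum>j\<in>UNIV. V k t $ j * W k t $ j) = integral\<^sup>L torus2 (\<lambda>(x, y). ker N (x - y) * (v t x \<bullet> w t y))"
    if "torus_fields (v t) (w t)" "integrable torus (\<pi> t)"
      "\<forall>k\<in>{..<n}. (LINT x|torus. v t x \<bullet> space_grad (b k) x) = 0"
      "\<forall>k\<in>{..<n}. (LINT x|torus. w t x \<bullet> space_grad (b k) x) = 0" for t
  proof -
    have d: "\<And>k. k < n \<Longrightarrow> (LINT x|torus. v t x \<bullet> space_grad (b k) x) = 0"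
      "\<And>k. k < n \<Longrightarrow> (LINT x|torus. w t x \<bullet> space_grad (b k) x) = 0" using that(3,4) by auto
    show "torus_flux (v t) (w t) (gker N)" by (rule flux_expansion(1)[OF that(1) _ _ that(2)]) (use d in auto)
    have "S t = (\<Sum>k<n. F k t \<bullet> W k t + V k t \<bullet> G k t)"
      by (simp add: S_def P_def inner_vec_def sum.distrib)
    also have "\<dots> = torus_flux.flux (v t) (w t) (gker N)"
      unfolding F_def W_def V_def G_def by (rule flux_expansion(2)[OF that(1) _ _ that(2)]) (use d in auto)
    finally show "S t = torus_flux.flux (v t) (w t) (gker N)" .
    have "(\<Sum>k<n. \<Sum>j\<in>UNIV. V k t $ j * W k t $ j) = (\<Sum>k<n. V k t \<bullet> W k t)"
      by (simp add: inner_vec_def)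
    also have "\<dots> = integral\<^sup>L torus2 (\<lambda>(x, y). ker N (x - y) * (v t x \<bullet> w t y))"
      unfolding W_def V_def by (rule flux_expansion(3)[OF that(1) _ _ that(2)]) (use d in auto)
    finally show "(\<Sum>k<n. \<Sum>j\<in>UNIV. V k t $ j * W k t $ j) = integral\<^sup>L torus2 (\<lambda>(x, y). ker N (x - y) * (v t x \<bullet> w t y))" .
  qed
  have "AE t in lebesgue_on {\<alpha>..\<beta>}. torus_flux (v t) (w t) (gker N) \<and> S t = torus_flux.flux (v t) (w t) (gker N)"
    using tf' dv dw by eventually_elim (use flux in blast)
  moreover have "AE t in lebesgue_on {\<alpha>..\<beta>}. integral\<^sup>L torus2 (\<lambda>(x, y). ker N (x - y) * (v t x \<bullet> w t y))
        = c0 + integral\<^sup>L (lebesgue_on {\<alpha>..t}) S"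
    using tf' dv dw allc AE_ab
  proof eventually_elim
    case (elim t)
    have sub: "{\<alpha>..t} \<subseteq> {\<alpha>..\<beta>}" using elim(5) by auto
    have iP: "integrable (lebesgue_on {\<alpha>..t}) (P k j)" if "k < n" for k j
      by (rule integrable_lebesgue_on_subset[OF _ sub]) (use prod[OF that] in auto)
    have "integral\<^sup>L torus2 (\<lambda>(x, y). ker N (x - y) * (v t x \<bullet> w t y)) = (\<Sum>k<n. \<Sum>j\<in>UNIV. V k t $ j * W k t $ j)"
      using flux(3)[of t] elim by simp
    also have "\<dots> = (\<Sum>k<n. \<Sum>j\<in>UNIV. c k j + integral\<^sup>L (lebesgue_on {\<alpha>..t}) (P k j))"
      using elim(4) by (intro sum.cong refl) auto
    also have "\<dots> = c0 + (\<Sum>k<n. \<Sum>j\<in>UNIV. integral\<^sup>L (lebesgue_on {\<alpha>..t}) (P k j))"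
      by (simp add: c0_def sum.distrib)
    also have "(\<Sum>k<n. \<Sum>j\<in>UNIV. integral\<^sup>L (lebesgue_on {\<alpha>..t}) (P k j)) = (\<Sum>k<n. (LINT s|lebesgue_on {\<alpha>..t}. (\<Sum>j\<in>UNIV. P k j s)))"
      using iP by (intro sum.cong refl Bochner_Integration.integral_sum[symmetric]) auto
    also have "\<dots> = integral\<^sup>L (lebesgue_on {\<alpha>..t}) S"
      unfolding S_def using iP by (intro Bochner_Integration.integral_sum[symmetric] Bochner_Integration.integrable_sum) auto
    finally show ?case .
  qed
  ultimately show ?thesis using iS by blast
qed

subsection \<open>Passing to the limit\<close>

text \<open>A common bound for the kernel and its gradient at distance at least d from the origin;
  the third of d is the size that some coordinate must then have.\<close>

definition ker_tail :: "real \<Rightarrow> nat \<Rightarrow> real" where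
  "ker_tail d N = 3 * (2 * pi * real N) ^ 4 * cos (pi * (d / 3)) ^ (2 * N - 1)"

lemma ker_tail_tendsto_0: "0 < d \<Longrightarrow> d \<le> 1 \<Longrightarrow> ker_tail d \<longlonglongrightarrow> 0"
  unfolding ker_tail_def[abs_def] by (rule gker_tail_tendsto_0) auto

lemma norm_centered_cell:
  assumes "l \<in> centered_cell" shows "norm l \<le> 2"
proof -
  have "norm l \<le> (\<Sum>i\<in>UNIV. \<bar>l $ i\<bar>)" by (rule norm_le_l1_cart)
  also have "\<dots> \<le> (\<Sum>i\<in>(UNIV::3 set). 1/2)"
  proof (rule sum_mono)
    fix i show "\<bar>l $ i\<bar> \<le> 1/2"
      using assms by (auto simp: centered_cell_def mem_box_cart abs_le_iff dest: spec[of _ i])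
  qed
  finally show ?thesis by simp
qed

text \<open>The two first moments provide the constants: 36 for the gradient, and 2 for the kernel
  itself, which has mass 1 on a cell where |l| \<le> 2. Beyond radius d the tail bound is combined
  with the total of all increments.\<close>

lemma kernel_increments:
  fixes v w :: "real^3 \<Rightarrow> real^3"
  assumes per: "torus_periodic v" "torus_periodic w" and Lq: "in_Lq q v" "in_Lq n w"
    and qn: "3 \<le> q" "1 < n" "2 / q + 1 / n = 1"
    and inc_v: "\<forall>l\<in>ball 0 \<delta>. in_Lq (9/2) (\<lambda>x. v (x + l) - v x)
       \<and> Lq_norm (9/2) (\<lambda>x. v (x + l) - v x) \<le> c1 * norm l powr \<alpha> * s1 l"
    and inc_w: "\<forall>l\<in>ball 0 \<delta>. in_Lq (9/5) (\<lambda>x. w (x + l) - w x)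
       \<and> Lq_norm (9/5) (\<lambda>x. w (x + l) - w x) \<le> c2 * norm l powr \<beta> * s2 l"
    and ab: "1 \<le> 2 * \<alpha> + \<beta>" and nn: "0 \<le> c1" "0 \<le> c2" "\<And>l. 0 \<le> s1 l" "\<And>l. 0 \<le> s2 l"
    and Y: "c1\<^sup>2 * c2 \<le> Y" and d: "0 < d" "d \<le> \<delta>" "d \<le> 1"
    and e: "\<forall>l\<in>ball 0 d. l \<noteq> 0 \<longrightarrow> 2 * (s1 l)\<^sup>2 * s2 l \<le> \<epsilon>" "0 \<le> \<epsilon>"
    and M: "128 * (Lq_norm q v)\<^sup>2 * Lq_norm n w \<le> M" and N: "N \<ge> 1"
  shows "torus_fields.increments v w (\<lambda>l. ennreal (norm (gker N l))) \<le> ennreal (\<epsilon> * Y * 36 + ker_tail d N * M)"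
    and "torus_fields.increments v w (\<lambda>l. ennreal (ker N l)) \<le> ennreal (\<epsilon> * Y * 2 + ker_tail d N * M)"
proof -
  note tfL = torus_fields_Lq[OF Lq qn]
  interpret torus_fields v w by (rule tfL(1))
  have small: "(\<integral>\<^sup>+y. ennreal ((norm (v (y + l) - v y))\<^sup>2 * norm (w (y + l) - w y)) \<partial>torus) \<le> ennreal (\<epsilon> * Y * norm l)"
    if l: "l \<in> ball 0 d" for l
  proof -
    have "l \<in> ball 0 \<delta>" "norm l \<le> 1" using l d by auto
    then show ?thesis
      using inc_v inc_w ab nn Y e l by (intro increment_product_small[of v l c1 \<alpha> "s1 l" w c2 \<beta> "s2 l"]) auto
  qed
  have Y0: "0 \<le> Y" using order_trans[OF _ Y] nn by simp
  have M0: "0 \<le> M" using order_trans[OF _ M] by simp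
  have tot: "increments (\<lambda>l. 1) \<le> ennreal M" using tfL(2) M ennreal_leI order_trans by blast
  have e0: "0 \<le> d / 3" "d / 3 \<le> 1/2" using d by auto
  have t: "ker N l \<le> ker_tail d N \<and> norm (gker N l) \<le> ker_tail d N" if "l \<in> centered_cell" "l \<notin> ball 0 d" for l
  proof -
    have "3 * (d / 3) \<le> norm l" using that(2) by auto
    note gt = gker_tail[OF N e0 that(1) this]
    have A: "1 \<le> 2 * pi * real N"
    proof -
      have "1 * 1 \<le> (2 * pi) * real N" using N pi_ge_two by (intro mult_mono) auto
      then show ?thesis by simp
    qed
    have q0: "0 \<le> cos (pi * (d / 3)) ^ (2 * N - 1)" using cos_pi_half_interval[of "d / 3"] e0 by simp
    have "(2 * pi * real N) ^ 3 \<le> (2 * pi * real N) ^ 4" by (rule power_increasing) (use A in auto)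
    then have "(2 * pi * real N) ^ 3 \<le> 3 * (2 * pi * real N) ^ 4" using zero_le_power[of "2 * pi * real N" 4] A by linarith
    then have "(2 * pi * real N) ^ 3 * cos (pi * (d / 3)) ^ (2 * N - 1) \<le> ker_tail d N"
      unfolding ker_tail_def using q0 by (rule mult_right_mono)
    then show ?thesis using gt by (simp add: ker_tail_def)
  qed
  have tail0: "0 \<le> ker_tail d N"
    unfolding ker_tail_def using cos_pi_half_interval[of "d / 3"] e0 by simp
  have gb: "(\<lambda>l. norm (gker N l)) \<in> borel_measurable borel"
    by (intro borel_measurable_continuous_onI continuous_on_norm gker_continuous)
  have kb: "ker N \<in> borel_measurable borel" by (rule borel_measurable_continuous_onI[OF ker_continuous])
  have gp: "torus_periodic (\<lambda>l. norm (gker N l))" using gker_periodic[OF N] by (simp add: torus_periodic_def)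
  show "increments (\<lambda>l. ennreal (norm (gker N l))) \<le> ennreal (\<epsilon> * Y * 36 + ker_tail d N * M)"
  proof (rule increments_le[OF per gb gp _ small])
    show "(\<integral>\<^sup>+l. ennreal (norm (gker N l) * norm l) * indicator centered_cell l \<partial>lborel) \<le> ennreal 36"
      using nn_integral_gker_moment[OF N] by simp
  qed (use t tail0 tot Y0 M0 e(2) in auto)
  show "increments (\<lambda>l. ennreal (ker N l)) \<le> ennreal (\<epsilon> * Y * 2 + ker_tail d N * M)"
  proof (rule increments_le[OF per kb ker_periodic ker_nonneg small])
    have [measurable]: "ker N \<in> borel_measurable borel" "centered_cell \<in> sets borel" using kb by (auto simp: centered_cell_def)
    have "(\<integral>\<^sup>+l. ennreal (ker N l * norm l) * indicator centered_cell l \<partial>lborel)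
       \<le> (\<integral>\<^sup>+l. 2 * (ennreal (ker N l) * indicator centered_cell l) \<partial>lborel)"
    proof (rule nn_integral_mono)
      fix l :: "real^3"
      have "ennreal (ker N l * norm l) \<le> ennreal (2 * ker N l)" if "l \<in> centered_cell"
        using mult_left_mono[OF norm_centered_cell[OF that] ker_nonneg[of N l]] by (intro ennreal_leI) simp
      then show "ennreal (ker N l * norm l) * indicator centered_cell l \<le> 2 * (ennreal (ker N l) * indicator centered_cell l)"
        by (auto simp: indicator_def ennreal_mult ker_nonneg)
    qed
    also have "\<dots> = 2" by (subst nn_integral_cmult) (simp_all add: nn_integral_ker_cell[OF N])
    finally show "(\<integral>\<^sup>+l. ennreal (ker N l * norm l) * indicator centered_cell l \<partial>lborel) \<le> ennreal 2" by simp
  qed (use t tail0 tot Y0 M0 e(2) in auto)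
qed

text \<open>One factor tends to 0 and the other is bounded; which one is small is left open, so both
  cases must lead to the same threshold.\<close>

lemma sigma_product_small:
  fixes \<sigma>1 \<sigma>2 :: "real^3 \<Rightarrow> real"
  assumes \<delta>: "0 < \<delta>" and nn: "\<forall>l\<in>ball 0 \<delta>. 0 \<le> \<sigma>1 l" "\<forall>l\<in>ball 0 \<delta>. 0 \<le> \<sigma>2 l"
    and bd: "bounded (\<sigma>1 ` ball 0 \<delta>)" "bounded (\<sigma>2 ` ball 0 \<delta>)"
    and lim: "(\<sigma>1 \<longlongrightarrow> 0) (at 0) \<or> (\<sigma>2 \<longlongrightarrow> 0) (at 0)" and \<epsilon>: "0 < \<epsilon>"
  shows "\<exists>d. 0 < d \<and> d \<le> \<delta> \<and> d \<le> 1 \<and>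
    (\<forall>l\<in>ball 0 d. l \<noteq> 0 \<longrightarrow> 2 * (\<sigma>1 l powr (1/3))\<^sup>2 * \<sigma>2 l powr (1/3) \<le> \<epsilon>)"
proof -
  obtain K1 K2 where K: "\<And>l. l \<in> ball 0 \<delta> \<Longrightarrow> \<bar>\<sigma>1 l\<bar> \<le> K1" "\<And>l. l \<in> ball 0 \<delta> \<Longrightarrow> \<bar>\<sigma>2 l\<bar> \<le> K2"
  proof -
    obtain K1 where "\<forall>x\<in>\<sigma>1 ` ball 0 \<delta>. norm x \<le> K1" using bd(1) unfolding bounded_iff by blast
    moreover obtain K2 where "\<forall>x\<in>\<sigma>2 ` ball 0 \<delta>. norm x \<le> K2" using bd(2) unfolding bounded_iff by blast
    ultimately show ?thesis by (intro that) auto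
  qed
  define B where "B = (max K1 K2) powr (1/3)"
  have B0: "0 \<le> B" by (simp add: B_def)
  have B: "\<sigma>1 l powr (1/3) \<le> B" "\<sigma>2 l powr (1/3) \<le> B" if "l \<in> ball 0 \<delta>" for l
    unfolding B_def using K[OF that] nn that by (auto intro!: powr_mono2)
  \<comment> \<open>B serves the case where \<sigma>1 is small and B^2 the case where \<sigma>2 is;
    the summand 1 keeps the denominator positive. Since \<rho> \<le> 1, the square of a small factor
    is again at most \<rho>.\<close>
  define \<rho> where "\<rho> = min 1 (\<epsilon> / (2 * (B\<^sup>2 + B + 1)))"
  have den: "0 < 2 * (B\<^sup>2 + B + 1)" using B0 by (simp add: add_nonneg_pos)
  have \<rho>: "0 < \<rho>" "\<rho> \<le> 1" using den \<epsilon> by (auto simp: \<rho>_def)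
  have "\<rho> * (2 * (B\<^sup>2 + B + 1)) \<le> \<epsilon> / (2 * (B\<^sup>2 + B + 1)) * (2 * (B\<^sup>2 + B + 1))"
    by (rule mult_right_mono) (use den in \<open>auto simp: \<rho>_def\<close>)
  then have \<rho>D: "\<rho> * (2 * (B\<^sup>2 + B + 1)) \<le> \<epsilon>" using den by simp
  have r3: "s powr (1/3) \<le> \<rho>" if "0 \<le> s" "s \<le> \<rho> powr 3" for s
  proof -
    have "s powr (1/3) \<le> (\<rho> powr 3) powr (1/3)" using that by (intro powr_mono2) auto
    also have "(\<rho> powr 3) powr (1/3) = \<rho> powr (3 * (1/3))" by (rule powr_powr)
    finally show ?thesis using \<rho> by simp
  qed
  have ev: "\<exists>d>0. \<forall>l. l \<noteq> 0 \<and> dist l 0 < d \<longrightarrow> \<bar>\<sigma> l\<bar> < \<rho> powr 3" if "(\<sigma> \<longlongrightarrow> 0) (at 0)" for \<sigma> :: "real^3 \<Rightarrow> real"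
  proof -
    have "\<forall>\<^sub>F l in at 0. dist (\<sigma> l) 0 < \<rho> powr 3" using that \<rho> by (intro tendstoD) auto
    then show ?thesis by (simp add: eventually_at)
  qed
  have m: "2 * \<rho> * B \<le> \<epsilon>" "2 * B\<^sup>2 * \<rho> \<le> \<epsilon>"
  proof -
    have "0 \<le> \<rho> * B\<^sup>2" "0 \<le> \<rho> * B" using \<rho>(1) B0 by auto
    moreover have "\<rho> * (2 * (B\<^sup>2 + B + 1)) = 2 * (\<rho> * B\<^sup>2) + 2 * (\<rho> * B) + 2 * \<rho>" by (simp add: algebra_simps)
    ultimately have "2 * (\<rho> * B) \<le> \<epsilon>" "2 * (\<rho> * B\<^sup>2) \<le> \<epsilon>" using \<rho>(1) \<rho>D by linarith+
    then show "2 * \<rho> * B \<le> \<epsilon>" "2 * B\<^sup>2 * \<rho> \<le> \<epsilon>" by (simp_all only: mult.assoc mult.commute[of "B\<^sup>2"])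
  qed
  from lim show ?thesis
  proof
    assume "(\<sigma>1 \<longlongrightarrow> 0) (at 0)"
    then obtain d where d: "d > 0" "\<And>l. l \<noteq> 0 \<Longrightarrow> dist l 0 < d \<Longrightarrow> \<bar>\<sigma>1 l\<bar> < \<rho> powr 3" using ev by blast
    have "2 * (\<sigma>1 l powr (1/3))\<^sup>2 * \<sigma>2 l powr (1/3) \<le> \<epsilon>" if l: "l \<in> ball 0 (min d (min \<delta> 1))" "l \<noteq> 0" for l
    proof -
      have l\<delta>: "l \<in> ball 0 \<delta>" using l by auto
      have "\<sigma>1 l powr (1/3) \<le> \<rho>" using d(2)[of l] l nn l\<delta> by (intro r3) (auto simp: dist_commute)
      then have "(\<sigma>1 l powr (1/3))\<^sup>2 \<le> \<rho>\<^sup>2" by (intro power_mono) auto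
      also have "\<rho>\<^sup>2 \<le> \<rho>" using \<rho> by (simp add: power2_eq_square mult_left_le)
      finally have "2 * (\<sigma>1 l powr (1/3))\<^sup>2 * \<sigma>2 l powr (1/3) \<le> 2 * \<rho> * B"
        using B(2)[OF l\<delta>] \<rho> by (intro mult_mono) auto
      then show ?thesis using m by linarith
    qed
    then show ?thesis using d(1) \<delta> by (intro exI[of _ "min d (min \<delta> 1)"]) auto
  next
    assume "(\<sigma>2 \<longlongrightarrow> 0) (at 0)"
    then obtain d where d: "d > 0" "\<And>l. l \<noteq> 0 \<Longrightarrow> dist l 0 < d \<Longrightarrow> \<bar>\<sigma>2 l\<bar> < \<rho> powr 3" using ev by blast
    have "2 * (\<sigma>1 l powr (1/3))\<^sup>2 * \<sigma>2 l powr (1/3) \<le> \<epsilon>" if l: "l \<in> ball 0 (min d (min \<delta> 1))" "l \<noteq> 0" for l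
    proof -
      have l\<delta>: "l \<in> ball 0 \<delta>" using l by auto
      have s2: "\<sigma>2 l powr (1/3) \<le> \<rho>" using d(2)[of l] l nn l\<delta> by (intro r3) (auto simp: dist_commute)
      have "(\<sigma>1 l powr (1/3))\<^sup>2 \<le> B\<^sup>2" using B(1)[OF l\<delta>] by (intro power_mono) auto
      then have "2 * (\<sigma>1 l powr (1/3))\<^sup>2 * \<sigma>2 l powr (1/3) \<le> 2 * B\<^sup>2 * \<rho>"
        using s2 by (intro mult_mono) auto
      then show ?thesis using m by linarith
    qed
    then show ?thesis using d(1) \<delta> by (intro exI[of _ "min d (min \<delta> 1)"]) auto
  qed
qed

text \<open>The order of choices matters: \<eta> is fixed by A, then \<epsilon> by \<eta> and B to
  compensate 1 / \<eta>, and only then N large enough for the tail belonging to that \<epsilon>.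
  Each part costs a quarter of r.\<close>

lemma helicity_limit:
  fixes h b :: real and hN :: "nat \<Rightarrow> real" and \<tau> :: "real \<Rightarrow> nat \<Rightarrow> real"
  assumes le: "\<And>\<eta> \<epsilon> N. 0 < \<eta> \<Longrightarrow> \<eta> \<le> 1 \<Longrightarrow> 0 < \<epsilon> \<Longrightarrow> 1 \<le> N \<Longrightarrow> \<bar>h - hN N\<bar> \<le> \<eta> * A + 1 / \<eta> * (\<epsilon> * B + \<tau> \<epsilon> N * M)"
    and \<tau>: "\<And>\<epsilon>. 0 < \<epsilon> \<Longrightarrow> \<tau> \<epsilon> \<longlonglongrightarrow> 0" and nn: "0 \<le> A" "0 \<le> B"
  shows "hN \<longlonglongrightarrow> h"
proof (rule LIMSEQ_I)
  fix r :: real assume r: "0 < r"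
  define \<eta> where "\<eta> = min 1 (r / (4 * (A + 1)))"
  have \<eta>: "0 < \<eta>" "\<eta> \<le> 1" using r nn by (simp_all add: \<eta>_def)
  have cancel: "x / (4 * y) * y = x / 4" if "y \<noteq> 0" for x y :: real using that by simp
  have AB: "A + 1 \<noteq> 0" "B + 1 \<noteq> 0" using nn by auto
  have \<eta>A: "\<eta> * A \<le> r / 4"
  proof -
    have "\<eta> * A \<le> \<eta> * (A + 1)" using \<eta> by simp
    also have "\<dots> \<le> r / (4 * (A + 1)) * (A + 1)" using nn by (intro mult_right_mono) (auto simp: \<eta>_def)
    also have "\<dots> = r / 4" by (rule cancel) (use AB in simp)
    finally show ?thesis .
  qed
  define \<epsilon> where "\<epsilon> = \<eta> * r / (4 * (B + 1))"
  have \<epsilon>: "0 < \<epsilon>" using r nn \<eta> by (simp add: \<epsilon>_def)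
  have \<epsilon>B: "1 / \<eta> * (\<epsilon> * B) \<le> r / 4"
  proof -
    have "1 / \<eta> * (\<epsilon> * B) \<le> 1 / \<eta> * (\<epsilon> * (B + 1))" using \<eta> \<epsilon> by (intro mult_left_mono) auto
    also have "\<dots> = r / 4"
    proof -
      have "1 / \<eta> * (\<epsilon> * (B + 1)) = (1 / \<eta> * \<eta>) * (r / (4 * (B + 1)) * (B + 1))" by (simp add: \<epsilon>_def)
      also have "r / (4 * (B + 1)) * (B + 1) = r / 4"
        by (rule cancel) (use AB in simp)
      finally show ?thesis using \<eta> by simp
    qed
    finally show ?thesis .
  qed
  have "(\<lambda>N. 1 / \<eta> * (\<tau> \<epsilon> N * M)) \<longlonglongrightarrow> 1 / \<eta> * (0 * M)"
    by (intro tendsto_mult tendsto_const \<tau>[OF \<epsilon>])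
  then have "(\<lambda>N. 1 / \<eta> * (\<tau> \<epsilon> N * M)) \<longlonglongrightarrow> 0" by simp
  from LIMSEQ_D[OF this, of "r / 4"] r
  obtain n0 where n0: "\<And>N. N \<ge> n0 \<Longrightarrow> norm (1 / \<eta> * (\<tau> \<epsilon> N * M) - 0) < r / 4" by auto
  have "norm (hN N - h) < r" if N: "N \<ge> max 1 n0" for N
  proof -
    have "\<bar>h - hN N\<bar> \<le> \<eta> * A + 1 / \<eta> * (\<epsilon> * B + \<tau> \<epsilon> N * M)" using N by (intro le \<eta> \<epsilon>) auto
    also have "1 / \<eta> * (\<epsilon> * B + \<tau> \<epsilon> N * M) = 1 / \<eta> * (\<epsilon> * B) + 1 / \<eta> * (\<tau> \<epsilon> N * M)" by (rule distrib_left)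
    finally have "\<bar>h - hN N\<bar> \<le> \<eta> * A + (1 / \<eta> * (\<epsilon> * B) + 1 / \<eta> * (\<tau> \<epsilon> N * M))" .
    moreover have "\<bar>1 / \<eta> * (\<tau> \<epsilon> N * M)\<bar> < r / 4"
      using n0[of N] N unfolding real_norm_def diff_0_right by (simp only: max.bounded_iff)
    ultimately have "\<bar>h - hN N\<bar> < r" using \<eta>A \<epsilon>B r abs_ge_self[of "1 / \<eta> * (\<tau> \<epsilon> N * M)"] by linarith
    then show ?thesis by (simp add: abs_minus_commute)
  qed
  then show "\<exists>n0. \<forall>N\<ge>n0. norm (hN N - h) < r" by blast
qed

text \<open>Countably many compact intervals exhaust (0,T), and all of them contain the middle
  third. That has positive measure, so the constants coincide.\<close>

lemma constant_AE_on_open_interval: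
  fixes h :: "real \<Rightarrow> real"
  assumes T: "0 < T" and loc: "\<And>\<alpha> \<beta>. 0 < \<alpha> \<Longrightarrow> \<alpha> < \<beta> \<Longrightarrow> \<beta> < T \<Longrightarrow> \<exists>H. AE t in lebesgue_on {\<alpha>..\<beta>}. h t = H"
  shows "\<exists>H. AE t in lebesgue_on {0<..<T}. h t = H"
proof -
  \<comment> \<open>Starting the denominators at 3 makes the first interval the middle third of
    (0,T).\<close>
  define \<alpha> where "\<alpha> k = T / (real k + 3)" for k :: nat
  have \<alpha>: "0 < \<alpha> k" "\<alpha> k \<le> T / 3" for k 
    unfolding \<alpha>_def using T by (simp, intro divide_left_mono) auto
  have ab: "0 < \<alpha> k" "\<alpha> k < T - \<alpha> k" "T - \<alpha> k < T" for k using \<alpha>[of k] T by auto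
  have "\<forall>k. \<exists>H. AE t in lebesgue_on {\<alpha> k..T - \<alpha> k}. h t = H" using loc[OF ab] by blast
  then have "\<exists>H. \<forall>k. AE t in lebesgue_on {\<alpha> k..T - \<alpha> k}. h t = H k" by (simp only: choice_iff)
  then obtain H where H: "\<And>k. AE t in lebesgue_on {\<alpha> k..T - \<alpha> k}. h t = H k" by blast
  have same: "H k = H 0" for k
  proof -
    have sub: "{T / 3..T - T / 3} \<subseteq> {\<alpha> j..T - \<alpha> j}" for j using \<alpha>(2)[of j] by auto
    have "AE t in lebesgue_on {T / 3..T - T / 3}. h t = H k" "AE t in lebesgue_on {T / 3..T - T / 3}. h t = H 0"
      by (rule AE_lebesgue_on_subset[OF H sub]; simp)+
    then have "AE t in lebesgue_on {T / 3..T - T / 3}. H k = H 0" by eventually_elim simp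
    from AE_lebesgue_on_Icc_ex[OF this] T show ?thesis by auto
  qed
  have "AE t in lebesgue. \<forall>k. t \<in> {\<alpha> k..T - \<alpha> k} \<longrightarrow> h t = H 0"
    unfolding AE_all_countable
  proof
    fix k
    have "AE t in lebesgue_on {\<alpha> k..T - \<alpha> k}. h t = H 0" using H[of k] unfolding same[of k] .
    then show "AE t in lebesgue. t \<in> {\<alpha> k..T - \<alpha> k} \<longrightarrow> h t = H 0" by (simp add: AE_restrict_space_iff)
  qed
  then have "AE t in lebesgue. t \<in> {0<..<T} \<longrightarrow> h t = H 0"
  proof eventually_elim
    case (elim t)
    show ?case
    proof
      assume t: "t \<in> {0<..<T}"
      define m where "m = min t (T - t)"
      have m: "0 < m" using t by (simp add: m_def)
      obtain k :: nat where k: "T / m < real k" using reals_Archimedean2 by blast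
      have "T < real k * m" using k m by (simp add: field_simps)
      also have "\<dots> \<le> (real k + 3) * m" using m by (intro mult_right_mono) auto
      finally have "\<alpha> k \<le> m" by (simp add: \<alpha>_def field_simps)
      then have "t \<in> {\<alpha> k..T - \<alpha> k}" by (auto simp: m_def)
      then show "h t = H 0" using elim by blast
    qed
  qed
  then have "AE t in lebesgue_on {0<..<T}. h t = H 0" by (simp add: AE_restrict_space_iff)
  then show ?thesis by blast
qed

theorem corollary1p6:
  fixes T m n p q r1 r2 \<alpha> \<beta> \<delta> :: real
    and v \<omega> :: "real \<Rightarrow> real^3 \<Rightarrow> real^3"
    and C1 C2 :: "real \<Rightarrow> real"
    and \<sigma>1 \<sigma>2 :: "real^3 \<Rightarrow> real"
  assumes "0 < T"
    and "1 < m" and "1 < n" and "3 \<le> p" and "3 \<le> q"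
    and "2 / p + 1 / m = 1" and "2 / q + 1 / n = 1"
    and "euler_weak_solution T v \<omega>"
    and "in_LinfLq T (3/2) \<omega>" and "in_LpLq T m n \<omega>"
    and "in_LpLq T p q v"
    and "1 < r1" and "1 < r2" and "2 / r1 + 1 / r2 = 1"
    and "2 * \<alpha> + \<beta> \<ge> 1"
    and "integrable (lebesgue_on {0..T}) C1" and "\<forall>t\<in>{0..T}. 0 \<le> C1 t"
    and "integrable (lebesgue_on {0..T}) C2" and "\<forall>t\<in>{0..T}. 0 \<le> C2 t"
    and "0 < \<delta>"
    and "\<forall>l\<in>ball 0 \<delta>. 0 \<le> \<sigma>1 l" and "bounded (\<sigma>1 ` ball 0 \<delta>)"
    and "\<forall>l\<in>ball 0 \<delta>. 0 \<le> \<sigma>2 l" and "bounded (\<sigma>2 ` ball 0 \<delta>)"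
    and "(\<sigma>1 \<longlongrightarrow> 0) (at 0) \<or> (\<sigma>2 \<longlongrightarrow> 0) (at 0)"
    and "increment_bound T (9/2) v \<delta> C1 r1 \<alpha> \<sigma>1"
    and "increment_bound T (9/5) \<omega> \<delta> C2 r2 \<beta> \<sigma>2"
  shows "\<exists>H. AE t in lebesgue_on {0<..<T}.
    has_bochner_integral (lebesgue_on torus_cell) (\<lambda>x. v t x \<bullet> \<omega> t x) H"
proof -
  note T = \<open>0 < T\<close> and euler = \<open>euler_weak_solution T v \<omega>\<close>
  have qn: "3 \<le> q" "1 < n" "2 / q + 1 / n = 1" by fact+
  \<comment> \<open>Y and M are the majorants integrable in time: Y bounds the product of the two
    increment constants, M the total of all increments, both through the product inequality with
    exponents r1, r2 and p, m.\<close>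
  define Y where "Y t = C1 t + C2 t" for t
  define M where "M t = 128 * (Lq_norm q (v t) powr p + Lq_norm n (\<omega> t) powr m)" for t
  define h where "h t = (LINT x|torus. v t x \<bullet> \<omega> t x)" for t
  define hN where "hN N t = integral\<^sup>L torus2 (\<lambda>(x, y). ker N (x - y) * (v t x \<bullet> \<omega> t y))" for N t
  \<comment> \<open>The radius is chosen for \<epsilon> once, before any time is fixed. The tail
    \<tau> below is therefore the same for all t and survives integration in time.\<close>
  have "\<forall>\<epsilon>. \<exists>d. 0 < \<epsilon> \<longrightarrow> (0 < d \<and> d \<le> \<delta> \<and> d \<le> 1 \<and>
    (\<forall>l\<in>ball 0 d. l \<noteq> 0 \<longrightarrow> 2 * (\<sigma>1 l powr (1/3))\<^sup>2 * \<sigma>2 l powr (1/3) \<le> \<epsilon>))"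
  proof
    fix \<epsilon> :: real
    show "\<exists>d. 0 < \<epsilon> \<longrightarrow> (0 < d \<and> d \<le> \<delta> \<and> d \<le> 1 \<and>
      (\<forall>l\<in>ball 0 d. l \<noteq> 0 \<longrightarrow> 2 * (\<sigma>1 l powr (1/3))\<^sup>2 * \<sigma>2 l powr (1/3) \<le> \<epsilon>))"
    proof (cases "0 < \<epsilon>")
      case True
      show ?thesis using sigma_product_small[OF assms(20,21,23,22,24,25) True] by (elim exE) (rule exI, rule impI)
    qed simp
  qed
  then have "\<exists>d. \<forall>\<epsilon>. 0 < \<epsilon> \<longrightarrow> (0 < d \<epsilon> \<and> d \<epsilon> \<le> \<delta> \<and> d \<epsilon> \<le> 1 \<and>
    (\<forall>l\<in>ball 0 (d \<epsilon>). l \<noteq> 0 \<longrightarrow> 2 * (\<sigma>1 l powr (1/3))\<^sup>2 * \<sigma>2 l powr (1/3) \<le> \<epsilon>))"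
    by (simp only: choice_iff)
  then obtain d where d_all: "\<forall>\<epsilon>. 0 < \<epsilon> \<longrightarrow> (0 < d \<epsilon> \<and> d \<epsilon> \<le> \<delta> \<and> d \<epsilon> \<le> 1 \<and>
    (\<forall>l\<in>ball 0 (d \<epsilon>). l \<noteq> 0 \<longrightarrow> 2 * (\<sigma>1 l powr (1/3))\<^sup>2 * \<sigma>2 l powr (1/3) \<le> \<epsilon>))"
    by (rule exE)
  have d: "\<And>\<epsilon>. 0 < \<epsilon> \<Longrightarrow> 0 < d \<epsilon>" "\<And>\<epsilon>. 0 < \<epsilon> \<Longrightarrow> d \<epsilon> \<le> \<delta>" "\<And>\<epsilon>. 0 < \<epsilon> \<Longrightarrow> d \<epsilon> \<le> 1"
    "\<And>\<epsilon>. 0 < \<epsilon> \<Longrightarrow> \<forall>l\<in>ball 0 (d \<epsilon>). l \<noteq> 0 \<longrightarrow> 2 * (\<sigma>1 l powr (1/3))\<^sup>2 * \<sigma>2 l powr (1/3) \<le> \<epsilon>"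
    using d_all by simp_all
  define \<tau> where "\<tau> \<epsilon> = ker_tail (d \<epsilon>)" for \<epsilon>
  have \<tau>: "\<tau> \<epsilon> \<longlonglongrightarrow> 0" if "0 < \<epsilon>" for \<epsilon>
    unfolding \<tau>_def by (rule ker_tail_tendsto_0[OF d(1)[OF that] d(3)[OF that]])
  define good where "good t \<longleftrightarrow> t \<in> {0<..<T} \<and> in_Lq q (v t) \<and> in_Lq n (\<omega> t) \<and>
    (\<forall>l\<in>ball 0 \<delta>. in_Lq (9/2) (\<lambda>x. v t (x + l) - v t x) \<and>
        Lq_norm (9/2) (\<lambda>x. v t (x + l) - v t x) \<le> C1 t powr (1 / r1) * norm l powr \<alpha> * \<sigma>1 l powr (1 / 3)) \<and>
    (\<forall>l\<in>ball 0 \<delta>. in_Lq (9/5) (\<lambda>x. \<omega> t (x + l) - \<omega> t x) \<and>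
        Lq_norm (9/5) (\<lambda>x. \<omega> t (x + l) - \<omega> t x) \<le> C2 t powr (1 / r2) * norm l powr \<beta> * \<sigma>2 l powr (1 / 3))" for t
  have good_AE: "AE t in lebesgue_on {0<..<T}. good t"
  proof -
    have 1: "AE t in lebesgue_on {0<..<T}. in_Lq q (v t)" "AE t in lebesgue_on {0<..<T}. in_Lq n (\<omega> t)"
      using assms(10,11) by (simp_all add: in_LpLq_def)
    have sub: "{0<..<T} \<subseteq> {0..T}" by auto
    have m: "{0<..<T} \<in> sets lebesgue" "{0..T} \<in> sets lebesgue" by auto
    note 2 = AE_lebesgue_on_subset[OF \<open>increment_bound T (9/2) v \<delta> C1 r1 \<alpha> \<sigma>1\<close>[unfolded increment_bound_def] sub m]
    note 3 = AE_lebesgue_on_subset[OF \<open>increment_bound T (9/5) \<omega> \<delta> C2 r2 \<beta> \<sigma>2\<close>[unfolded increment_bound_def] sub m]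
    have 4: "AE t in lebesgue_on {0<..<T}. t \<in> {0<..<T}" by (metis AE_space space_lebesgue_on)
    show ?thesis using 1 2 3 4 by eventually_elim (unfold good_def, blast)
  qed
  have nonneg: "0 \<le> Y t" "0 \<le> M t" if "good t" for t
    using that assms(17,19) by (auto simp: Y_def M_def good_def)
  have tf: "torus_fields (v t) (\<omega> t)" if "good t" for t
    using torus_fields_Lq(1)[OF _ _ qn] that by (auto simp: good_def)
  have inc: "torus_fields.increments (v t) (\<omega> t) (\<lambda>l. ennreal (norm (gker N l))) \<le> ennreal (\<epsilon> * Y t * 36 + \<tau> \<epsilon> N * M t)"
      "torus_fields.increments (v t) (\<omega> t) (\<lambda>l. ennreal (ker N l)) \<le> ennreal (\<epsilon> * Y t * 2 + \<tau> \<epsilon> N * M t)"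
    if g: "good t" and \<epsilon>: "0 < \<epsilon>" and N: "1 \<le> N" for t \<epsilon> N
  proof -
    have t: "t \<in> {0<..<T}" "in_Lq q (v t)" "in_Lq n (\<omega> t)" using g by (auto simp: good_def)
    have per: "torus_periodic (v t)" "torus_periodic (\<omega> t)"
      using euler t(1) unfolding euler_weak_solution_def by blast+
    have C: "0 \<le> C1 t" "0 \<le> C2 t" using assms(17,19) t(1) by auto
    have Yle: "(C1 t powr (1 / r1))\<^sup>2 * C2 t powr (1 / r2) \<le> Y t"
      using square_mult_le_powr_sum[of "C1 t powr (1 / r1)" "C2 t powr (1 / r2)" r1 r2] C assms(12,13,14)
      by (simp add: Y_def powr_powr)
    have "(Lq_norm q (v t))\<^sup>2 * Lq_norm n (\<omega> t) \<le> Lq_norm q (v t) powr p + Lq_norm n (\<omega> t) powr m"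
      by (rule square_mult_le_powr_sum) (use assms(2,4,6) in auto)
    then have Mle: "128 * (Lq_norm q (v t))\<^sup>2 * Lq_norm n (\<omega> t) \<le> M t" by (simp add: M_def)
    have nnp: "0 \<le> C1 t powr (1 / r1)" "0 \<le> C2 t powr (1 / r2)" "\<And>l. 0 \<le> \<sigma>1 l powr (1 / 3)" "\<And>l. 0 \<le> \<sigma>2 l powr (1 / 3)" by auto
    have inc: "\<forall>l\<in>ball 0 \<delta>. in_Lq (9/2) (\<lambda>x. v t (x + l) - v t x) \<and>
        Lq_norm (9/2) (\<lambda>x. v t (x + l) - v t x) \<le> C1 t powr (1 / r1) * norm l powr \<alpha> * \<sigma>1 l powr (1 / 3)"
      "\<forall>l\<in>ball 0 \<delta>. in_Lq (9/5) (\<lambda>x. \<omega> t (x + l) - \<omega> t x) \<and>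
        Lq_norm (9/5) (\<lambda>x. \<omega> t (x + l) - \<omega> t x) \<le> C2 t powr (1 / r2) * norm l powr \<beta> * \<sigma>2 l powr (1 / 3)"
      using g unfolding good_def by blast+
    show "torus_fields.increments (v t) (\<omega> t) (\<lambda>l. ennreal (norm (gker N l))) \<le> ennreal (\<epsilon> * Y t * 36 + \<tau> \<epsilon> N * M t)"
      unfolding \<tau>_def
      by (rule kernel_increments(1)[OF per t(2,3) qn inc assms(15) nnp Yle d(1)[OF \<epsilon>] d(2)[OF \<epsilon>] d(3)[OF \<epsilon>]
            d(4)[OF \<epsilon>] less_imp_le[OF \<epsilon>] Mle N])
    show "torus_fields.increments (v t) (\<omega> t) (\<lambda>l. ennreal (ker N l)) \<le> ennreal (\<epsilon> * Y t * 2 + \<tau> \<epsilon> N * M t)"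
      unfolding \<tau>_def
      by (rule kernel_increments(2)[OF per t(2,3) qn inc assms(15) nnp Yle d(1)[OF \<epsilon>] d(2)[OF \<epsilon>] d(3)[OF \<epsilon>]
            d(4)[OF \<epsilon>] less_imp_le[OF \<epsilon>] Mle N])
  qed
  have \<tau>0: "0 \<le> \<tau> \<epsilon> N" if "0 < \<epsilon>" for \<epsilon> N
    unfolding \<tau>_def ker_tail_def using cos_pi_half_interval[of "d \<epsilon> / 3"] d(1,3)[OF that] by simp
  have lim: "(\<lambda>N. hN N t) \<longlonglongrightarrow> h t" if g: "good t" for t
  proof (rule helicity_limit)
    interpret torus_fields "v t" "\<omega> t" by (rule tf[OF g])
    show "0 \<le> (LINT x|torus. norm (\<omega> t x))" by simp
    show "0 \<le> 2 * Y t" using nonneg[OF g] by simp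
    show "\<tau> \<epsilon> \<longlonglongrightarrow> 0" if "0 < \<epsilon>" for \<epsilon> by (rule \<tau>[OF that])
    fix \<eta> \<epsilon> :: real and N :: nat
    assume \<eta>: "0 < \<eta>" "\<eta> \<le> 1" and \<epsilon>: "0 < \<epsilon>" and N: "1 \<le> N"
    have "ennreal \<bar>h t - hN N t\<bar> \<le> ennreal (\<eta> * (LINT x|torus. norm (\<omega> t x))) + ennreal (1 / \<eta>) * increments (\<lambda>l. ennreal (ker N l))"
      unfolding h_def hN_def
      by (rule helicity_approximation(2)[OF ker_continuous ker_nonneg ker_even ker_integral[OF N] \<eta>(1)])
    also have "\<dots> \<le> ennreal (\<eta> * (LINT x|torus. norm (\<omega> t x))) + ennreal (1 / \<eta>) * ennreal (\<epsilon> * Y t * 2 + \<tau> \<epsilon> N * M t)"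
      by (intro add_left_mono mult_left_mono inc(2)[OF g \<epsilon> N]) auto
    also have "\<dots> = ennreal (\<eta> * (LINT x|torus. norm (\<omega> t x)) + 1 / \<eta> * (\<epsilon> * Y t * 2 + \<tau> \<epsilon> N * M t))"
      using \<eta> \<epsilon> nonneg[OF g] \<tau>0[OF \<epsilon>, of N] by (simp add: ennreal_mult'[symmetric] ennreal_plus[symmetric] del: ennreal_plus)
    finally have "\<bar>h t - hN N t\<bar> \<le> \<eta> * (LINT x|torus. norm (\<omega> t x)) + 1 / \<eta> * (\<epsilon> * Y t * 2 + \<tau> \<epsilon> N * M t)"
      using \<eta> \<epsilon> nonneg[OF g] \<tau>0[OF \<epsilon>, of N] by (subst (asm) ennreal_le_iff) auto
    then show "\<bar>h t - hN N t\<bar> \<le> \<eta> * (LINT x|torus. norm (\<omega> t x)) + 1 / \<eta> * (\<epsilon> * (2 * Y t) + \<tau> \<epsilon> N * M t)"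
      by (simp add: mult_ac)
  qed
  have iY: "integrable (lebesgue_on {0..T}) Y" unfolding Y_def using assms(16,18) by simp
  have iM: "integrable (lebesgue_on {0<..<T}) M"
    unfolding M_def using assms(10,11) by (simp add: in_LpLq_def)
  have "\<exists>H. AE t in lebesgue_on {\<alpha>'..\<beta>'}. h t = H" if ab: "0 < \<alpha>'" "\<alpha>' < \<beta>'" "\<beta>' < T" for \<alpha>' \<beta>'
  proof -
    let ?L = "lebesgue_on {\<alpha>'..\<beta>'}"
    have gAE: "AE t in ?L. good t" by (rule AE_lebesgue_on_subset[OF good_AE]) (use ab in auto)
    have iYM: "integrable ?L Y" "integrable ?L M"
      by (rule integrable_lebesgue_on_subset[OF iY], use ab in auto, rule integrable_lebesgue_on_subset[OF iM], use ab in auto)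
    have tfAE: "AE t in lebesgue_on {0<..<T}. torus_fields (v t) (\<omega> t)" using good_AE by eventually_elim (rule tf)
    have "\<forall>N. \<exists>c S. 1 \<le> N \<longrightarrow> (integrable ?L S \<and> (AE t in ?L. hN N t = c + integral\<^sup>L (lebesgue_on {\<alpha>'..t}) S) \<and>
      (AE t in ?L. torus_flux (v t) (\<omega> t) (gker N) \<and> S t = torus_flux.flux (v t) (\<omega> t) (gker N)))"
      using mollified_helicity_balance[OF euler _ ab tfAE] unfolding hN_def by blast
    then have "\<exists>c S. \<forall>N. 1 \<le> N \<longrightarrow> (integrable ?L (S N) \<and> (AE t in ?L. hN N t = c N + integral\<^sup>L (lebesgue_on {\<alpha>'..t}) (S N)) \<and>
      (AE t in ?L. torus_flux (v t) (\<omega> t) (gker N) \<and> S N t = torus_flux.flux (v t) (\<omega> t) (gker N)))"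
      by (simp only: choice_iff)
    then obtain c S where S: "\<And>N. 1 \<le> N \<Longrightarrow> integrable ?L (S N)"
      "\<And>N. 1 \<le> N \<Longrightarrow> AE t in ?L. hN N t = c N + integral\<^sup>L (lebesgue_on {\<alpha>'..t}) (S N)"
      "\<And>N. 1 \<le> N \<Longrightarrow> AE t in ?L. torus_flux (v t) (\<omega> t) (gker N) \<and> S N t = torus_flux.flux (v t) (\<omega> t) (gker N)"
      by blast
    define I where "I N = (LINT t|?L. \<bar>S N t\<bar>)" for N
    have I_le: "I N \<le> \<epsilon> * (36 * (LINT t|?L. Y t)) + \<tau> \<epsilon> N * (LINT t|?L. M t)" if N: "1 \<le> N" and \<epsilon>: "0 < \<epsilon>" for N \<epsilon>
    proof -
      have "I N \<le> (LINT t|?L. \<epsilon> * 36 * Y t + \<tau> \<epsilon> N * M t)"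
        unfolding I_def
      proof (rule integral_mono_AE)
        show "integrable ?L (\<lambda>t. \<bar>S N t\<bar>)" using S(1)[OF N] by simp
        show "integrable ?L (\<lambda>t. \<epsilon> * 36 * Y t + \<tau> \<epsilon> N * M t)" using iYM by simp
        show "AE t in ?L. \<bar>S N t\<bar> \<le> \<epsilon> * 36 * Y t + \<tau> \<epsilon> N * M t"
          using gAE S(3)[OF N]
        proof eventually_elim
          case (elim t)
          interpret torus_flux "v t" "\<omega> t" "gker N" using elim by blast
          have "ennreal \<bar>S N t\<bar> \<le> increments (\<lambda>l. ennreal (norm (gker N l)))" using flux_bound elim by simp
          also have "\<dots> \<le> ennreal (\<epsilon> * Y t * 36 + \<tau> \<epsilon> N * M t)" by (rule inc(1)[OF elim(1) \<epsilon> N])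
          finally have "\<bar>S N t\<bar> \<le> \<epsilon> * Y t * 36 + \<tau> \<epsilon> N * M t"
            using \<epsilon> nonneg[OF elim(1)] \<tau>0[OF \<epsilon>, of N] by (subst (asm) ennreal_le_iff) auto
          then show ?case by (simp add: mult_ac)
        qed
      qed
      also have "\<dots> = \<epsilon> * (36 * (LINT t|?L. Y t)) + \<tau> \<epsilon> N * (LINT t|?L. M t)" using iYM by simp
      finally show ?thesis .
    qed
    have IY: "0 \<le> (LINT t|?L. Y t)"
      by (rule integral_nonneg_AE) (rule eventually_mono[OF gAE nonneg(1)])
    \<comment> \<open>The limit lemma serves again, with limit 0 and A = 0. As \<eta> \<le> 1, a
      nonnegative bound only grows under the factor 1 / \<eta>.\<close>
    have I0: "I \<longlonglongrightarrow> 0"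
    proof (rule helicity_limit[where A = 0])
      fix \<eta> \<epsilon> :: real and N :: nat assume as: "0 < \<eta>" "\<eta> \<le> 1" "0 < \<epsilon>" "1 \<le> N"
      have I0: "0 \<le> I N" by (simp add: I_def)
      show "\<bar>0 - I N\<bar> \<le> \<eta> * 0 + 1 / \<eta> * (\<epsilon> * (36 * (LINT t|?L. Y t)) + \<tau> \<epsilon> N * (LINT t|?L. M t))"
      proof -
        let ?X = "\<epsilon> * (36 * (LINT t|?L. Y t)) + \<tau> \<epsilon> N * (LINT t|?L. M t)"
        have le: "I N \<le> ?X" by (rule I_le[OF as(4,3)])
        then have "0 \<le> ?X" using I0 by linarith
        moreover have "1 \<le> 1 / \<eta>" using as by simp
        ultimately have "1 * ?X \<le> 1 / \<eta> * ?X" by (rule mult_right_mono[rotated])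
        then show ?thesis using le I0 by simp
      qed
    qed (use IY \<tau> in auto)
    \<comment> \<open>On the whole interval the mollified helicity stays within the L1 norm of its
      derivative of the constant c N. The exceptional set is made common to all N by
      countability.\<close>
    have near: "AE t in ?L. \<forall>N. 1 \<le> N \<longrightarrow> \<bar>hN N t - c N\<bar> \<le> I N"
      unfolding AE_all_countable
    proof
      fix N
      show "AE t in ?L. 1 \<le> N \<longrightarrow> \<bar>hN N t - c N\<bar> \<le> I N"
      proof (cases "1 \<le> N")
        case True
        have "AE t in ?L. t \<in> {\<alpha>'..\<beta>'}" by (metis AE_space space_lebesgue_on)
        with S(2)[OF True] show ?thesis
        proof eventually_elim
          case (elim t)
          then show ?case unfolding I_def using integrable_indefinite_integral(2)[OF S(1)[OF True], of t] by simp
        qed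
      qed simp
    qed
    \<comment> \<open>The sequence c does not depend on t but converges to the helicity at almost
      every t, so uniqueness of limits makes the helicity constant.\<close>
    have cl: "c \<longlonglongrightarrow> h t" if "good t" "\<forall>N. 1 \<le> N \<longrightarrow> \<bar>hN N t - c N\<bar> \<le> I N" for t
    proof -
      have "(\<lambda>N. hN N t - c N) \<longlonglongrightarrow> 0"
        by (rule Lim_null_comparison[OF _ I0]) (use that(2) in \<open>auto simp: eventually_sequentially intro!: exI[of _ 1]\<close>)
      from tendsto_diff[OF lim[OF that(1)] this] show ?thesis by simp
    qed
    have both: "AE t in ?L. c \<longlonglongrightarrow> h t" using gAE near by eventually_elim (rule cl)
    then obtain t0 where t0: "c \<longlonglongrightarrow> h t0" using AE_lebesgue_on_Icc_ex[OF both ab(2)] by blast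
    have "AE t in ?L. h t = h t0" by (rule eventually_mono[OF both]) (rule LIMSEQ_unique[OF _ t0])
    then show ?thesis by blast
  qed
  from constant_AE_on_open_interval[OF T this] obtain H where H: "AE t in lebesgue_on {0<..<T}. h t = H" by blast
  have "AE t in lebesgue_on {0<..<T}. has_bochner_integral torus (\<lambda>x. v t x \<bullet> \<omega> t x) H"
    using H good_AE
  proof eventually_elim
    case (elim t)
    interpret torus_fields "v t" "\<omega> t" by (rule tf[OF elim(2)])
    have "integrable torus (\<lambda>x. v t x \<bullet> \<omega> t x)"
      by (rule Bochner_Integration.integrable_bound[OF vw]) (auto intro!: AE_I2 Cauchy_Schwarz_ineq2)
    then show ?case using elim(1) by (simp add: has_bochner_integral_iff h_def)
  qed
  then show ?thesis by blast
qed

end
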